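(* Let $\alpha\in\mathbb Z$. Then for $\theta_1,\theta_2\in\mathbb C$ with $\theta_1\neq\theta_2$, \begin{align*} &\mathrm{gen}\!\int_0^\infty U_{\theta_1,\alpha}(z)\,U_{\theta_2,\alpha}(z)\,e^{-z}z^\alpha\,dz\\ &=\frac{(-1)^\alpha}{\theta_1-\theta_2}\Bigg(\frac{\psi\big(\frac{1+\theta_1+\alpha}{2}\big)+\psi\big(\frac{1+\theta_1-\alpha}{2}\big)}{\Gamma\big(\frac{1+\theta_1-|\alpha|}{2}\big)\Gamma\big(\frac{1+\theta_2+|\alpha|}{2}\big)}-\frac{\psi\big(\frac{1+\theta_2+\alpha}{2}\big)+\psi\big(\frac{1+\theta_2-\alpha}{2}\big)}{\Gamma\big(\frac{1+\theta_2-|\alpha|}{2}\big)\Gamma\big(\frac{1+\theta_1+|\alpha|}{2}\big)}\Bigg)\\ &\quad+\frac{(-1)^\alpha}{\Gamma\big(\frac{1+\theta_1+|\alpha|}{2}\big)\Gamma\big(\frac{1+\theta_2+|\alpha|}{2}\big)}\sum_{k=0}^{|\alpha|-1}\big(\tfrac{1+\theta_1-|\alpha|}{2}\big)_k\big(\tfrac{3+\theta_2-|\alpha|}{2}+k\big)_{|\alpha|-1-k}\\ &\qquad\times\Big(-\psi(|\alpha|-k)-\psi(k+1)+\tfrac12H_k\big(\tfrac{1+\theta_1-|\alpha|}{2}\big)-\tfrac12H_{|\alpha|-1-k}\big(\tfrac{3+\theta_2-|\alpha|}{2}+k\big)\Big), \end{align*} and for $\theta\in\mathbb C$, \begin{align*}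 &\mathrm{gen}\!\int_0^\infty U_{\theta,\alpha}(z)^2\,e^{-z}z^\alpha\,dz\\ &=\frac{(-1)^\alpha}{2\,\Gamma\big(\frac{1+\theta+\alpha}{2}\big)\Gamma\big(\frac{1+\theta-\alpha}{2}\big)}\Bigg(\psi\big(\tfrac{1+\theta+|\alpha|}{2}\big)^2-\psi\big(\tfrac{1+\theta-|\alpha|}{2}\big)^2+\psi'\big(\tfrac{1+\theta+\alpha}{2}\big)+\psi'\big(\tfrac{1+\theta-\alpha}{2}\big)\\ &\hspace{12em}-2\sum_{k=0}^{|\alpha|-1}\frac{\psi(|\alpha|-k)+\psi(k+1)}{\frac{1+\theta-|\alpha|}{2}+k}\Bigg). \end{align*}
   Context: Tricomi's confluent function in Lie-algebraic parameters: for $\theta,\alpha\in\mathbb C$ and $z>0$, $U_{\theta,\alpha}(z):=U\big(\tfrac{1+\alpha+\theta}{2};1+\alpha;z\big)$, where $U(a;c;z)$ is the standard Tricomi confluent hypergeometric function, i.e. the solution of $zf''+(c-z)f'-af=0$ with $U(a;c;z)\sim z^{-a}$ as $z\to+\infty$ (equivalently $U(a;c;z)=z^{-a}\,{}_2F_0(a,1+a-c;-;-z^{-1})$). $\Gamma$ is the Gamma function, $\psi=\Gamma'/\Gamma$ is the digamma function and $\psi'$ its derivative. For $k\in\mathbb N_0$: $(a)_k=a(a+1)\cdots(a+k-1)$ is the Pochhammer symbol and $H_k(a)=\sum_{j=0}^{k-1}\frac1{a+j}$. Empty products are $1$, empty sums are $0$. Generalized integral: a function $f$ on $]0,\infty[$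 is integrable in the generalized sense if it is integrable on $]1,\infty[$ and there exist a finite set $\Omega\subset\mathbb C$ and complex coefficients $(f_k)_{k\in\Omega}$ such that $f-\sum_{k\in\Omega}f_kr^k$ is integrable on $]0,1[$. For such $f$, $$\mathrm{gen}\!\int_0^\infty f(r)\,dr:=\sum_{k\in\Omega\setminus\{-1\}}\frac{f_k}{k+1}+\int_0^1\Big(f(r)-\sum_{k\in\Omega}f_kr^k\Big)dr+\int_1^\infty f(r)\,dr,$$ which does not depend on the choice of $\Omega$. For special values of $\theta_1,\theta_2,\theta$ at which individual terms on the right-hand sides are singular (form "$0$ divided by $0$"), the singularities are only apparent and the right-hand sides are understood as their limits (analytic continuation in the parameters). *)

theory Defs
  imports "HOL-Analysis.Analysis" "HOL-Library.Landau_Symbols"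
begin

text \<open>
  On \<open>z > 0\<close> the asymptotics \<open>U(a;c;z) \<sim> z\<^sup>-\<^sup>a\<close> single out Tricomi's function among the solutions
  of Kummer's equation: solutions that are not multiples of it grow like \<open>exp z * z powr (a - c)\<close>. The clause fixing the values at \<open>z \<le> 0\<close> only
  serves to make the description unique as a total function on the reals.
\<close>

definition is_Tricomi_U :: "complex \<Rightarrow> complex \<Rightarrow> (real \<Rightarrow> complex) \<Rightarrow> bool" where
  "is_Tricomi_U a c f \<longleftrightarrow>
     (\<exists>f' f''. \<forall>z>0.
        (f has_vector_derivative f' z) (at z) \<and>
        (f' has_vector_derivative f'' z) (at z) \<and>
        of_real z * f'' z + (c - of_real z) * f' z - a * f z = 0) \<and>
     f \<sim>[at_top] (\<lambda>z. of_real z powr (- a)) \<and>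
     (\<forall>z\<le>0. f z = 0)"

definition Tricomi_U :: "complex \<Rightarrow> complex \<Rightarrow> real \<Rightarrow> complex" where
  "Tricomi_U a c = (THE f. is_Tricomi_U a c f)"

definition Tricomi_U_Lie :: "complex \<Rightarrow> complex \<Rightarrow> real \<Rightarrow> complex" where
  "Tricomi_U_Lie \<theta> \<alpha> z = Tricomi_U ((1 + \<alpha> + \<theta>) / 2) (1 + \<alpha>) z"

definition shifted_harm :: "nat \<Rightarrow> complex \<Rightarrow> complex" where
  "shifted_harm k a = (\<Sum>j<k. 1 / (a + of_nat j))"

definition has_gen_integral :: "(real \<Rightarrow> complex) \<Rightarrow> complex \<Rightarrow> bool" where
  "has_gen_integral f I \<longleftrightarrow>
     set_integrable lebesgue {1<..} f \<and>
     (\<exists>\<Omega> c. finite \<Omega> \<and>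
        set_integrable lebesgue {0<..<1} (\<lambda>r. f r - (\<Sum>k\<in>\<Omega>. c k * of_real r powr k)) \<and>
        I = (\<Sum>k\<in>\<Omega> - {-1}. c k / (k + 1))
            + (LINT r:{0<..<1}|lebesgue. f r - (\<Sum>k\<in>\<Omega>. c k * of_real r powr k))
            + (LINT r:{1<..}|lebesgue. f r))"

definition gen_integrable :: "(real \<Rightarrow> complex) \<Rightarrow> bool" where
  "gen_integrable f \<longleftrightarrow> (\<exists>I. has_gen_integral f I)"

text \<open>The value does not depend on the choice of \<open>\<Omega>\<close> and of the coefficients.\<close>

definition gen_integral :: "(real \<Rightarrow> complex) \<Rightarrow> complex" where
  "gen_integral f = (THE I. has_gen_integral f I)"

text \<open>
  \<open>continued_value F S p v\<close>: \<open>v\<close> is the value at \<open>p\<close> of the expression \<open>F\<close>, whose individual terms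
  are nonsingular exactly on \<open>S\<close>; outside \<open>S\<close> the value is understood as the limit of \<open>F\<close> along \<open>S\<close>.
  Isabelle's totalised conventions (such as \<open>x / 0 = 0\<close>) give \<open>F\<close> meaningless values outside \<open>S\<close>,
  and these play no role. The first conjunct excludes a vacuous limit.
\<close>

definition continued_value ::
    "('a::topological_space \<Rightarrow> complex) \<Rightarrow> 'a set \<Rightarrow> 'a \<Rightarrow> complex \<Rightarrow> bool" where
  "continued_value F S p v \<longleftrightarrow>
     p islimpt S \<and> (F \<longlongrightarrow> v) (at p within S) \<and> (p \<in> S \<longrightarrow> F p = v)"

text \<open>
  The parameters \<open>\<theta>\<close> for which no digamma argument below is a pole. For these also all the
  denominators in the finite sums are nonzero, since they have the form
  \<open>(1 + \<theta> - \<bar>\<alpha>\<bar>) / 2 + j\<close> with a natural number \<open>j\<close>. The reciprocals of \<open>Gamma\<close> need no exclusion: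
  at a pole, \<open>Gamma\<close> is \<open>0\<close> by convention, so \<open>1 / Gamma\<close> has its correct value \<open>0\<close>.
\<close>

definition regular_params :: "int \<Rightarrow> complex set" where
  "regular_params \<alpha> = {\<theta>. (1 + \<theta> + of_int \<alpha>) / 2 \<notin> \<int>\<^sub>\<le>\<^sub>0 \<and> (1 + \<theta> - of_int \<alpha>) / 2 \<notin> \<int>\<^sub>\<le>\<^sub>0}"

definition regular_param_pairs :: "int \<Rightarrow> (complex \<times> complex) set" where
  "regular_param_pairs \<alpha> =
     {(\<theta>1, \<theta>2). \<theta>1 \<noteq> \<theta>2 \<and> \<theta>1 \<in> regular_params \<alpha> \<and> \<theta>2 \<in> regular_params \<alpha>}"

definition gen_int_rhs_offdiag :: "int \<Rightarrow> complex \<Rightarrow> complex \<Rightarrow> complex" where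
  "gen_int_rhs_offdiag \<alpha> \<theta>1 \<theta>2 =
    (let a = of_int \<alpha>; m = nat \<bar>\<alpha>\<bar>; b = of_nat m in
       (-1) powi \<alpha> / (\<theta>1 - \<theta>2) *
         ((Digamma ((1 + \<theta>1 + a) / 2) + Digamma ((1 + \<theta>1 - a) / 2))
            / (Gamma ((1 + \<theta>1 - b) / 2) * Gamma ((1 + \<theta>2 + b) / 2))
        - (Digamma ((1 + \<theta>2 + a) / 2) + Digamma ((1 + \<theta>2 - a) / 2))
            / (Gamma ((1 + \<theta>2 - b) / 2) * Gamma ((1 + \<theta>1 + b) / 2)))
     + (-1) powi \<alpha> / (Gamma ((1 + \<theta>1 + b) / 2) * Gamma ((1 + \<theta>2 + b) / 2)) *
         (\<Sum>k<m. pochhammer ((1 + \<theta>1 - b) / 2) k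
                * pochhammer ((3 + \<theta>2 - b) / 2 + of_nat k) (m - 1 - k)
                * (- Digamma (of_nat (m - k)) - Digamma (of_nat (k + 1))
                   + 1 / 2 * shifted_harm k ((1 + \<theta>1 - b) / 2)
                   - 1 / 2 * shifted_harm (m - 1 - k) ((3 + \<theta>2 - b) / 2 + of_nat k))))"

definition gen_int_rhs_diag :: "int \<Rightarrow> complex \<Rightarrow> complex" where
  "gen_int_rhs_diag \<alpha> \<theta> =
    (let a = of_int \<alpha>; m = nat \<bar>\<alpha>\<bar>; b = of_nat m in
       (-1) powi \<alpha> / (2 * Gamma ((1 + \<theta> + a) / 2) * Gamma ((1 + \<theta> - a) / 2)) *
         ((Digamma ((1 + \<theta> + b) / 2))\<^sup>2 - (Digamma ((1 + \<theta> - b) / 2))\<^sup>2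
          + Polygamma 1 ((1 + \<theta> + a) / 2) + Polygamma 1 ((1 + \<theta> - a) / 2)
          - 2 * (\<Sum>k<m. (Digamma (of_nat (m - k)) + Digamma (of_nat (k + 1)))
                         / ((1 + \<theta> - b) / 2 + of_nat k))))"

end

theory Submission
  imports Defs "HOL-Complex_Analysis.Complex_Analysis" "HOL-Real_Asymp.Real_Asymp"
begin

text \<open>
  Kummer's transformation \<open>U(a - m; 1 - m; z) = z ^ m * U(a; 1 + m; z)\<close> shows that the integrand does
  not change under \<open>\<alpha> \<mapsto> - \<alpha>\<close>, so let \<open>\<alpha> = m \<ge> 0\<close>. Put \<open>a = (1 + \<theta> + m) / 2\<close> and
  \<open>f m a z = U(a; m + 1; z)\<close>. Everything rests on two first-order relations:
  \<open>exp (- z) * f m a z\<close> is a primitive of \<open>- exp (- z) * f (m + 1) a z\<close>, and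
  \<open>z ^ (m + 1) * f (m + 1) a z\<close> is a primitive of \<open>(m + 1 - a) * z ^ m * f m a z\<close>.

  Let \<open>J m\<close> be the generalized integral of \<open>z ^ m * exp (- z) * f m a z * f m b z\<close>. Integration by
  parts with the two relations gives \<open>J (m + 1) = (m + 1 - a) * J m + \<beta> m\<close>. The generalized integral
  discards powers and logarithms at \<open>0\<close>, so \<open>\<beta> m\<close> is the constant term in the asymptotic expansion at
  \<open>0\<close> of \<open>z ^ (m + 1) * f (m + 1) a z * exp (- z) * f m b z\<close> (lemma \<open>has_gen_integral_Suc\<close>). The right-hand
  sides of the theorem obey the same recursion (\<open>offdiag_val_regular\<close>, \<open>diag_val_regular\<close>).
  For \<open>m = 0\<close> and \<open>a \<noteq> b\<close> the Wronskian of the two functions yields \<open>J 0\<close> (\<open>has_gen_integral_0\<close>); the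
  case \<open>a = b\<close> is the limit \<open>b \<rightarrow> a\<close> when \<open>Re a > 2\<close>, and a lowering relation in \<open>a\<close> carries it to
  all \<open>a\<close> (\<open>tri_u_square_integral\<close>, \<open>square_integral_lower\<close>).

  The expansions at \<open>0\<close> follow by integrating the same two relations, starting from
  \<open>U(a; 1; z) = - rGamma a * ln z + M + o(1)\<close>. The constant \<open>M\<close> carries the digamma function. It is found for
  \<open>Re a > 2\<close> from the Laplace integral: the Mellin transform of \<open>U(a; 1; z)\<close> is
  \<open>(Gamma s * rGamma a)\<^sup>2 * Gamma (a - s)\<close>, and \<open>M\<close> is the coefficient of \<open>1 / s\<close> in it (\<open>tri_u_constants\<close>).
  The lowering relation again extends this to all \<open>a\<close>. Uniqueness of the solution with leading term
  \<open>z powr (- a)\<close> identifies these functions with Tricomi's (\<open>kummer_solution_unique\<close>).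

  Finally, the recursion for \<open>J m\<close> involves only polynomials, \<open>rGamma\<close> and its derivatives, which are
  entire. So the integrals are continuous in the parameters, and at the apparent singularities of
  the closed forms they are the limits of those forms.
\<close>

section \<open>Generalized integrals\<close>

lemma continuous_bounded_imp_absolutely_integrable:
  fixes f :: "real \<Rightarrow> complex" and g :: "real \<Rightarrow> real"
  assumes "continuous_on S f" "S \<in> sets borel" "g integrable_on S" "\<And>x. x \<in> S \<Longrightarrow> norm (f x) \<le> g x"
  shows "f absolutely_integrable_on S"
  using assms continuous_imp_measurable_on_sets_lebesgue[of S f]
  by (intro measurable_bounded_by_integrable_imp_absolutely_integrable) auto

lemma FTC_absolutely_integrable:
  fixes f F :: "real \<Rightarrow> complex" and a b :: ereal
  assumes "a < b"
    and F: "\<And>x. x \<in> einterval a b \<Longrightarrow> (F has_vector_derivative f x) (at x)"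
    and f: "continuous_on (einterval a b) f"
    and int: "f absolutely_integrable_on einterval a b"
    and A: "((F \<circ> real_of_ereal) \<longlongrightarrow> A) (at_right a)"
    and B: "((F \<circ> real_of_ereal) \<longlongrightarrow> B) (at_left b)"
  shows "(LINT x:einterval a b|lebesgue. f x) = B - A"
proof -
  let ?g = "\<lambda>x. indicat_real (einterval a b) x *\<^sub>R f x"
  have meas: "?g \<in> borel_measurable lborel"
    using borel_measurable_continuous_on_indicator[OF _ f] by simp
  have int': "set_integrable lborel (einterval a b) f"
    using int meas unfolding set_integrable_def by (simp add: integrable_completion)
  have "(LBINT x=a..b. f x) = B - A"
    using \<open>a < b\<close> F f int' A B
    by (intro interval_integral_FTC_integrable)
       (auto simp: einterval_iff continuous_on_eq_continuous_at)
  also have "(LBINT x=a..b. f x) = (LINT x:einterval a b|lebesgue. f x)"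
    using \<open>a < b\<close> meas
    by (simp add: interval_lebesgue_integral_def set_lebesgue_integral_def integral_completion)
  finally show ?thesis .
qed

lemma einterval_0_1: "einterval 0 1 = {0<..<1}"
  and einterval_1_inf: "einterval 1 \<infinity> = {1<..}"
  and einterval_0_inf: "einterval 0 \<infinity> = {0<..}"
  by (auto simp: einterval_iff)

lemma FTC_Ioo_0_1:
  fixes f F :: "real \<Rightarrow> complex"
  assumes "\<And>x. x \<in> {0<..<1} \<Longrightarrow> (F has_vector_derivative f x) (at x)"
    "continuous_on {0<..<1} f" "f absolutely_integrable_on {0<..<1}"
    "(F \<longlongrightarrow> A) (at_right 0)" "(F \<longlongrightarrow> B) (at_left 1)"
  shows "(LINT x:{0<..<1}|lebesgue. f x) = B - A"
  using FTC_absolutely_integrable[of 0 1 F f A B] assms unfolding einterval_0_1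
  by (simp add: zero_ereal_def one_ereal_def ereal_tendsto_simps del: ereal_eq_0 ereal_eq_1)

lemma FTC_Ioi_1:
  fixes f F :: "real \<Rightarrow> complex"
  assumes "\<And>x. x \<in> {1<..} \<Longrightarrow> (F has_vector_derivative f x) (at x)"
    "continuous_on {1<..} f" "f absolutely_integrable_on {1<..}"
    "(F \<longlongrightarrow> A) (at_right 1)" "(F \<longlongrightarrow> B) at_top"
  shows "(LINT x:{1<..}|lebesgue. f x) = B - A"
  using FTC_absolutely_integrable[of 1 \<infinity> F f A B] assms unfolding einterval_1_inf
  by (simp add: one_ereal_def ereal_tendsto_simps del: ereal_eq_0 ereal_eq_1)

lemma FTC_Ioi_0:
  fixes f F :: "real \<Rightarrow> complex"
  assumes "\<And>x. x \<in> {0<..} \<Longrightarrow> (F has_vector_derivative f x) (at x)"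
    "continuous_on {0<..} f" "f absolutely_integrable_on {0<..}"
    "(F \<longlongrightarrow> A) (at_right 0)" "(F \<longlongrightarrow> B) at_top"
  shows "(LINT x:{0<..}|lebesgue. f x) = B - A"
  using FTC_absolutely_integrable[of 0 \<infinity> F f A B] assms unfolding einterval_0_inf
  by (simp add: zero_ereal_def ereal_tendsto_simps del: ereal_eq_0 ereal_eq_1)

lemma norm_of_real_powr: "x > 0 \<Longrightarrow> norm (of_real x powr w :: complex) = x powr Re w"
  by (simp add: norm_powr_real_powr)

lemma has_vector_derivative_of_real_powr:
  assumes "x > 0"
  shows "((\<lambda>x. of_real x powr w :: complex) has_vector_derivative w * of_real x powr (w - 1)) (at x)"
proof -
  have "((\<lambda>z. z powr w) has_field_derivative w * of_real x powr (w - 1)) (at (of_real x :: complex))"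
    using assms by (intro has_field_derivative_powr) auto
  from has_vector_derivative_real_field[OF this] show ?thesis .
qed

lemma continuous_on_of_real_powr [continuous_intros]:
  fixes w :: "real \<Rightarrow> complex"
  assumes "continuous_on S g" "continuous_on S w" "\<And>x. x \<in> S \<Longrightarrow> g x > (0::real)"
  shows "continuous_on S (\<lambda>x. of_real (g x) powr w x :: complex)"
  using assms by (intro continuous_on_powr_complex continuous_intros)
     (auto simp: complex_nonpos_Reals_iff dest: assms(3))

lemma powr_absolutely_integrable_Ioo:
  assumes "Re w > -1"
  shows "(\<lambda>x. of_real x powr w :: complex) absolutely_integrable_on {0<..<1}"
    and "(LINT x:{0<..<1}|lebesgue. of_real x powr w :: complex) = 1 / (w + 1)"
proof -
  have "(\<lambda>x::real. x powr Re w) integrable_on {0<..<1}"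
    using integrable_on_powr_from_0[OF assms, of 1] by (simp add: integrable_on_Icc_iff_Ioo)
  thus int: "(\<lambda>x. of_real x powr w :: complex) absolutely_integrable_on {0<..<1}"
    by (intro continuous_bounded_imp_absolutely_integrable[where g = "\<lambda>x. x powr Re w"])
       (auto intro!: continuous_intros simp: norm_of_real_powr)
  have nz: "w + 1 \<noteq> 0"
    using assms by (auto simp: complex_eq_iff)
  have "((\<lambda>x::real. x powr (Re w + 1)) \<longlongrightarrow> 0 powr (Re w + 1)) (at_right 0)"
    using assms by (intro tendsto_powr2 tendsto_intros) (auto simp: eventually_at_right_less eventually_at_filter)
  hence "((\<lambda>x::real. x powr (Re w + 1)) \<longlongrightarrow> 0) (at_right 0)"
    by simp
  moreover have "eventually (\<lambda>x::real. x powr (Re w + 1) = norm (of_real x powr (w + 1) :: complex)) (at_right 0)"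
    by (simp add: eventually_at_filter norm_of_real_powr)
  ultimately have "((\<lambda>x. norm (of_real x powr (w + 1) :: complex)) \<longlongrightarrow> 0) (at_right 0)"
    by (rule Lim_transform_eventually)
  hence lim0: "((\<lambda>x. of_real x powr (w + 1) / (w + 1)) \<longlongrightarrow> 0) (at_right 0)"
    by (rule tendsto_divide_zero[OF tendsto_norm_zero_cancel])
  have lim1: "((\<lambda>x. of_real x powr (w + 1) / (w + 1)) \<longlongrightarrow> of_real 1 powr (w + 1) / (w + 1)) (at_left (1::real))"
    using nz by (intro tendsto_intros) (auto simp: tendsto_ident_at)
  show "(LINT x:{0<..<1}|lebesgue. of_real x powr w :: complex) = 1 / (w + 1)"
  proof -
    have "((\<lambda>x. of_real x powr (w + 1) / (w + 1) :: complex) has_vector_derivative of_real x powr w) (at x)"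
      if "x \<in> {0<..<1}" for x :: real
      using has_vector_derivative_divide[OF has_vector_derivative_of_real_powr[of x "w + 1"], of "w + 1"] that nz
      by simp
    thus ?thesis
      using FTC_Ioo_0_1[OF _ continuous_on_of_real_powr int lim0 lim1] by (auto intro!: continuous_intros)
  qed
qed

text \<open>
  A finite sum of powers is absolutely integrable at \<open>0\<close> only if every power in it is. Among the
  exponents with nonzero coefficient pick \<open>k0\<close> of least real part; multiplication by
  \<open>r powr (- k0 - 1)\<close> preserves integrability if \<open>Re k0 \<le> -1\<close>, while the integral over \<open>{x..1}\<close> of the
  product is \<open>- e k0 * ln x\<close> up to a bounded oscillating term.
\<close>
lemma powr_sum_absolutely_integrable_imp_Re_gt:
  fixes e :: "complex \<Rightarrow> complex"
  assumes fin: "finite \<Omega>"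
    and int: "(\<lambda>r. \<Sum>k\<in>\<Omega>. e k * of_real r powr k) absolutely_integrable_on {0<..<1}"
    and k: "k \<in> \<Omega>" "e k \<noteq> 0"
  shows "Re k > -1"
proof (rule ccontr)
  assume neg: "\<not> Re k > -1"
  define g where "g = (\<lambda>r::real. \<Sum>k\<in>\<Omega>. e k * of_real r powr k)"
  define N where "N = {k\<in>\<Omega>. e k \<noteq> 0}"
  have N: "finite N" "N \<noteq> {}" using fin k by (auto simp: N_def)
  define k0 where "k0 = arg_min_on Re N"
  have k0: "k0 \<in> N" and k0_min: "\<And>k. k \<in> N \<Longrightarrow> Re k0 \<le> Re k"
    using arg_min_if_finite[OF N, of Re] by (auto simp: k0_def not_less)
  have Re_k0: "Re k0 \<le> -1" using k0_min[of k] k neg by (auto simp: N_def)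
  have e0: "e k0 \<noteq> 0" using k0 by (simp add: N_def)
  define B where "B = integral {0..1} (\<lambda>r. norm (g r))"
  have int_g: "(\<lambda>r. norm (g r)) integrable_on {0..1}"
    using int unfolding g_def[symmetric] absolutely_integrable_on_def by (simp add: integrable_on_Icc_iff_Ioo)
  define K where "K = (\<Sum>k\<in>N-{k0}. 2 * norm (e k) / norm (k - k0))"
  define G where "G = (\<lambda>r::real. e k0 * of_real (ln r) + (\<Sum>k\<in>N-{k0}. e k * of_real r powr (k - k0) / (k - k0)))"
  have g_N: "g r = (\<Sum>k\<in>N. e k * of_real r powr k)" for r
    unfolding g_def N_def using fin by (intro sum.mono_neutral_right) auto
  have bound: "norm (e k0) * - ln x \<le> B + K" if x: "0 < x" "x < 1" for x
  proof -
    have deriv: "(G has_vector_derivative of_real r powr (- k0 - 1) * g r) (at r within {x..1})" if "r \<in> {x..1}" for r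
    proof -
      have r: "r > 0" using that x by auto
      have eq: "of_real r powr (- k0 - 1) * g r = e k0 * of_real (1 / r) + (\<Sum>k\<in>N-{k0}. e k * ((k - k0) * of_real r powr (k - k0 - 1)) / (k - k0))"
      proof -
        have "of_real r powr (- k0 - 1) * g r = (\<Sum>k\<in>N. e k * of_real r powr (k - k0 - 1))"
          unfolding g_N sum_distrib_left using r
          by (intro sum.cong) (auto simp: powr_add[symmetric] algebra_simps)
        also have "\<dots> = e k0 * of_real r powr (-1) + (\<Sum>k\<in>N-{k0}. e k * of_real r powr (k - k0 - 1))"
          using N k0 by (simp add: sum.remove[of N k0])
        also have "of_real r powr (-1) = (of_real (1 / r) :: complex)"
          using r by (simp add: powr_minus divide_inverse)
        finally show ?thesis by simp
      qed
      have "((\<lambda>r. e k0 * of_real (ln r)) has_vector_derivative e k0 * of_real (1 / r)) (at r)"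
        using r by (intro has_vector_derivative_mult_right has_vector_derivative_of_real)
           (auto intro!: derivative_eq_intros simp: has_real_derivative_iff_has_vector_derivative[symmetric])
      moreover have "((\<lambda>r. (\<Sum>k\<in>N-{k0}. e k * of_real r powr (k - k0) / (k - k0))) has_vector_derivative
         (\<Sum>k\<in>N-{k0}. e k * ((k - k0) * of_real r powr (k - k0 - 1)) / (k - k0))) (at r)"
        by (rule has_vector_derivative_sum, rule has_vector_derivative_divide,
            rule has_vector_derivative_mult_right, rule has_vector_derivative_of_real_powr, rule r)
      ultimately show ?thesis unfolding eq G_def
        by (rule has_vector_derivative_at_within[OF has_vector_derivative_add])
    qed
    have hi: "((\<lambda>r. of_real r powr (- k0 - 1) * g r) has_integral (G 1 - G x)) {x..1}"
      using x by (intro fundamental_theorem_of_calculus deriv) auto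
    have "norm (G 1 - G x) \<le> integral {x..1} (\<lambda>r. norm (g r))"
      unfolding integral_unique[OF hi, symmetric]
    proof (rule integral_norm_bound_integral)
      show "(\<lambda>r. of_real r powr (- k0 - 1) * g r) integrable_on {x..1}" using hi by blast
      show "(\<lambda>r. norm (g r)) integrable_on {x..1}"
        by (rule integrable_on_subinterval[OF int_g]) (use x in auto)
    next
      fix r assume r: "r \<in> {x..1}"
      have "r powr (- Re k0 - 1) \<le> 1 powr (- Re k0 - 1)"
        using r x Re_k0 by (intro powr_mono2) auto
      thus "norm (of_real r powr (- k0 - 1) * g r) \<le> norm (g r)"
        using r x by (simp add: norm_mult norm_of_real_powr mult_left_le_one_le)
    qed
    also have "\<dots> \<le> B" unfolding B_def using x int_g
      by (intro integral_subset_le) (auto intro: integrable_on_subinterval[OF int_g])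
    finally have 1: "norm (G 1 - G x) \<le> B" .
    have 2: "norm (\<Sum>k\<in>N-{k0}. e k * (1 - of_real x powr (k - k0)) / (k - k0)) \<le> K"
      unfolding K_def
    proof (rule sum_norm_le)
      fix k assume k: "k \<in> N - {k0}"
      have "x powr Re (k - k0) \<le> 1" using x k0_min[of k] k by (auto intro: powr_le1)
      hence "norm (1 - of_real x powr (k - k0) :: complex) \<le> 2"
        using norm_triangle_ineq4[of 1 "of_real x powr (k - k0) :: complex"] x by (simp add: norm_of_real_powr)
      thus "norm (e k * (1 - of_real x powr (k - k0)) / (k - k0)) \<le> 2 * norm (e k) / norm (k - k0)"
        using mult_right_mono[of "norm (1 - of_real x powr (k - k0) :: complex)" 2 "norm (e k)"]
        by (simp add: norm_mult norm_divide divide_right_mono mult.commute)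
    qed
    have "e k0 * of_real (- ln x) = (G 1 - G x) - (\<Sum>k\<in>N-{k0}. e k * (1 - of_real x powr (k - k0)) / (k - k0))"
      by (simp add: G_def sum_subtractf algebra_simps diff_divide_distrib)
    hence "norm (e k0 * of_real (- ln x)) \<le> B + K"
      using 1 2 norm_triangle_ineq4 by (smt (verit, best))
    thus ?thesis using x by (simp add: norm_mult)
  qed
  have "B \<ge> 0" unfolding B_def by (intro integral_nonneg int_g) auto
  moreover have "K \<ge> 0" unfolding K_def by (intro sum_nonneg) auto
  ultimately have T: "(B + K + 1) / norm (e k0) > 0" using e0 by simp
  have "B + K + 1 \<le> B + K"
    using bound[of "exp (- ((B + K + 1) / norm (e k0)))"] T e0 by simp
  thus False by simp
qed

lemma absolutely_integrable_eq_on: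
  fixes f g :: "real \<Rightarrow> complex"
  assumes "\<And>x. x \<in> S \<Longrightarrow> f x = g x" "f absolutely_integrable_on S"
  shows "g absolutely_integrable_on S"
  using assms(2) set_integrable_cong[of lebesgue lebesgue S S f g] assms(1) by simp

lemma powr_sum_extend:
  assumes "finite \<Omega>'" "\<Omega> \<subseteq> \<Omega>'"
  shows "(\<Sum>k\<in>\<Omega>'. (if k \<in> \<Omega> then c k else 0) * h k) = (\<Sum>k\<in>\<Omega>. c k * h k :: complex)"
  using assms by (intro sum.mono_neutral_cong_right) auto

lemma has_gen_integral_unique:
  assumes "has_gen_integral f I" "has_gen_integral f J"
  shows "I = J"
proof -
  obtain \<Omega> c where \<Omega>: "finite \<Omega>" and int: "(\<lambda>r. f r - (\<Sum>k\<in>\<Omega>. c k * of_real r powr k)) absolutely_integrable_on {0<..<1}"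
    and I: "I = (\<Sum>k\<in>\<Omega> - {-1}. c k / (k + 1))
            + (LINT r:{0<..<1}|lebesgue. f r - (\<Sum>k\<in>\<Omega>. c k * of_real r powr k))
            + (LINT r:{1<..}|lebesgue. f r)"
    using assms(1) unfolding has_gen_integral_def by blast
  obtain \<Omega>' c' where \<Omega>': "finite \<Omega>'" and int': "(\<lambda>r. f r - (\<Sum>k\<in>\<Omega>'. c' k * of_real r powr k)) absolutely_integrable_on {0<..<1}"
    and J: "J = (\<Sum>k\<in>\<Omega>' - {-1}. c' k / (k + 1))
            + (LINT r:{0<..<1}|lebesgue. f r - (\<Sum>k\<in>\<Omega>'. c' k * of_real r powr k))
            + (LINT r:{1<..}|lebesgue. f r)"
    using assms(2) unfolding has_gen_integral_def by blast
  define N where "N = \<Omega> \<union> \<Omega>'"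
  have N: "finite N" "\<Omega> \<subseteq> N" "\<Omega>' \<subseteq> N" using \<Omega> \<Omega>' by (auto simp: N_def)
  define e where "e = (\<lambda>k. (if k \<in> \<Omega> then c k else 0) - (if k \<in> \<Omega>' then c' k else 0))"
  have e: "(\<Sum>k\<in>N. e k * h k) = (\<Sum>k\<in>\<Omega>. c k * h k) - (\<Sum>k\<in>\<Omega>'. c' k * h k)" for h
    using N unfolding e_def by (simp add: powr_sum_extend sum_subtractf left_diff_distrib)
  have diff_eq: "(f r - (\<Sum>k\<in>\<Omega>'. c' k * of_real r powr k)) - (f r - (\<Sum>k\<in>\<Omega>. c k * of_real r powr k)) = (\<Sum>k\<in>N. e k * of_real r powr k)" for r
    by (simp add: e)
  have int_e: "(\<lambda>r. \<Sum>k\<in>N. e k * of_real r powr k) absolutely_integrable_on {0<..<1}"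
    using set_integral_diff(1)[OF int' int] by (simp only: diff_eq)
  have Re: "Re k > -1" if "k \<in> N" "e k \<noteq> 0" for k
    using powr_sum_absolutely_integrable_imp_Re_gt[OF N(1) int_e that] .
  have single: "(\<lambda>r. e k * of_real r powr k) absolutely_integrable_on {0<..<1}"
    and single_int: "integral {0<..<1} (\<lambda>r. e k * of_real r powr k) = e k / (k + 1)" if "k \<in> N" for k
  proof -
    have "(\<lambda>r. e k * of_real r powr k) absolutely_integrable_on {0<..<1} \<and>
          integral {0<..<1} (\<lambda>r. e k * of_real r powr k) = e k / (k + 1)"
    proof (cases "e k = 0")
      case False
      note P = powr_absolutely_integrable_Ioo[OF Re[OF that False]]
      have "(\<lambda>r. e k * of_real r powr k) absolutely_integrable_on {0<..<1}"
        using P(1) by (rule set_integrable_mult_right)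
      thus ?thesis using P set_lebesgue_integral_eq_integral(2)[OF P(1)] by simp
    qed simp
    thus "(\<lambda>r. e k * of_real r powr k) absolutely_integrable_on {0<..<1}"
      "integral {0<..<1} (\<lambda>r. e k * of_real r powr k) = e k / (k + 1)" by auto
  qed
  have "(LINT r:{0<..<1}|lebesgue. f r - (\<Sum>k\<in>\<Omega>'. c' k * of_real r powr k)) - 
        (LINT r:{0<..<1}|lebesgue. f r - (\<Sum>k\<in>\<Omega>. c k * of_real r powr k))
      = (LINT r:{0<..<1}|lebesgue. (\<Sum>k\<in>N. e k * of_real r powr k))"
    using set_integral_diff(2)[OF int' int] by (simp only: diff_eq)
  also have "\<dots> = integral {0<..<1} (\<lambda>r. \<Sum>k\<in>N. e k * of_real r powr k)"
    by (rule set_lebesgue_integral_eq_integral(2)[OF int_e])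
  also have "\<dots> = (\<Sum>k\<in>N. integral {0<..<1} (\<lambda>r. e k * of_real r powr k))"
    using single by (intro integral_sum N set_lebesgue_integral_eq_integral(1))
  also have "\<dots> = (\<Sum>k\<in>N. e k * (1 / (k + 1)))"
    by (intro sum.cong refl) (simp only: single_int times_divide_eq_right mult_1_right)
  also have "\<dots> = (\<Sum>k\<in>\<Omega>. c k * (1 / (k + 1))) - (\<Sum>k\<in>\<Omega>'. c' k * (1 / (k + 1)))"
    by (rule e)
  also have "(\<Sum>k\<in>\<Omega>. c k * (1 / (k + 1))) = (\<Sum>k\<in>\<Omega>-{-1}. c k / (k + 1))"
    using \<Omega> by (intro sum.mono_neutral_cong_right) auto
  also have "(\<Sum>k\<in>\<Omega>'. c' k * (1 / (k + 1))) = (\<Sum>k\<in>\<Omega>'-{-1}. c' k / (k + 1))"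
    using \<Omega>' by (intro sum.mono_neutral_cong_right) auto
  finally show ?thesis unfolding I J by (simp add: algebra_simps)
qed

lemma gen_integral_eqI: "has_gen_integral f I \<Longrightarrow> gen_integral f = I"
  unfolding gen_integral_def by (rule the_equality) (auto intro: has_gen_integral_unique)

lemma has_gen_integral_cong:
  assumes "\<And>x. x > 0 \<Longrightarrow> f x = g x" "has_gen_integral f I"
  shows "has_gen_integral g I"
proof -
  obtain \<Omega> c where \<Omega>: "finite \<Omega>" and int: "(\<lambda>r. f r - (\<Sum>k\<in>\<Omega>. c k * of_real r powr k)) absolutely_integrable_on {0<..<1}"
    and f: "f absolutely_integrable_on {1<..}"
    and I: "I = (\<Sum>k\<in>\<Omega> - {-1}. c k / (k + 1))
            + (LINT r:{0<..<1}|lebesgue. f r - (\<Sum>k\<in>\<Omega>. c k * of_real r powr k))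
            + (LINT r:{1<..}|lebesgue. f r)"
    using assms(2) unfolding has_gen_integral_def by blast
  have 1: "g absolutely_integrable_on {1<..}"
    by (rule absolutely_integrable_eq_on[OF _ f]) (use assms in auto)
  have 2: "(\<lambda>r. g r - (\<Sum>k\<in>\<Omega>. c k * of_real r powr k)) absolutely_integrable_on {0<..<1}"
    by (rule absolutely_integrable_eq_on[OF _ int]) (use assms in auto)
  have "(LINT r:{1<..}|lebesgue. g r) = (LINT r:{1<..}|lebesgue. f r)"
    "(LINT r:{0<..<1}|lebesgue. g r - (\<Sum>k\<in>\<Omega>. c k * of_real r powr k)) = (LINT r:{0<..<1}|lebesgue. f r - (\<Sum>k\<in>\<Omega>. c k * of_real r powr k))"
    using assms(1) by (auto intro!: set_lebesgue_integral_cong)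
  with 1 2 \<Omega> I show ?thesis unfolding has_gen_integral_def by (intro conjI exI[of _ \<Omega>] exI[of _ c]) simp_all
qed

lemma has_gen_integral_linear:
  assumes "has_gen_integral f I" "has_gen_integral g J"
  shows "has_gen_integral (\<lambda>x. u * f x + v * g x) (u * I + v * J)"
proof -
  obtain \<Omega> c where \<Omega>: "finite \<Omega>" and int: "(\<lambda>r. f r - (\<Sum>k\<in>\<Omega>. c k * of_real r powr k)) absolutely_integrable_on {0<..<1}"
    and f: "f absolutely_integrable_on {1<..}"
    and I: "I = (\<Sum>k\<in>\<Omega> - {-1}. c k / (k + 1))
            + (LINT r:{0<..<1}|lebesgue. f r - (\<Sum>k\<in>\<Omega>. c k * of_real r powr k))
            + (LINT r:{1<..}|lebesgue. f r)"
    using assms(1) unfolding has_gen_integral_def by blast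
  obtain \<Omega>' c' where \<Omega>': "finite \<Omega>'" and int': "(\<lambda>r. g r - (\<Sum>k\<in>\<Omega>'. c' k * of_real r powr k)) absolutely_integrable_on {0<..<1}"
    and g: "g absolutely_integrable_on {1<..}"
    and J: "J = (\<Sum>k\<in>\<Omega>' - {-1}. c' k / (k + 1))
            + (LINT r:{0<..<1}|lebesgue. g r - (\<Sum>k\<in>\<Omega>'. c' k * of_real r powr k))
            + (LINT r:{1<..}|lebesgue. g r)"
    using assms(2) unfolding has_gen_integral_def by blast
  define N where "N = \<Omega> \<union> \<Omega>'"
  have N: "finite N" "\<Omega> \<subseteq> N" "\<Omega>' \<subseteq> N" "\<Omega> - {-1} \<subseteq> N" "\<Omega>' - {-1} \<subseteq> N" using \<Omega> \<Omega>' by (auto simp: N_def)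
  define e where "e = (\<lambda>k. u * (if k \<in> \<Omega> then c k else 0) + v * (if k \<in> \<Omega>' then c' k else 0))"
  have e: "(\<Sum>k\<in>N. e k * h k) = u * (\<Sum>k\<in>\<Omega>. c k * h k) + v * (\<Sum>k\<in>\<Omega>'. c' k * h k)" for h
    using N unfolding e_def
    by (simp add: powr_sum_extend sum.distrib distrib_right mult.assoc sum_distrib_left[symmetric])
  have eq: "u * f r + v * g r - (\<Sum>k\<in>N. e k * of_real r powr k) =
     u * (f r - (\<Sum>k\<in>\<Omega>. c k * of_real r powr k)) + v * (g r - (\<Sum>k\<in>\<Omega>'. c' k * of_real r powr k))" for r
    by (simp add: e algebra_simps)
  have "(\<Sum>k\<in>N-{-1}. e k / (k + 1)) = (\<Sum>k\<in>N. e k * (1 / (k + 1)))"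
    using N by (intro sum.mono_neutral_cong_left) auto
  also have "\<dots> = u * (\<Sum>k\<in>\<Omega>. c k * (1 / (k + 1))) + v * (\<Sum>k\<in>\<Omega>'. c' k * (1 / (k + 1)))"
    by (rule e)
  also have "(\<Sum>k\<in>\<Omega>. c k * (1 / (k + 1))) = (\<Sum>k\<in>\<Omega>-{-1}. c k / (k + 1))"
    using \<Omega> by (intro sum.mono_neutral_cong_right) auto
  also have "(\<Sum>k\<in>\<Omega>'. c' k * (1 / (k + 1))) = (\<Sum>k\<in>\<Omega>'-{-1}. c' k / (k + 1))"
    using \<Omega>' by (intro sum.mono_neutral_cong_right) auto
  finally have sum_eq: "(\<Sum>k\<in>N-{-1}. e k / (k + 1)) = u * (\<Sum>k\<in>\<Omega>-{-1}. c k / (k + 1)) + v * (\<Sum>k\<in>\<Omega>'-{-1}. c' k / (k + 1))" .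
  note A = set_integral_add[OF set_integrable_mult_right[of u, OF int] set_integrable_mult_right[of v, OF int']]
  note B = set_integral_add[OF set_integrable_mult_right[of u, OF f] set_integrable_mult_right[of v, OF g]]
  show ?thesis unfolding has_gen_integral_def
  proof (intro conjI exI[of _ N] exI[of _ e])
    show "(\<lambda>x. u * f x + v * g x) absolutely_integrable_on {1<..}" using B(1) .
    show "(\<lambda>r. u * f r + v * g r - (\<Sum>k\<in>N. e k * of_real r powr k)) absolutely_integrable_on {0<..<1}"
      unfolding eq using A(1) .
    show "u * I + v * J = (\<Sum>k\<in>N - {-1}. e k / (k + 1))
            + (LINT r:{0<..<1}|lebesgue. u * f r + v * g r - (\<Sum>k\<in>N. e k * of_real r powr k))
            + (LINT r:{1<..}|lebesgue. u * f r + v * g r)"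
      unfolding eq sum_eq A(2) B(2) I J set_integral_mult_right by (simp add: algebra_simps)
  qed (rule N)
qed

abbreviation polar_sum :: "nat \<Rightarrow> (nat \<Rightarrow> complex) \<Rightarrow> real \<Rightarrow> complex" where
  "polar_sum N e z \<equiv> \<Sum>k=1..N. e k / of_real z ^ k"

text \<open>Multiplication by \<open>z ^ N\<close> isolates the coefficient of the strongest pole, which therefore vanishes;
  at the end of the induction only the logarithm is left, and it has no finite limit.\<close>
lemma polar_sum_tendsto_imp_zero:
  fixes e :: "nat \<Rightarrow> complex"
  assumes "((\<lambda>z. (polar_sum N e z) + l * of_real (ln z)) \<longlongrightarrow> A) (at_right 0)"
  shows "(\<forall>k\<in>{1..N}. e k = 0) \<and> l = 0 \<and> A = 0"
  using assms
proof (induction N)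
  case 0
  have "l = 0"
  proof (rule ccontr)
    assume l: "l \<noteq> 0"
    have "((\<lambda>z. Re ((l * of_real (ln z)) / l)) \<longlongrightarrow> Re (A / l)) (at_right 0)"
      using 0 l by (intro tendsto_Re tendsto_divide) auto
    hence "((\<lambda>z. ln z :: real) \<longlongrightarrow> Re (A / l)) (at_right 0)"
      using l by simp
    moreover have "filterlim (ln :: real \<Rightarrow> real) at_infinity (at_right 0)"
      by (intro filterlim_at_bot_imp_at_infinity ln_at_0)
    ultimately show False
      using not_tendsto_and_filterlim_at_infinity[of "at_right (0::real)" ln "Re (A / l)"] by simp
  qed
  with 0 show ?case by (auto simp: tendsto_const_iff)
next
  case (Suc N)
  have pow: "((\<lambda>z. of_real z ^ n :: complex) \<longlongrightarrow> 0) (at_right 0)" if "n > 0" for n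
    using that by (auto intro!: tendsto_eq_intros)
  have "((\<lambda>z. of_real (z * ln z) :: complex) \<longlongrightarrow> of_real 0) (at_right 0)"
    by (intro tendsto_of_real) real_asymp
  hence "((\<lambda>z. l * (of_real z ^ N * of_real (z * ln z))) \<longlongrightarrow> l * (0 ^ N * of_real 0)) (at_right 0)"
    by (intro tendsto_mult tendsto_power tendsto_const) (auto intro!: tendsto_eq_intros)
  hence ln: "((\<lambda>z. of_real z ^ Suc N * (l * of_real (ln z))) \<longlongrightarrow> 0) (at_right 0)"
    by (simp add: mult_ac)
  have sum: "((\<lambda>z. \<Sum>k=1..N. e k * of_real z ^ (Suc N - k)) \<longlongrightarrow> 0) (at_right 0)"
    by (intro tendsto_null_sum tendsto_mult_right_zero pow) auto
  have "((\<lambda>z. of_real z ^ Suc N * ((polar_sum (Suc N) e z) + l * of_real (ln z))) \<longlongrightarrow> 0 * A) (at_right 0)"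
    by (intro tendsto_mult Suc.prems pow) auto
  note lim = tendsto_diff[OF tendsto_diff[OF this ln] sum]
  have "((\<lambda>z. e (Suc N)) \<longlongrightarrow> 0 * A - 0 - 0) (at_right (0::real))"
  proof (rule Lim_transform_eventually[OF lim])
    show "\<forall>\<^sub>F z in at_right 0. of_real z ^ Suc N * ((polar_sum (Suc N) e z) + l * of_real (ln z)) -
        of_real z ^ Suc N * (l * of_real (ln z)) - (\<Sum>k=1..N. e k * of_real z ^ (Suc N - k)) = e (Suc N)"
    proof (intro eventually_mono[OF eventually_at_right_less])
      fix z :: real assume z: "z > 0"
      have "(\<Sum>k=1..N. of_real z ^ Suc N * (e k / of_real z ^ k)) = (\<Sum>k=1..N. e k * of_real z ^ (Suc N - k))"
        using z by (intro sum.cong) (auto simp: power_diff)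
      thus "of_real z ^ Suc N * ((polar_sum (Suc N) e z) + l * of_real (ln z)) -
        of_real z ^ Suc N * (l * of_real (ln z)) - (\<Sum>k=1..N. e k * of_real z ^ (Suc N - k)) = e (Suc N)"
        using z by (simp add: distrib_left sum_distrib_left)
    qed
  qed
  hence e: "e (Suc N) = 0" by (simp add: tendsto_const_iff)
  with Suc.prems have "(\<forall>k\<in>{1..N}. e k = 0) \<and> l = 0 \<and> A = 0"
    by (intro Suc.IH) simp
  with e show ?case by (auto simp: le_Suc_eq)
qed

lemma has_gen_integral_polar:
  fixes d :: "nat \<Rightarrow> complex"
  assumes "f absolutely_integrable_on {1<..}"
    and int: "(\<lambda>z. f z - (polar_sum N d z)) absolutely_integrable_on {0<..<1}"
  shows "has_gen_integral f ((\<Sum>k=2..N. d k / (1 - of_nat k)) 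
     + (LINT z:{0<..<1}|lebesgue. f z - (polar_sum N d z)) + (LINT z:{1<..}|lebesgue. f z))"
proof -
  define \<Omega> :: "complex set" where "\<Omega> = (\<lambda>k. - of_nat k) ` {1..N}"
  define c where "c = (\<lambda>w. d (nat \<lfloor>- Re w\<rfloor>))"
  have inj: "inj_on (\<lambda>k. - of_nat k :: complex) A" for A by (auto simp: inj_on_def)
  have c: "c (- of_nat k) = d k" for k by (simp add: c_def)
  have eq: "(\<Sum>w\<in>\<Omega>. c w * of_real z powr w) = (polar_sum N d z)" if "z > 0" for z
    unfolding \<Omega>_def sum.reindex[OF inj] o_def c using that
    by (intro sum.cong) (auto simp: powr_minus powr_nat field_simps)
  have \<Omega>1: "\<Omega> - {-1} = (\<lambda>k. - of_nat k) ` {2..N}"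
  proof -
    have "(- of_nat k = (-1::complex)) \<longleftrightarrow> k = 1" for k by (metis neg_equal_iff_equal of_nat_1 of_nat_eq_iff)
    thus ?thesis unfolding \<Omega>_def by (auto simp: image_iff)
  qed
  have sum1: "(\<Sum>w\<in>\<Omega>-{-1}. c w / (w + 1)) = (\<Sum>k=2..N. d k / (1 - of_nat k))"
    unfolding \<Omega>1 sum.reindex[OF inj] o_def c by (intro sum.cong) auto
  have int': "(\<lambda>z. f z - (\<Sum>w\<in>\<Omega>. c w * of_real z powr w)) absolutely_integrable_on {0<..<1}"
    by (rule absolutely_integrable_eq_on[OF _ int]) (simp add: eq)
  have "(LINT z:{0<..<1}|lebesgue. f z - (\<Sum>w\<in>\<Omega>. c w * of_real z powr w)) = 
        (LINT z:{0<..<1}|lebesgue. f z - (polar_sum N d z))"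
    by (intro set_lebesgue_integral_cong) (auto simp: eq)
  moreover have "finite \<Omega>" by (simp add: \<Omega>_def)
  ultimately show ?thesis
    unfolding has_gen_integral_def using assms(1) int' sum1
    by (intro conjI exI[of _ \<Omega>] exI[of _ c]) simp_all
qed

text \<open>
  The generalized integral of a derivative: the value at \<open>0\<close> is replaced by the constant term of the
  asymptotic expansion there. The polar coefficients of \<open>P\<close> need not be matched with those of its
  derivative by hand, since an expansion determines its coefficients.
\<close>
lemma has_gen_integral_deriv:
  fixes d b :: "nat \<Rightarrow> complex"
  assumes P: "\<And>z. z > 0 \<Longrightarrow> (P has_vector_derivative P' z) (at z)"
    and cont: "continuous_on {0<..} P'"
    and int1: "P' absolutely_integrable_on {1<..}"
    and top: "(P \<longlongrightarrow> 0) at_top"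
    and int0: "(\<lambda>z. P' z - (polar_sum N d z)) absolutely_integrable_on {0<..<1}"
    and lim0: "((\<lambda>z. P z - ((polar_sum N b z) + l * of_real (ln z))) \<longlongrightarrow> \<beta>) (at_right 0)"
  shows "has_gen_integral P' (- \<beta>)"
proof -
  define h where "h = (\<lambda>z. P' z - (polar_sum N d z))"
  define q where "q = (\<lambda>k. if k < N then - d (Suc k) / of_nat k else 0)"
  define l' where "l' = (if N \<ge> 1 then d 1 else 0)"
  define Q where "Q = (\<lambda>z. (polar_sum N q z) + l' * of_real (ln z))"
  have cont_h: "continuous_on {0<..} h"
    unfolding h_def by (intro continuous_intros cont) auto
  have Q': "(Q has_vector_derivative (polar_sum N d z)) (at z)" if z: "z > 0" for z
  proof -
    have 1: "((\<lambda>z. q k / of_real z ^ k) has_vector_derivative q k * (- of_nat k / of_real z ^ Suc k)) (at z)" for k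
    proof -
      have "((\<lambda>w. q k * inverse (w ^ k)) has_field_derivative
          q k * (- (inverse (of_real z ^ k) * (of_nat k * of_real z ^ (k - Suc 0)) * inverse (of_real z ^ k)))) (at (of_real z))"
        using z by (intro DERIV_cmult DERIV_inverse' DERIV_power[THEN DERIV_cong] DERIV_ident) auto
      also have "q k * (- (inverse (of_real z ^ k) * (of_nat k * of_real z ^ (k - Suc 0)) * inverse (of_real z ^ k)))
         = q k * (- of_nat k / of_real z ^ Suc k)"
        using z by (cases k) (simp_all add: field_simps)
      finally have "((\<lambda>w. q k / w ^ k) has_field_derivative q k * (- of_nat k / of_real z ^ Suc k)) (at (of_real z))"
        by (simp add: divide_inverse)
      from has_vector_derivative_real_field[OF this] show ?thesis .
    qed
    have 2: "((\<lambda>z. l' * of_real (ln z)) has_vector_derivative l' * of_real (1 / z)) (at z)"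
      using z by (intro has_vector_derivative_mult_right has_vector_derivative_of_real)
           (auto intro!: derivative_eq_intros simp: has_real_derivative_iff_has_vector_derivative[symmetric])
    have "(Q has_vector_derivative (\<Sum>k=1..N. q k * (- of_nat k / of_real z ^ Suc k)) + l' * of_real (1 / z)) (at z)"
      unfolding Q_def by (intro has_vector_derivative_add has_vector_derivative_sum 1 2)
    also have "(\<Sum>k=1..N. q k * (- of_nat k / of_real z ^ Suc k)) = (\<Sum>k\<in>{1..<N}. d (Suc k) / of_real z ^ Suc k)"
      by (intro sum.mono_neutral_cong_right) (auto simp: q_def)
    also have "\<dots> = (\<Sum>k\<in>{2..<Suc N}. d k / of_real z ^ k)"
      by (subst sum.shift_bounds_Suc_ivl[symmetric]) (simp add: numeral_2_eq_2)
    also have "\<dots> + l' * of_real (1 / z) = (polar_sum N d z)"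
    proof (cases "N \<ge> 1")
      case True
      thus ?thesis by (simp add: l'_def sum.atLeast_Suc_atMost[of "Suc 0" N] numeral_2_eq_2 atLeastLessThanSuc_atLeastAtMost)
    qed (simp add: l'_def)
    finally show ?thesis .
  qed
  have PQ: "((\<lambda>z. P z - Q z) has_vector_derivative h z) (at z)" if "z > 0" for z
    unfolding h_def by (intro has_vector_derivative_diff P Q' that)
  have h_int: "h integrable_on {0..1}"
    using set_lebesgue_integral_eq_integral(1)[OF int0] unfolding h_def by (simp add: integrable_on_Icc_iff_Ioo)
  define A where "A = (P 1 - Q 1) - integral {0..1} h"
  have "((\<lambda>x. integral {x..1} h) \<longlongrightarrow> integral {0..1} h) (at_right 0)"
    using indefinite_integral_continuous_1'[OF h_int]
    by (auto simp: continuous_on_def at_within_Icc_at_right dest!: bspec[of _ _ 0])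
  hence "((\<lambda>x. (P 1 - Q 1) - integral {x..1} h) \<longlongrightarrow> A) (at_right 0)"
    unfolding A_def by (intro tendsto_intros)
  moreover have "\<forall>\<^sub>F x in at_right 0. (P 1 - Q 1) - integral {x..1} h = P x - Q x"
    using eventually_at_right_less[of 0] eventually_at_right_real[of 0 1, OF zero_less_one]
  proof eventually_elim
    case (elim x)
    have "(h has_integral (P 1 - Q 1) - (P x - Q x)) {x..1}"
      using elim by (intro fundamental_theorem_of_calculus has_vector_derivative_at_within[OF PQ]) auto
    thus ?case by (simp add: integral_unique)
  qed
  ultimately have limA: "((\<lambda>z. P z - Q z) \<longlongrightarrow> A) (at_right 0)"
    by (rule Lim_transform_eventually)
  have "((\<lambda>z. (\<Sum>k=1..N. (b k - q k) / of_real z ^ k) + (l - l') * of_real (ln z)) \<longlongrightarrow> A - \<beta>) (at_right 0)"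
    using tendsto_diff[OF limA lim0] unfolding Q_def by (simp add: algebra_simps sum_subtractf diff_divide_distrib)
  from polar_sum_tendsto_imp_zero[OF this] have A: "A = \<beta>" by simp
  have P1: "(P \<longlongrightarrow> P 1) (at_right 1)"
    using has_vector_derivative_continuous[OF P[of 1]] by (simp add: continuous_within filterlim_at_split)
  have "(LINT z:{1<..}|lebesgue. P' z) = 0 - P 1"
    by (rule FTC_Ioi_1[OF P _ int1 P1 top]) (auto intro: continuous_on_subset[OF cont])
  moreover have "(LINT z:{0<..<1}|lebesgue. h z) = P 1 - Q 1 - \<beta>"
    using set_lebesgue_integral_eq_integral(2)[OF int0] A unfolding h_def[symmetric] A_def
    by (auto simp: integral_open_interval_real)
  moreover have "Q 1 = (\<Sum>k=2..N. d k / (1 - of_nat k))"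
  proof -
    have "Q 1 = (\<Sum>k\<in>{1..<N}. d (Suc k) / (1 - of_nat (Suc k)))"
      unfolding Q_def by simp (intro sum.mono_neutral_cong_right, auto simp: q_def)
    also have "\<dots> = (\<Sum>k\<in>{2..<Suc N}. d k / (1 - of_nat k))"
      by (subst sum.shift_bounds_Suc_ivl[symmetric]) (simp add: numeral_2_eq_2)
    finally show ?thesis by (simp add: atLeastLessThanSuc_atLeastAtMost)
  qed
  ultimately show ?thesis
    using has_gen_integral_polar[OF int1 int0] unfolding h_def[symmetric] by simp
qed

section \<open>Asymptotic expansions at zero\<close>

text \<open>The increments of \<open>F\<close> are dominated by those of \<open>K / p * z powr p\<close>, so \<open>F\<close> has a limit \<open>C\<close> at \<open>0\<close>.\<close>
lemma primitive_bound_at_0: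
  fixes F :: "real \<Rightarrow> complex"
  assumes p: "p > 0" and \<delta>: "\<delta> > 0"
    and F: "\<And>z. 0 < z \<Longrightarrow> z \<le> \<delta> \<Longrightarrow> (F has_vector_derivative F' z) (at z)"
    and bound: "\<And>z. 0 < z \<Longrightarrow> z \<le> \<delta> \<Longrightarrow> norm (F' z) \<le> K * z powr (p - 1)"
  shows "\<exists>C. \<forall>z\<in>{0<..\<delta>}. norm (F z - C) \<le> K / p * z powr p"
proof -
  have K: "K \<ge> 0"
  proof -
    have "0 \<le> K * \<delta> powr (p - 1)" using order_trans[OF norm_ge_zero bound[of \<delta>]] \<delta> by simp
    thus ?thesis using \<delta> by (simp add: zero_le_mult_iff)
  qed
  have diff: "norm (F y - F x) \<le> K / p * y powr p - K / p * x powr p" if "0 < x" "x < y" "y \<le> \<delta>" for x y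
  proof (rule differentiable_bound_general[OF \<open>x < y\<close>, where f' = F' and \<phi>' = "\<lambda>z. K * z powr (p - 1)"])
    show "continuous_on {x..y} F"
      using that by (intro continuous_at_imp_continuous_on ballI has_vector_derivative_continuous[OF F]) auto
    show "continuous_on {x..y} (\<lambda>y. K / p * y powr p)"
      using that by (intro continuous_intros) auto
    show "((\<lambda>y. K / p * y powr p) has_vector_derivative K * z powr (p - 1)) (at z)" if z: "x < z" for z
      using z \<open>0 < x\<close> p unfolding has_real_derivative_iff_has_vector_derivative[symmetric]
      by (auto intro!: derivative_eq_intros simp: powr_diff)
  qed (use that in \<open>auto intro!: F bound\<close>)
  define X where "X = (\<lambda>n::nat. \<delta> / real (Suc n))"
  have X: "0 < X n" "X n \<le> \<delta>" for n using \<delta> by (auto simp: X_def field_simps)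
  have X0: "X \<longlonglongrightarrow> 0" unfolding X_def by real_asymp
  have Xp: "(\<lambda>n. K / p * X n powr p) \<longlonglongrightarrow> 0"
    using tendsto_mult[OF tendsto_const tendsto_zero_powrI[OF X0 tendsto_const _ p], of "K / p"] X
    by (auto simp: less_imp_le)
  have diff': "norm (F y - F x) \<le> K / p * (max x y) powr p" if "0 < x" "x \<le> \<delta>" "0 < y" "y \<le> \<delta>" for x y
  proof -
    consider "x < y" | "x = y" | "y < x" by linarith
    thus ?thesis
    proof cases
      case 1
      from diff[of x y] 1 that K p show ?thesis by (smt (verit) divide_nonneg_pos powr_ge_zero mult_nonneg_nonneg)
    next
      case 3
      from diff[of y x] 3 that K p show ?thesis
        by (smt (verit) divide_nonneg_pos powr_ge_zero mult_nonneg_nonneg norm_minus_commute)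
    qed (use K p in auto)
  qed
  have "Cauchy (\<lambda>n. F (X n))"
  proof (rule metric_CauchyI)
    fix e :: real assume "e > 0"
    then obtain N where N: "\<And>n. n \<ge> N \<Longrightarrow> norm (K / p * X n powr p) < e"
      using Xp by (auto simp: LIMSEQ_iff)
    show "\<exists>M. \<forall>m\<ge>M. \<forall>n\<ge>M. dist (F (X m)) (F (X n)) < e"
    proof (intro exI[of _ N] allI impI)
      fix m n assume "m \<ge> N" "n \<ge> N"
      hence "norm (K / p * max (X n) (X m) powr p) < e" using N by (auto simp: max_def)
      moreover have "norm (F (X m) - F (X n)) \<le> K / p * max (X n) (X m) powr p" 
        by (rule diff'[OF X X])
      ultimately show "dist (F (X m)) (F (X n)) < e"
        using abs_ge_self[of "K / p * max (X n) (X m) powr p"] unfolding dist_norm real_norm_def by linarith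
    qed
  qed
  then obtain C where C: "(\<lambda>n. F (X n)) \<longlonglongrightarrow> C" using Cauchy_convergent convergentD by blast
  show ?thesis
  proof (intro exI[of _ C] ballI)
    fix z assume z: "z \<in> {0<..\<delta>}"
    have "(\<lambda>n. norm (F z - F (X n))) \<longlonglongrightarrow> norm (F z - C)" by (intro tendsto_intros C)
    moreover have "eventually (\<lambda>n. norm (F z - F (X n)) \<le> K / p * z powr p) sequentially"
      using order_tendstoD(2)[OF X0, of z]
    proof (rule eventually_mono)
      show "norm (F z - F (X n)) \<le> K / p * z powr p" if "X n < z" for n
        using diff'[OF X(1) X(2), of z n] z that by (simp add: max_def)
    qed (use z in auto)
    ultimately show "norm (F z - C) \<le> K / p * z powr p"
      by (rule tendsto_upperbound) simp
  qed
qed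

text \<open>For every \<open>e > 0\<close> the preceding lemma applies near \<open>0\<close> with \<open>K = e\<close>; the constants it yields all
  equal the limit of \<open>F\<close> at \<open>0\<close>.\<close>
lemma primitive_little_o_at_0:
  fixes F :: "real \<Rightarrow> complex"
  assumes F: "\<And>z. 0 < z \<Longrightarrow> (F has_vector_derivative F' z) (at z)"
    and lim: "((\<lambda>z. F' z / of_real z ^ m) \<longlongrightarrow> 0) (at_right 0)"
  shows "\<exists>C. ((\<lambda>z. (F z - C) / of_real z ^ Suc m) \<longlongrightarrow> 0) (at_right 0)"
proof -
  have "\<exists>C. \<exists>\<delta>>0. \<forall>z\<in>{0<..\<delta>}. norm (F z - C) \<le> e * z ^ Suc m" if "e > 0" for e
  proof -
    have "\<forall>\<^sub>F z in at_right 0. norm (F' z / of_real z ^ m) < e"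
      using tendstoD[OF lim \<open>e > 0\<close>] by simp
    then obtain \<delta>' where \<delta>': "\<delta>' > 0" "\<And>z. 0 < z \<Longrightarrow> z < \<delta>' \<Longrightarrow> norm (F' z / of_real z ^ m) < e"
      unfolding eventually_at_right_field by auto
    define \<delta> where "\<delta> = \<delta>' / 2"
    have \<delta>: "\<delta> > 0" "\<delta> < \<delta>'" using \<delta>' by (auto simp: \<delta>_def)
    have "norm (F' z) \<le> e * z powr (real (Suc m) - 1)" if "0 < z" "z \<le> \<delta>" for z
      using \<delta>'(2)[of z] that \<delta> by (simp add: norm_divide norm_power powr_realpow field_simps)
    hence "\<exists>C. \<forall>z\<in>{0<..\<delta>}. norm (F z - C) \<le> e / real (Suc m) * z powr real (Suc m)"
      by (intro primitive_bound_at_0[OF _ \<delta>(1) F]) auto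
    then obtain C where
      C: "\<And>z. z \<in> {0<..\<delta>} \<Longrightarrow> norm (F z - C) \<le> e / real (Suc m) * z powr real (Suc m)"
      by blast
    have "norm (F z - C) \<le> e * z ^ Suc m" if "z \<in> {0<..\<delta>}" for z
    proof -
      have "norm (F z - C) \<le> e / real (Suc m) * z ^ Suc m"
        using C[OF that] that powr_realpow[of z "Suc m"] by simp
      also have "\<dots> \<le> e * z ^ Suc m"
        using that \<open>e > 0\<close> by (intro mult_right_mono) (auto simp: field_simps)
      finally show ?thesis .
    qed
    with \<delta> show ?thesis by blast
  qed
  hence "\<forall>e. \<exists>C \<delta>. e > 0 \<longrightarrow> \<delta> > 0 \<and> (\<forall>z\<in>{0<..\<delta>}. norm (F z - C) \<le> e * z ^ Suc m)" by blast
  then obtain C \<delta> where C: "\<And>e::real. e > 0 \<Longrightarrow> \<delta> e > 0"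
      "\<And>e z. e > 0 \<Longrightarrow> z \<in> {0<..\<delta> e} \<Longrightarrow> norm (F z - C e) \<le> e * z ^ Suc m" by metis
  have lim_C: "(F \<longlongrightarrow> C e) (at_right 0)" if "e > 0" for e
  proof (rule Lim_null[THEN iffD2], rule Lim_null_comparison)
    show "\<forall>\<^sub>F z in at_right 0. norm (F z - C e) \<le> e * z ^ Suc m"
      unfolding eventually_at_right_field using C[OF that] by (auto intro!: exI[of _ "\<delta> e"])
    show "((\<lambda>z. e * z ^ Suc m) \<longlongrightarrow> 0) (at_right 0)" by (auto intro!: tendsto_eq_intros)
  qed
  have C_eq: "C e = C 1" if "e > 0" for e
    using tendsto_unique[OF _ lim_C[OF that] lim_C[of 1]] by simp
  show ?thesis
  proof (intro exI[of _ "C 1"] tendstoI)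
    fix e :: real assume e: "e > 0"
    show "\<forall>\<^sub>F z in at_right 0. dist ((F z - C 1) / of_real z ^ Suc m) 0 < e"
      unfolding eventually_at_right_field
    proof (intro exI[of _ "\<delta> (e / 2)"] conjI allI impI C)
      fix z assume z: "0 < z" "z < \<delta> (e / 2)"
      have "norm (F z - C 1) \<le> e / 2 * z ^ Suc m" using C(2)[of "e / 2" z] C_eq[of "e / 2"] e z by simp
      also have "\<dots> < e * z ^ Suc m" using z e by (intro mult_strict_right_mono) auto
      finally show "dist ((F z - C 1) / of_real z ^ Suc m) 0 < e" using z
        by (simp add: norm_divide norm_mult norm_power pos_divide_less_eq)
    qed (use e in auto)
  qed
qed

definition polar_expansion :: "nat \<Rightarrow> (nat \<Rightarrow> complex) \<Rightarrow> complex \<Rightarrow> complex \<Rightarrow> (real \<Rightarrow> complex) \<Rightarrow> bool" where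
  "polar_expansion m q L M h \<longleftrightarrow>
     ((\<lambda>z. h z - ((polar_sum m q z) + L * of_real (ln z) + M)) \<longlongrightarrow> 0) (at_right 0)"

lemma polar_expansion_cong:
  assumes "polar_expansion m q L M h"
    and "\<And>z. z > 0 \<Longrightarrow> h z = h' z" "\<And>k. 1 \<le> k \<Longrightarrow> k \<le> m \<Longrightarrow> q k = q' k" "L = L'" "M = M'"
  shows "polar_expansion m q' L' M' h'"
proof -
  have "(polar_sum m q z) = (polar_sum m q' z)" for z :: real
    using assms(3) by (intro sum.cong) auto
  with assms show ?thesis unfolding polar_expansion_def
    by (auto elim!: Lim_transform_eventually intro!: eventually_mono[OF eventually_at_right_less])
qed

lemma polar_expansion_linear:
  assumes "polar_expansion m q L M h" "polar_expansion m q' L' M' h'"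
  shows "polar_expansion m (\<lambda>k. u * q k + v * q' k) (u * L + v * L') (u * M + v * M') (\<lambda>z. u * h z + v * h' z)"
proof -
  have "((\<lambda>z. u * (h z - ((polar_sum m q z) + L * of_real (ln z) + M)) +
              v * (h' z - ((polar_sum m q' z) + L' * of_real (ln z) + M'))) \<longlongrightarrow> u * 0 + v * 0) (at_right 0)"
    using assms unfolding polar_expansion_def by (intro tendsto_intros)
  thus ?thesis unfolding polar_expansion_def
    by (simp add: algebra_simps sum.distrib sum_distrib_left add_divide_distrib)
qed

lemma polar_expansion_Suc:
  assumes "polar_expansion m q L M h"
  shows "polar_expansion (Suc m) (\<lambda>k. if k = Suc m then 0 else q k) L M h"
proof -
  have "(\<Sum>k=1..Suc m. (if k = Suc m then 0 else q k) / of_real z ^ k) = (polar_sum m q z)" for z :: real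
    by (auto intro!: sum.cong)
  thus ?thesis using assms by (simp add: polar_expansion_def)
qed

text \<open>Integration of \<open>z ^ m * h z\<close> raises the order of the pole by one; the new coefficient is the
  constant of integration.\<close>
lemma polar_expansion_primitive:
  assumes h: "polar_expansion m q L M h"
    and F: "\<And>z. z > 0 \<Longrightarrow> (F has_vector_derivative of_real z ^ m * h z) (at z)"
  shows "\<exists>C. polar_expansion (Suc m) (\<lambda>k. if k = Suc m then C else q k / of_nat (Suc m - k))
           (L / of_nat (Suc m)) (M / of_nat (Suc m) - L / of_nat (Suc m) ^ 2) (\<lambda>z. F z / of_real z ^ Suc m)"
proof -
  define s :: complex where "s = of_nat (Suc m)"
  have s: "s \<noteq> 0" unfolding s_def using of_nat_neq_0 by blast
  define E where "E = (\<lambda>z::real. (\<Sum>k=1..m. q k / of_nat (Suc m - k) * of_real z ^ (Suc m - k)) +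
       of_real z ^ Suc m * (L / s * of_real (ln z) + (M / s - L / s ^ 2)))"
  define e where "e = (\<lambda>z::real. (polar_sum m q z) + L * of_real (ln z) + M)"
  have pow: "((\<lambda>z. of_real z ^ Suc n :: complex) has_vector_derivative of_nat (Suc n) * of_real z ^ n) (at z)" for n and z :: real
    by (rule has_vector_derivative_real_field, rule DERIV_cong[OF DERIV_power[OF DERIV_ident]]) simp
  have E': "(E has_vector_derivative of_real z ^ m * e z) (at z)" if z: "z > 0" for z
  proof -
    have 1: "((\<lambda>z. q k / of_nat (Suc m - k) * of_real z ^ (Suc m - k)) has_vector_derivative of_real z ^ m * (q k / of_real z ^ k)) (at z)" if "k \<in> {1..m}" for k
    proof -
      have "Suc m - k = Suc (m - k)" using that by auto
      moreover have "of_nat (Suc (m - k)) \<noteq> (0::complex)" using of_nat_neq_0 by blast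
      ultimately show ?thesis
        using has_vector_derivative_mult_right[OF pow, of "q k / of_nat (Suc m - k)" "m - k" z] that z
        by (simp add: power_diff field_simps del: of_nat_Suc)
    qed
    have 2: "((\<lambda>z. of_real (ln z) :: complex) has_vector_derivative of_real (1 / z)) (at z)"
      using z by (intro has_vector_derivative_of_real)
           (auto intro!: derivative_eq_intros simp: has_real_derivative_iff_has_vector_derivative[symmetric])
    have 3: "((\<lambda>z. of_real z ^ Suc m * (L / s * of_real (ln z) + (M / s - L / s ^ 2))) has_vector_derivative
       of_real z ^ Suc m * (L / s * of_real (1 / z)) + of_nat (Suc m) * of_real z ^ m * (L / s * of_real (ln z) + (M / s - L / s ^ 2))) (at z)"
      by (intro has_vector_derivative_mult pow has_vector_derivative_add_const[THEN iffD2] has_vector_derivative_mult_right 2)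
    have eq: "(\<Sum>k=1..m. of_real z ^ m * (q k / of_real z ^ k)) +
       (of_real z ^ Suc m * (L / s * of_real (1 / z)) + of_nat (Suc m) * of_real z ^ m * (L / s * of_real (ln z) + (M / s - L / s ^ 2)))
       = of_real z ^ m * e z"
      unfolding s_def[symmetric] e_def using s z
      by (simp add: sum_distrib_left distrib_left power2_eq_square field_simps)
    show ?thesis
      unfolding E_def eq[symmetric] by (intro has_vector_derivative_add has_vector_derivative_sum 1 3)
  qed
  have FE: "((\<lambda>z. F z - E z) has_vector_derivative of_real z ^ m * (h z - e z)) (at z)" if "z > 0" for z
    using has_vector_derivative_diff[OF F[OF that] E'[OF that]] by (simp add: algebra_simps)
  have "((\<lambda>z. of_real z ^ m * (h z - e z) / of_real z ^ m) \<longlongrightarrow> 0) (at_right 0)"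
    using h unfolding polar_expansion_def e_def
    by (auto elim!: Lim_transform_eventually intro!: eventually_mono[OF eventually_at_right_less])
  from primitive_little_o_at_0[OF FE this] obtain C where
    C: "((\<lambda>z. (F z - E z - C) / of_real z ^ Suc m) \<longlongrightarrow> 0) (at_right 0)" by auto
  have "(F z - E z - C) / of_real z ^ Suc m = F z / of_real z ^ Suc m -
     ((\<Sum>k=1..Suc m. (if k = Suc m then C else q k / of_nat (Suc m - k)) / of_real z ^ k) + L / s * of_real (ln z) + (M / s - L / s ^ 2))"
    if z: "z > 0" for z
  proof -
    have "(\<Sum>k=1..Suc m. (if k = Suc m then C else q k / of_nat (Suc m - k)) / of_real z ^ k) = 
          (\<Sum>k=1..m. q k / of_nat (Suc m - k) / of_real z ^ k) + C / of_real z ^ Suc m"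
      by (auto intro!: sum.cong)
    also have "(\<Sum>k=1..m. q k / of_nat (Suc m - k) / of_real z ^ k) = (\<Sum>k=1..m. q k / of_nat (Suc m - k) * of_real z ^ (Suc m - k)) / of_real z ^ Suc m"
      unfolding sum_divide_distrib
    proof (intro sum.cong refl)
      fix k assume "k \<in> {1..m}"
      hence "of_real z ^ Suc m = (of_real z ^ k * of_real z ^ (Suc m - k) :: complex)"
        by (simp flip: power_add)
      thus "q k / of_nat (Suc m - k) / of_real z ^ k = q k / of_nat (Suc m - k) * of_real z ^ (Suc m - k) / of_real z ^ Suc m"
        using z by simp
    qed
    finally show ?thesis using z unfolding E_def by (simp add: diff_divide_distrib add_divide_distrib)
  qed
  with C have "polar_expansion (Suc m) (\<lambda>k. if k = Suc m then C else q k / of_nat (Suc m - k)) (L / s) (M / s - L / s ^ 2) (\<lambda>z. F z / of_real z ^ Suc m)"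
    unfolding polar_expansion_def by (auto elim!: Lim_transform_eventually intro!: eventually_mono[OF eventually_at_right_less])
  thus ?thesis unfolding s_def by blast
qed

lemma powr_times_ln_tendsto_0: "((\<lambda>z. z powr (1/4) * ln z) \<longlongrightarrow> 0) (at_right (0::real))"
  by real_asymp

text \<open>The remainder after the polar part is \<open>O(z powr (-1/4))\<close>: this crude form of
  \<open>O(1 + \<bar>ln z\<bar>)\<close> keeps a product of two remainders integrable.\<close>
lemma polar_expansion_remainder:
  assumes "polar_expansion m q L M h"
  shows "((\<lambda>z. of_real (z powr (1/4)) * (h z - (polar_sum m q z))) \<longlongrightarrow> 0) (at_right 0)"
proof -
  have z: "((\<lambda>z. of_real (z powr (1/4)) :: complex) \<longlongrightarrow> of_real 0) (at_right 0)"
    by (intro tendsto_of_real) real_asymp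
  have l: "((\<lambda>z. of_real (z powr (1/4) * ln z) :: complex) \<longlongrightarrow> of_real 0) (at_right 0)"
    by (intro tendsto_of_real powr_times_ln_tendsto_0)
  have "((\<lambda>z. of_real (z powr (1/4)) * (h z - ((polar_sum m q z) + L * of_real (ln z) + M)) +
       (L * of_real (z powr (1/4) * ln z) + M * of_real (z powr (1/4)))) \<longlongrightarrow> of_real 0 * 0 + (L * of_real 0 + M * of_real 0)) (at_right 0)"
    by (intro tendsto_add tendsto_mult tendsto_const z l assms[unfolded polar_expansion_def])
  thus ?thesis by (simp add: algebra_simps)
qed

lemma polar_expansion_leading:
  assumes "polar_expansion m q L M h" "n > 0" "m \<le> n"
  shows "((\<lambda>z. of_real z ^ n * h z) \<longlongrightarrow> (if m = n then q n else 0)) (at_right 0)"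
proof -
  have 1: "((\<lambda>z. of_real z ^ n * (q k / of_real z ^ k)) \<longlongrightarrow> (if k = n then q n else 0)) (at_right 0)" if "k \<in> {1..m}" for k
  proof -
    have "((\<lambda>z. q k * of_real z ^ (n - k)) \<longlongrightarrow> (if k = n then q n else 0)) (at_right 0)"
      using that assms by (cases "k = n") (auto intro!: tendsto_eq_intros)
    thus ?thesis using that assms
      by (elim Lim_transform_eventually) (auto intro!: eventually_mono[OF eventually_at_right_less] simp: power_diff)
  qed
  have 2: "((\<lambda>z. of_real (z powr (real n - 1/4)) * (of_real (z powr (1/4)) * (h z - (polar_sum m q z)))) \<longlongrightarrow> of_real 0 * 0) (at_right 0)"
    using assms(2) by (intro tendsto_mult polar_expansion_remainder[OF assms(1)] tendsto_of_real) real_asymp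
  have "((\<lambda>z. of_real z ^ n * (h z - (polar_sum m q z))) \<longlongrightarrow> 0) (at_right 0)"
    by (rule Lim_transform_eventually[OF 2[simplified]])
       (auto intro!: eventually_mono[OF eventually_at_right_less] simp: powr_diff powr_realpow)
  moreover have "((\<lambda>z. \<Sum>k=1..m. of_real z ^ n * (q k / of_real z ^ k)) \<longlongrightarrow> (\<Sum>k=1..m. if k = n then q n else 0)) (at_right 0)"
    by (intro tendsto_sum 1)
  ultimately have "((\<lambda>z. of_real z ^ n * (h z - (polar_sum m q z)) + (\<Sum>k=1..m. of_real z ^ n * (q k / of_real z ^ k)))
      \<longlongrightarrow> 0 + (\<Sum>k=1..m. if k = n then q n else 0)) (at_right 0)"
    by (rule tendsto_add)
  hence "((\<lambda>z. of_real z ^ n * h z) \<longlongrightarrow> 0 + (\<Sum>k=1..m. if k = n then q n else 0)) (at_right 0)"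
    by (simp add: algebra_simps sum_distrib_left)
  also have "0 + (\<Sum>k=1..m. if k = n then q n else 0) = (if m = n then q n else 0)"
    using assms by auto
  finally show ?thesis .
qed

text \<open>Only the constant term is recorded: by \<open>polar_sum_tendsto_imp_zero\<close> it does not depend on the choice
  of the polar part, and it is all that an integration by parts contributes.\<close>
definition has_finite_part :: "nat \<Rightarrow> (real \<Rightarrow> complex) \<Rightarrow> complex \<Rightarrow> bool" where
  "has_finite_part N g \<beta> \<longleftrightarrow> (\<exists>b l. ((\<lambda>z. g z - ((polar_sum N b z) + l * of_real (ln z))) \<longlongrightarrow> \<beta>) (at_right 0))"

lemma has_finite_part_tendsto: "(g \<longlongrightarrow> \<beta>) (at_right 0) \<Longrightarrow> has_finite_part N g \<beta>"
  unfolding has_finite_part_def by (intro exI[of _ "\<lambda>_. 0"] exI[of _ 0]) simp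

lemma has_finite_part_ln: "has_finite_part N (\<lambda>z. l * of_real (ln z)) 0"
  unfolding has_finite_part_def by (intro exI[of _ "\<lambda>_. 0"] exI[of _ l]) simp

lemma has_finite_part_add:
  assumes "has_finite_part N f \<beta>" "has_finite_part N g \<gamma>"
  shows "has_finite_part N (\<lambda>z. f z + g z) (\<beta> + \<gamma>)"
proof -
  obtain b l where 1: "((\<lambda>z. f z - ((polar_sum N b z) + l * of_real (ln z))) \<longlongrightarrow> \<beta>) (at_right 0)"
    using assms(1) unfolding has_finite_part_def by blast
  obtain b' l' where 2: "((\<lambda>z. g z - ((polar_sum N b' z) + l' * of_real (ln z))) \<longlongrightarrow> \<gamma>) (at_right 0)"
    using assms(2) unfolding has_finite_part_def by blast
  show ?thesis unfolding has_finite_part_def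
    by (intro exI[of _ "\<lambda>k. b k + b' k"] exI[of _ "l + l'"])
       (use tendsto_add[OF 1 2] in \<open>simp add: algebra_simps add_divide_distrib sum.distrib\<close>)
qed

lemma has_finite_part_sum:
  "(\<And>i. i \<in> I \<Longrightarrow> has_finite_part N (f i) (\<beta> i)) \<Longrightarrow> has_finite_part N (\<lambda>z. \<Sum>i\<in>I. f i z) (\<Sum>i\<in>I. \<beta> i)"
  by (induction I rule: infinite_finite_induct)
     (auto intro: has_finite_part_add has_finite_part_tendsto)

lemma has_finite_part_cong:
  assumes "has_finite_part N f \<beta>" "\<And>z. z > 0 \<Longrightarrow> f z = g z"
  shows "has_finite_part N g \<beta>"
proof -
  obtain b l where 1: "((\<lambda>z. f z - ((polar_sum N b z) + l * of_real (ln z))) \<longlongrightarrow> \<beta>) (at_right 0)"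
    using assms(1) unfolding has_finite_part_def by blast
  show ?thesis unfolding has_finite_part_def
    by (intro exI[of _ b] exI[of _ l] Lim_transform_eventually[OF 1] eventually_mono[OF eventually_at_right_less])
       (simp add: assms(2))
qed

lemma has_finite_part_monomial:
  assumes "k \<le> N + j"
  shows "has_finite_part N (\<lambda>z. c * of_real z ^ j / of_real z ^ k) (if j = k then c else 0)"
proof (cases "k \<le> j")
  case True
  have "((\<lambda>z. c * of_real z ^ (j - k)) \<longlongrightarrow> (if j = k then c else 0)) (at_right 0)"
    using True by (auto intro!: tendsto_eq_intros)
  hence "((\<lambda>z. c * of_real z ^ j / of_real z ^ k) \<longlongrightarrow> (if j = k then c else 0)) (at_right 0)"
    by (rule Lim_transform_eventually)
       (use True in \<open>auto intro!: eventually_mono[OF eventually_at_right_less] simp: power_diff\<close>)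
  thus ?thesis by (rule has_finite_part_tendsto)
next
  case False
  have eq: "c * of_real z ^ j / of_real z ^ k = (\<Sum>i=1..N. (if i = k - j then c else 0) / of_real z ^ i)" if "z > 0" for z :: real
  proof -
    have "(\<Sum>i=1..N. (if i = k - j then c else 0) / of_real z ^ i) = (\<Sum>i=1..N. if i = k - j then c / of_real z ^ (k - j) else 0)"
      by (intro sum.cong) auto
    also have "\<dots> = c / of_real z ^ (k - j)" using False assms by (subst sum.delta) auto
    also have "\<dots> = c * of_real z ^ j / of_real z ^ k" using False that by (simp add: power_diff)
    finally show ?thesis ..
  qed
  have "((\<lambda>z. c * of_real z ^ j / of_real z ^ k - ((\<Sum>i=1..N. (if i = k - j then c else 0) / of_real z ^ i) + 0 * of_real (ln z))) \<longlongrightarrow> 0) (at_right 0)"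
    by (rule Lim_transform_eventually[OF tendsto_const])
       (auto intro!: eventually_mono[OF eventually_at_right_less] simp: eq)
  with False show ?thesis unfolding has_finite_part_def
    by (intro exI[of _ "\<lambda>i. if i = k - j then c else 0"] exI[of _ 0]) simp
qed

text \<open>\<open>z ^ (m + 1) * F z\<close> is a polynomial in \<open>z\<close> up to an error that even the pole of \<open>G\<close> makes vanish at
  \<open>0\<close>. So only the monomials of equal degree in the polynomial and in the polar part of \<open>G\<close> and the
  product of the two constant terms contribute.\<close>
lemma has_finite_part_product:
  assumes F: "polar_expansion (Suc m) c L' M' F" and G: "polar_expansion m q L M G"
  shows "has_finite_part m (\<lambda>z. of_real z ^ Suc m * F z * G z) (c (Suc m) * M + (\<Sum>k=1..m. c (Suc m - k) * q k))"
proof -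
  define p where "p = (\<lambda>j. c (Suc m - j))"
  define R where "R = (\<lambda>z. F z - (polar_sum (Suc m) c z))"
  define S where "S = (\<lambda>z. G z - ((polar_sum m q z) + L * of_real (ln z) + M))"
  have G_lim: "((\<lambda>z. of_real (z powr (1/4)) * of_real z ^ m * G z) \<longlongrightarrow> 0) (at_right 0)"
  proof (cases "m = 0")
    case True
    thus ?thesis using polar_expansion_remainder[OF G] by simp
  next
    case False
    have "((\<lambda>z. of_real (z powr (1/4)) * (of_real z ^ m * G z)) \<longlongrightarrow> of_real 0 * (if m = m then q m else 0)) (at_right 0)"
      using False by (intro tendsto_mult polar_expansion_leading[OF G] tendsto_of_real) (real_asymp, auto)
    thus ?thesis by (simp add: mult_ac)
  qed
  have RG: "((\<lambda>z. of_real z ^ Suc m * R z * G z) \<longlongrightarrow> 0) (at_right 0)"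
  proof -
    have "((\<lambda>z. of_real (z powr (1/2)) * (of_real (z powr (1/4)) * R z) * (of_real (z powr (1/4)) * of_real z ^ m * G z)) \<longlongrightarrow> of_real 0 * 0 * 0) (at_right 0)"
      unfolding R_def by (intro tendsto_mult G_lim polar_expansion_remainder[OF F] tendsto_of_real) real_asymp
    hence "((\<lambda>z. of_real (z powr (1/2)) * (of_real (z powr (1/4)) * R z) * (of_real (z powr (1/4)) * of_real z ^ m * G z)) \<longlongrightarrow> 0) (at_right 0)"
      by simp
    thus ?thesis
    proof (rule Lim_transform_eventually, intro eventually_mono[OF eventually_at_right_less])
      fix z :: real assume z: "z > 0"
      have "z powr (1/2) * z powr (1/4) * z powr (1/4) = z"
        using z by (simp flip: powr_add)
      hence "of_real (z powr (1/2)) * of_real (z powr (1/4)) * of_real (z powr (1/4)) = (of_real z :: complex)"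
        by (metis of_real_mult)
      thus "of_real (z powr (1/2)) * (of_real (z powr (1/4)) * R z) * (of_real (z powr (1/4)) * of_real z ^ m * G z) = of_real z ^ Suc m * R z * G z"
        by (simp add: mult_ac)
    qed
  qed
  have pz: "of_real z ^ Suc m * F z = (\<Sum>j\<le>m. p j * of_real z ^ j) + of_real z ^ Suc m * R z" if "z > 0" for z
  proof -
    have "of_real z ^ Suc m * (polar_sum (Suc m) c z) = (\<Sum>k=1..Suc m. c k * of_real z ^ (Suc m - k))"
      unfolding sum_distrib_left using that by (intro sum.cong) (auto simp: power_diff field_simps)
    also have "\<dots> = (\<Sum>j\<le>m. p j * of_real z ^ j)"
      unfolding p_def by (rule sum.reindex_bij_witness[of _ "\<lambda>j. Suc m - j" "\<lambda>k. Suc m - k"]) auto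
    finally show ?thesis by (simp add: R_def algebra_simps)
  qed
  have main: "has_finite_part m (\<lambda>z. (\<Sum>j\<le>m. p j * of_real z ^ j) * G z) (p 0 * M + (\<Sum>k=1..m. p k * q k))"
  proof -
    have A: "has_finite_part m (\<lambda>z. \<Sum>j\<le>m. \<Sum>k=1..m. p j * q k * of_real z ^ j / of_real z ^ k)
        (\<Sum>j\<le>m. \<Sum>k=1..m. if j = k then p j * q k else 0)"
      by (intro has_finite_part_sum has_finite_part_monomial) auto
    have B: "((\<lambda>z. (\<Sum>j=1..m. p j * L * (of_real z ^ j * of_real (ln z))) + (\<Sum>j\<le>m. p j * of_real z ^ j) * (M + S z)) \<longlongrightarrow>
        (\<Sum>j=1..m. p j * L * 0) + (\<Sum>j\<le>m. p j * 0 ^ j) * (M + 0)) (at_right 0)"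
    proof (intro tendsto_add tendsto_sum tendsto_mult tendsto_const tendsto_power G[unfolded polar_expansion_def, folded S_def])
      show "((\<lambda>z. complex_of_real z) \<longlongrightarrow> 0) (at_right 0)" by (auto intro!: tendsto_eq_intros)
      show "((\<lambda>z. of_real z ^ j * of_real (ln z) :: complex) \<longlongrightarrow> 0) (at_right 0)" if "j \<in> {1..m}" for j
      proof -
        have "((\<lambda>z. of_real (z ^ j * ln z) :: complex) \<longlongrightarrow> of_real 0) (at_right 0)"
          using that by (intro tendsto_of_real) real_asymp
        thus ?thesis by simp
      qed
    qed
    have "(\<Sum>j\<le>m. p j * 0 ^ j) = p 0"
      by (subst sum.atMost_shift) simp
    with B have B: "((\<lambda>z. (\<Sum>j=1..m. p j * L * (of_real z ^ j * of_real (ln z))) + (\<Sum>j\<le>m. p j * of_real z ^ j) * (M + S z)) \<longlongrightarrow> p 0 * M) (at_right 0)"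
      by simp
    have "has_finite_part m (\<lambda>z. (\<Sum>j\<le>m. \<Sum>k=1..m. p j * q k * of_real z ^ j / of_real z ^ k) + p 0 * L * of_real (ln z) + 
      ((\<Sum>j=1..m. p j * L * (of_real z ^ j * of_real (ln z))) + (\<Sum>j\<le>m. p j * of_real z ^ j) * (M + S z)))
      ((\<Sum>j\<le>m. \<Sum>k=1..m. if j = k then p j * q k else 0) + 0 + p 0 * M)"
      by (intro has_finite_part_add A has_finite_part_ln has_finite_part_tendsto[OF B])
    also have "(\<Sum>j\<le>m. \<Sum>k=1..m. if j = k then p j * q k else 0) = (\<Sum>k=1..m. p k * q k)"
      by (subst sum.swap) (auto intro!: sum.cong)
    also have "(\<Sum>k=1..m. p k * q k) + 0 + p 0 * M = p 0 * M + (\<Sum>k=1..m. p k * q k)" by simp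
    finally show ?thesis
    proof (rule has_finite_part_cong)
      fix z :: real assume "z > 0"
      define X where "X = (\<Sum>j\<le>m. p j * of_real z ^ j)"
      have "(\<Sum>j\<le>m. \<Sum>k=1..m. p j * q k * of_real z ^ j / of_real z ^ k) = X * (polar_sum m q z)"
        unfolding X_def sum_product by (intro sum.cong) auto
      moreover have "X = p 0 + (\<Sum>j=1..m. p j * of_real z ^ j)"
        unfolding X_def by (simp add: sum.atMost_shift atLeast0LessThan sum.atLeast1_atMost_eq lessThan_Suc_atMost)
      hence "p 0 * L * of_real (ln z) + (\<Sum>j=1..m. p j * L * (of_real z ^ j * of_real (ln z))) = X * (L * of_real (ln z))"
      proof -
        assume X: "X = p 0 + (\<Sum>j=1..m. p j * of_real z ^ j)"
        have "(\<Sum>j=1..m. p j * L * (of_real z ^ j * of_real (ln z))) = (\<Sum>j=1..m. p j * of_real z ^ j) * (L * of_real (ln z))"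
          unfolding sum_distrib_right by (simp add: mult_ac)
        thus ?thesis by (simp add: X distrib_right)
      qed
      ultimately have "(\<Sum>j\<le>m. \<Sum>k=1..m. p j * q k * of_real z ^ j / of_real z ^ k) + p 0 * L * of_real (ln z) + 
        ((\<Sum>j=1..m. p j * L * (of_real z ^ j * of_real (ln z))) + X * (M + S z)) = 
        X * (polar_sum m q z) + X * (L * of_real (ln z)) + X * (M + S z)"
        by (simp add: algebra_simps)
      also have "\<dots> = X * G z" by (simp add: S_def algebra_simps)
      finally show "(\<Sum>j\<le>m. \<Sum>k=1..m. p j * q k * of_real z ^ j / of_real z ^ k) + p 0 * L * of_real (ln z) + 
        ((\<Sum>j=1..m. p j * L * (of_real z ^ j * of_real (ln z))) + (\<Sum>j\<le>m. p j * of_real z ^ j) * (M + S z)) = (\<Sum>j\<le>m. p j * of_real z ^ j) * G z"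
        by (simp add: X_def)
    qed
  qed
  have "has_finite_part m (\<lambda>z. (\<Sum>j\<le>m. p j * of_real z ^ j) * G z + of_real z ^ Suc m * R z * G z)
      (p 0 * M + (\<Sum>k=1..m. p k * q k) + 0)"
    by (intro has_finite_part_add main has_finite_part_tendsto RG)
  hence "has_finite_part m (\<lambda>z. of_real z ^ Suc m * F z * G z) (p 0 * M + (\<Sum>k=1..m. p k * q k) + 0)"
    by (rule has_finite_part_cong) (simp only: pz distrib_right)
  thus ?thesis by (simp add: p_def)
qed

text \<open>The exponent \<open>-1/2\<close> is that of a product of two remainders of size \<open>z powr (-1/4)\<close>.\<close>
definition polar_integrable :: "nat \<Rightarrow> (real \<Rightarrow> complex) \<Rightarrow> bool" where
  "polar_integrable N g \<longleftrightarrow>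
     (\<exists>d K. \<forall>z\<in>{0<..1}. norm (g z - (polar_sum N d z)) \<le> K * z powr (-1/2))"

lemma polar_integrable_bounded:
  assumes "\<And>z. z \<in> {0<..1} \<Longrightarrow> norm (g z) \<le> K * z powr (-1/2)"
  shows "polar_integrable N g"
  unfolding polar_integrable_def using assms by (intro exI[of _ "\<lambda>_. 0"] exI[of _ K]) simp

lemma polar_integrable_add:
  assumes "polar_integrable N f" "polar_integrable N g"
  shows "polar_integrable N (\<lambda>z. f z + g z)"
proof -
  obtain d K where 1: "\<And>z. z \<in> {0<..1} \<Longrightarrow> norm (f z - (polar_sum N d z)) \<le> K * z powr (-1/2)"
    using assms(1) unfolding polar_integrable_def by blast
  obtain d' K' where 2: "\<And>z. z \<in> {0<..1} \<Longrightarrow> norm (g z - (polar_sum N d' z)) \<le> K' * z powr (-1/2)"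
    using assms(2) unfolding polar_integrable_def by blast
  have "norm (f z + g z - (\<Sum>k=1..N. (d k + d' k) / of_real z ^ k)) \<le> (K + K') * z powr (-1/2)" if "z \<in> {0<..1}" for z
  proof -
    have "f z + g z - (\<Sum>k=1..N. (d k + d' k) / of_real z ^ k) = 
       (f z - (polar_sum N d z)) + (g z - (polar_sum N d' z))"
      by (simp add: sum.distrib add_divide_distrib)
    thus ?thesis using norm_triangle_mono[OF 1[OF that] 2[OF that]] by (simp only: distrib_right)
  qed
  thus ?thesis unfolding polar_integrable_def
    by (intro exI[of _ "\<lambda>k. d k + d' k"] exI[of _ "K + K'"]) blast
qed

lemma polar_integrable_sum:
  "(\<And>i. i \<in> I \<Longrightarrow> polar_integrable N (f i)) \<Longrightarrow> polar_integrable N (\<lambda>z. \<Sum>i\<in>I. f i z)"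
  by (induction I rule: infinite_finite_induct)
     (auto intro: polar_integrable_add polar_integrable_bounded[where K = 0])

lemma polar_integrable_cong:
  assumes "polar_integrable N f" "\<And>z. 0 < z \<Longrightarrow> f z = g z"
  shows "polar_integrable N g"
  using assms unfolding polar_integrable_def by auto

lemma ge_1_powr_neg: "0 < z \<Longrightarrow> z \<le> 1 \<Longrightarrow> a \<le> 0 \<Longrightarrow> 1 \<le> z powr (a::real)"
  using powr_mono2'[of a z 1] by simp

lemma polar_integrable_monomial:
  assumes "k \<le> N + j"
  shows "polar_integrable N (\<lambda>z. c * of_real z ^ j / of_real z ^ k)"
proof (cases "k \<le> j")
  case True
  show ?thesis
  proof (rule polar_integrable_bounded)
    fix z :: real assume z: "z \<in> {0<..1}"
    have "norm (c * of_real z ^ j / of_real z ^ k) = norm c * z ^ (j - k)"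
      using z True by (simp add: norm_mult norm_divide norm_power power_diff)
    also have "\<dots> \<le> norm c * 1" using z by (intro mult_left_mono power_le_one) auto
    also have "\<dots> \<le> norm c * z powr (-1/2)" using z by (intro mult_left_mono ge_1_powr_neg) auto
    finally show "norm (c * of_real z ^ j / of_real z ^ k) \<le> norm c * z powr (-1/2)" .
  qed
next
  case False
  have eq: "c * of_real z ^ j / of_real z ^ k = (\<Sum>i=1..N. (if i = k - j then c else 0) / of_real z ^ i)" if "z > 0" for z :: real
  proof -
    have "(\<Sum>i=1..N. (if i = k - j then c else 0) / of_real z ^ i) = (\<Sum>i=1..N. if i = k - j then c / of_real z ^ (k - j) else 0)"
      by (intro sum.cong) auto
    also have "\<dots> = c / of_real z ^ (k - j)" using False assms by (subst sum.delta) auto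
    also have "\<dots> = c * of_real z ^ j / of_real z ^ k" using False that by (simp add: power_diff)
    finally show ?thesis ..
  qed
  show ?thesis unfolding polar_integrable_def
    by (intro exI[of _ "\<lambda>i. if i = k - j then c else 0"] exI[of _ 0]) (simp add: eq)
qed

lemma bounded_at_0_imp_bounded:
  fixes h :: "real \<Rightarrow> complex"
  assumes lim: "((\<lambda>z. of_real (z powr (1/4)) * h z) \<longlongrightarrow> 0) (at_right 0)"
    and cont: "continuous_on {0<..} h"
  shows "\<exists>K\<ge>0. \<forall>z\<in>{0<..1}. norm (h z) \<le> K * z powr (-1/4)"
proof -
  have "\<forall>\<^sub>F z in at_right 0. norm (of_real (z powr (1/4)) * h z) < 1"
    using tendstoD[OF lim zero_less_one] by simp
  then obtain \<delta> where \<delta>: "\<delta> > 0" "\<And>z. 0 < z \<Longrightarrow> z < \<delta> \<Longrightarrow> norm (of_real (z powr (1/4)) * h z) < 1"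
    unfolding eventually_at_right_field by auto
  have "compact (h ` {\<delta>..1})"
    using \<delta> by (intro compact_continuous_image continuous_on_subset[OF cont]) auto
  then obtain B where B: "\<And>z. z \<in> {\<delta>..1} \<Longrightarrow> norm (h z) \<le> B"
    using compact_imp_bounded[of "h ` {\<delta>..1}"] unfolding bounded_iff by blast
  have "norm (h z) \<le> max 1 B * z powr (-1/4)" if z: "z \<in> {0<..1}" for z
  proof (cases "z < \<delta>")
    case True
    have "z powr (1/4) * norm (h z) < 1" using \<delta>(2)[of z] z True by (simp add: norm_mult)
    hence "norm (h z) \<le> 1 * z powr (-1/4)"
      using z by (simp add: powr_minus field_simps)
    also have "\<dots> \<le> max 1 B * z powr (-1/4)" by (intro mult_right_mono) auto
    finally show ?thesis .
  next
    case False
    have "norm (h z) \<le> max 1 B * 1" using B[of z] z False by auto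
    also have "\<dots> \<le> max 1 B * z powr (-1/4)" using z by (intro mult_left_mono ge_1_powr_neg) auto
    finally show ?thesis .
  qed
  thus ?thesis by (intro exI[of _ "max 1 B"]) auto
qed

lemma polar_expansion_bound:
  assumes "polar_expansion m q L M h" "continuous_on {0<..} h"
  shows "\<exists>K\<ge>0. \<forall>z\<in>{0<..1}. norm (h z - (polar_sum m q z)) \<le> K * z powr (-1/4)"
  by (intro bounded_at_0_imp_bounded polar_expansion_remainder[OF assms(1)] continuous_intros assms) auto

text \<open>Here the factor \<open>z ^ m\<close> compensates only one of the two poles; the other one is the polar part of
  the product.\<close>
lemma polar_integrable_product:
  assumes F: "polar_expansion m c L' M' F" "continuous_on {0<..} F"
    and G: "polar_expansion m q L M G" "continuous_on {0<..} G"
  shows "polar_integrable m (\<lambda>z. of_real z ^ m * F z * G z)"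
proof -
  define A where "A = (\<lambda>z::real. \<Sum>k=1..m. c k / of_real z ^ k)"
  define B where "B = (\<lambda>z::real. \<Sum>k=1..m. q k / of_real z ^ k)"
  obtain K where K: "K \<ge> 0" "\<And>z. z \<in> {0<..1} \<Longrightarrow> norm (F z - A z) \<le> K * z powr (-1/4)"
    using polar_expansion_bound[OF F] unfolding A_def by blast
  obtain K' where K': "K' \<ge> 0" "\<And>z. z \<in> {0<..1} \<Longrightarrow> norm (G z - B z) \<le> K' * z powr (-1/4)"
    using polar_expansion_bound[OF G] unfolding B_def by blast
  have bound: "norm (of_real z ^ m * (polar_sum m e z)) \<le> (\<Sum>k=1..m. norm (e k))" if z: "z \<in> {0<..1}" for z :: real and e :: "nat \<Rightarrow> complex"
    unfolding sum_distrib_left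
  proof (rule sum_norm_le)
    fix k assume k: "k \<in> {1..m}"
    have "norm (of_real z ^ m * (e k / of_real z ^ k)) = z ^ (m - k) * norm (e k)"
      using z k by (simp add: norm_mult norm_divide norm_power power_diff)
    also have "\<dots> \<le> 1 * norm (e k)" using z by (intro mult_right_mono power_le_one) auto
    finally show "norm (of_real z ^ m * (e k / of_real z ^ k)) \<le> norm (e k)" by simp
  qed
  have half: "z powr (-1/4) \<le> z powr (-1/2)" if "z \<in> {0<..1}" for z :: real
    using that by (intro powr_mono') auto
  have 1: "polar_integrable m (\<lambda>z. of_real z ^ m * A z * B z)"
  proof (rule polar_integrable_cong)
    show "polar_integrable m (\<lambda>z. \<Sum>k=1..m. \<Sum>l=1..m. c k * q l * of_real z ^ m / of_real z ^ (k + l))"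
      by (intro polar_integrable_sum polar_integrable_monomial) auto
    show "(\<Sum>k=1..m. \<Sum>l=1..m. c k * q l * of_real z ^ m / of_real z ^ (k + l)) = of_real z ^ m * A z * B z" for z
    proof -
      have "of_real z ^ m * (A z * B z) = (\<Sum>k=1..m. \<Sum>l=1..m. of_real z ^ m * (c k / of_real z ^ k * (q l / of_real z ^ l)))"
        unfolding A_def B_def sum_product by (simp only: sum_distrib_left)
      also have "\<dots> = (\<Sum>k=1..m. \<Sum>l=1..m. c k * q l * of_real z ^ m / of_real z ^ (k + l))"
        by (intro sum.cong refl) (simp add: power_add mult_ac)
      finally show ?thesis by (simp only: mult.assoc)
    qed
  qed
  have 2: "polar_integrable m (\<lambda>z. of_real z ^ m * A z * (G z - B z))"
  proof (rule polar_integrable_bounded)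
    fix z :: real assume z: "z \<in> {0<..1}"
    have "norm (of_real z ^ m * A z * (G z - B z)) \<le> (\<Sum>k=1..m. norm (c k)) * (K' * z powr (-1/4))"
      unfolding norm_mult[of _ "G z - B z"] using K'(2)[OF z] bound[OF z, of c] unfolding A_def
      by (intro mult_mono) (auto intro: sum_nonneg)
    also have "\<dots> \<le> (\<Sum>k=1..m. norm (c k)) * (K' * z powr (-1/2))"
      using K' half[OF z] by (intro mult_left_mono) (auto intro: sum_nonneg)
    finally show "norm (of_real z ^ m * A z * (G z - B z)) \<le> (\<Sum>k=1..m. norm (c k)) * K' * z powr (-1/2)"
      by simp
  qed
  have 3: "polar_integrable m (\<lambda>z. of_real z ^ m * B z * (F z - A z))"
  proof (rule polar_integrable_bounded)
    fix z :: real assume z: "z \<in> {0<..1}"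
    have "norm (of_real z ^ m * B z * (F z - A z)) \<le> (\<Sum>k=1..m. norm (q k)) * (K * z powr (-1/4))"
      unfolding norm_mult[of _ "F z - A z"] using K(2)[OF z] bound[OF z, of q] unfolding B_def
      by (intro mult_mono) (auto intro: sum_nonneg)
    also have "\<dots> \<le> (\<Sum>k=1..m. norm (q k)) * (K * z powr (-1/2))"
      using K half[OF z] by (intro mult_left_mono) (auto intro: sum_nonneg)
    finally show "norm (of_real z ^ m * B z * (F z - A z)) \<le> (\<Sum>k=1..m. norm (q k)) * K * z powr (-1/2)"
      by simp
  qed
  have 4: "polar_integrable m (\<lambda>z. of_real z ^ m * (F z - A z) * (G z - B z))"
  proof (rule polar_integrable_bounded)
    fix z :: real assume z: "z \<in> {0<..1}"
    have "norm (of_real z ^ m * (F z - A z) * (G z - B z)) = z ^ m * (norm (F z - A z) * norm (G z - B z))"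
      using z by (simp add: norm_mult norm_power)
    also have "\<dots> \<le> 1 * ((K * z powr (-1/4)) * (K' * z powr (-1/4)))"
      using K(2)[OF z] K'(2)[OF z] K(1) z by (intro mult_mono power_le_one mult_nonneg_nonneg) auto
    also have "\<dots> = K * K' * (z powr (-1/4) * z powr (-1/4))" by simp
    also have "z powr (-1/4) * z powr (-1/4) = z powr (-1/2)" by (simp flip: powr_add)
    finally show "norm (of_real z ^ m * (F z - A z) * (G z - B z)) \<le> K * K' * z powr (-1/2)" .
  qed
  show ?thesis
    by (rule polar_integrable_cong[OF polar_integrable_add[OF polar_integrable_add[OF 1 2] polar_integrable_add[OF 3 4]]])
       (simp add: algebra_simps)
qed

lemma powr_minus_half_integrable: "(\<lambda>z::real. K * z powr (-1/2)) integrable_on {0<..<1}"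
  using integrable_on_powr_from_0[of "-1/2" 1]
  by (intro integrable_on_mult_right) (simp add: integrable_on_Icc_iff_Ioo)

lemma polar_integrable_imp_absolutely_integrable:
  assumes "polar_integrable N g" "continuous_on {0<..} g"
  obtains d where "(\<lambda>z. g z - (polar_sum N d z)) absolutely_integrable_on {0<..<1}"
proof -
  obtain d K where 1: "\<And>z. z \<in> {0<..1} \<Longrightarrow> norm (g z - (polar_sum N d z)) \<le> K * z powr (-1/2)"
    using assms(1) unfolding polar_integrable_def by blast
  have "(\<lambda>z. g z - (polar_sum N d z)) absolutely_integrable_on {0<..<1}"
    by (rule continuous_bounded_imp_absolutely_integrable[OF _ _ powr_minus_half_integrable 1])
       (auto intro!: continuous_intros continuous_on_subset[OF assms(2)])
  thus ?thesis by (rule that)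
qed

section \<open>Laplace transforms on the half-line\<close>

lemma lborel_lebesgue_continuous:
  fixes f :: "real \<Rightarrow> complex"
  assumes "continuous_on S f" "S \<in> sets borel"
  shows "set_integrable lborel S f \<longleftrightarrow> f absolutely_integrable_on S"
    and "(LINT x:S|lebesgue. f x) = (LBINT x:S. f x)"
proof -
  have meas: "(\<lambda>x. indicat_real S x *\<^sub>R f x) \<in> borel_measurable lborel"
    using borel_measurable_continuous_on_indicator[OF assms(2,1)] by simp
  show "set_integrable lborel S f \<longleftrightarrow> f absolutely_integrable_on S"
    using meas unfolding set_integrable_def by (simp add: integrable_completion)
  show "(LINT x:S|lebesgue. f x) = (LBINT x:S. f x)"
    using meas unfolding set_lebesgue_integral_def by (simp add: integral_completion)
qed

lemma LBINT_eq_integral: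
  fixes f :: "real \<Rightarrow> complex"
  assumes "continuous_on S f" "S \<in> sets borel" "f absolutely_integrable_on S"
  shows "(LBINT x:S. f x) = integral S f"
  using assms lborel_lebesgue_continuous(2)[of S f] set_lebesgue_integral_eq_integral(2)[OF assms(3)] by simp

text \<open>Euler's integral after the substitution \<open>t \<mapsto> x * t\<close>.\<close>
lemma Gamma_integral_scaled:
  assumes w: "Re w > 0" and x: "x > 0"
  shows "(\<lambda>t. of_real (exp (- x * t)) * of_real t powr (w - 1)) absolutely_integrable_on {0<..}"
    and "integral {0<..} (\<lambda>t. of_real (exp (- x * t)) * of_real t powr (w - 1)) = Gamma w * of_real x powr (- w)"
proof -
  have cont: "continuous_on {0<..} (\<lambda>t. of_real (exp (- x * t)) * of_real t powr (w - 1) :: complex)" for x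
    by (intro continuous_intros) auto
  show int: "(\<lambda>t. of_real (exp (- x * t)) * of_real t powr (w - 1)) absolutely_integrable_on {0<..}"
    using absolutely_integrable_Gamma_integral[OF w x]
    by (simp add: exp_minus field_simps)
  have int1: "(\<lambda>t. of_real (exp (- 1 * t)) * of_real t powr (w - 1)) absolutely_integrable_on {0<..}"
    using absolutely_integrable_Gamma_integral[OF w, of 1]
    by (simp add: exp_minus field_simps)
  have "Gamma w = integral {0<..} (\<lambda>t. of_real (exp (- 1 * t)) * of_real t powr (w - 1))"
    using Gamma_integral_complex'[OF w] by (simp add: exp_minus field_simps integral_unique)
  also have "\<dots> = (LBINT t:{0<..}. of_real (exp (- 1 * t)) * of_real t powr (w - 1))"
    by (intro LBINT_eq_integral[symmetric] cont int1) auto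
  also have "\<dots> = x *\<^sub>R (LINT t|lborel. indicat_real {0<..} (0 + x * t) *\<^sub>R (of_real (exp (- 1 * (0 + x * t))) * of_real (0 + x * t) powr (w - 1)))"
    unfolding set_lebesgue_integral_def using x by (subst lborel_integral_real_affine[of x _ 0]) auto
  also have "(LINT t|lborel. indicat_real {0<..} (0 + x * t) *\<^sub>R (of_real (exp (- 1 * (0 + x * t))) * of_real (0 + x * t) powr (w - 1)))
     = (LINT t|lborel. of_real x powr (w - 1) * (indicat_real {0<..} t *\<^sub>R (of_real (exp (- x * t)) * of_real t powr (w - 1))))"
    using x by (intro Bochner_Integration.integral_cong) (auto simp: indicator_def powr_times_real zero_less_mult_iff)
  also have "\<dots> = of_real x powr (w - 1) * (LBINT t:{0<..}. of_real (exp (- x * t)) * of_real t powr (w - 1))"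
    unfolding set_lebesgue_integral_def by (rule integral_mult_right_zero)
  also have "(LBINT t:{0<..}. of_real (exp (- x * t)) * of_real t powr (w - 1)) = integral {0<..} (\<lambda>t. of_real (exp (- x * t)) * of_real t powr (w - 1))"
    by (intro LBINT_eq_integral cont int) auto
  also have "x *\<^sub>R (of_real x powr (w - 1) * integral {0<..} (\<lambda>t. of_real (exp (- x * t)) * of_real t powr (w - 1))) = 
      of_real x powr w * integral {0<..} (\<lambda>t. of_real (exp (- x * t)) * of_real t powr (w - 1))"
    using x by (simp add: powr_diff scaleR_conv_of_real)
  finally show "integral {0<..} (\<lambda>t. of_real (exp (- x * t)) * of_real t powr (w - 1)) = Gamma w * of_real x powr (- w)"
    using x by (simp add: powr_minus field_simps)
qed

lemma has_vector_derivative_quadratic_bound: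
  fixes F :: "real \<Rightarrow> complex"
  assumes "\<delta> > 0" "\<And>h. \<bar>h\<bar> \<le> \<delta> \<Longrightarrow> norm (F (z + h) - F z - of_real h * D) \<le> K * h\<^sup>2"
  shows "(F has_vector_derivative D) (at z)"
  unfolding has_vector_derivative_def has_derivative_at
proof (intro conjI bounded_linear_intros)
  show "(\<lambda>h. norm (F (z + h) - F z - h *\<^sub>R D) / norm h) \<midarrow>0\<rightarrow> 0"
  proof (rule Lim_null_comparison)
    show "\<forall>\<^sub>F h in at 0. norm (norm (F (z + h) - F z - h *\<^sub>R D) / norm h) \<le> K * \<bar>h\<bar>"
      unfolding eventually_at
    proof (intro exI[of _ \<delta>] conjI ballI impI)
      fix h :: real assume h: "h \<noteq> 0 \<and> dist h 0 < \<delta>"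
      have "norm (F (z + h) - F z - h *\<^sub>R D) \<le> K * (\<bar>h\<bar> * \<bar>h\<bar>)"
        using assms(2)[of h] h by (simp add: scaleR_conv_of_real power2_eq_square)
      thus "norm (norm (F (z + h) - F z - h *\<^sub>R D) / norm h) \<le> K * \<bar>h\<bar>"
        using h by (simp add: pos_divide_le_eq mult_ac)
    qed (use assms in auto)
    show "(\<lambda>h. K * \<bar>h\<bar>) \<midarrow>0\<rightarrow> 0" by (auto intro!: tendsto_eq_intros)
  qed
qed

lemma exp_quadratic_remainder: "\<bar>exp x - 1 - x\<bar> \<le> exp \<bar>x\<bar> * x\<^sup>2 / 2" for x :: real
proof -
  obtain t where t: "\<bar>t\<bar> \<le> \<bar>x\<bar>" "exp x = (\<Sum>m<2. x ^ m / fact m) + exp t / fact 2 * x ^ 2"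
    using Maclaurin_exp_le[of x 2] by blast
  have "exp x - 1 - x = exp t * x\<^sup>2 / 2" using t(2) by (simp add: numeral_2_eq_2)
  moreover have "exp t * x\<^sup>2 / 2 \<le> exp \<bar>x\<bar> * x\<^sup>2 / 2" using t(1)
    by (intro divide_right_mono mult_right_mono) auto
  moreover have "0 \<le> exp t * x\<^sup>2 / 2" by simp
  ultimately show ?thesis by linarith
qed

lemma square_le_exp: "t \<ge> 0 \<Longrightarrow> c > 0 \<Longrightarrow> t\<^sup>2 \<le> 2 / c\<^sup>2 * exp (c * t)" for t c :: real
  using exp_lower_Taylor_quadratic[of "c * t"] by (simp add: field_simps power_mult_distrib) 
     (smt (verit) mult_nonneg_nonneg)

lemma linear_le_exp: "t \<ge> 0 \<Longrightarrow> c > 0 \<Longrightarrow> t \<le> 1 / c * exp (c * t)" for t c :: real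
proof -
  assume "c > 0"
  moreover have "c * t \<le> exp (c * t)" using exp_ge_add_one_self[of "c * t"] by linarith
  ultimately show ?thesis by (simp add: field_simps)
qed

lemma laplace_moment_integrable:
  fixes \<phi> :: "real \<Rightarrow> complex"
  assumes cont: "continuous_on {0<..} \<phi>"
    and int: "\<And>z. z > 0 \<Longrightarrow> (\<lambda>t. of_real (exp (- z * t)) * \<phi> t) absolutely_integrable_on {0<..}"
    and z: "z > 0"
  shows "(\<lambda>t. of_real (exp (- z * t)) * (of_real t * \<phi> t)) absolutely_integrable_on {0<..}"
proof (rule continuous_bounded_imp_absolutely_integrable)
  show "(\<lambda>t. 2 / z * norm (of_real (exp (- (z / 2) * t)) * \<phi> t)) integrable_on {0<..}"
    using int[of "z / 2"] z by (intro integrable_on_mult_right) (auto simp: absolutely_integrable_on_def)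
  fix t :: real assume t: "t \<in> {0<..}"
  have "exp (- z * t) * t \<le> exp (- z * t) * (1 / (z / 2) * exp (z / 2 * t))"
    using t z by (intro mult_left_mono linear_le_exp) auto
  also have "\<dots> = 2 / z * (exp (- z * t) * exp (z / 2 * t))" by simp
  also have "exp (- z * t) * exp (z / 2 * t) = exp (- (z / 2) * t)"
    by (simp flip: exp_add)
  finally have "exp (- z * t) * t * norm (\<phi> t) \<le> 2 / z * exp (- (z / 2) * t) * norm (\<phi> t)"
    by (intro mult_right_mono) auto
  thus "norm (of_real (exp (- z * t)) * (of_real t * \<phi> t)) \<le> 2 / z * norm (of_real (exp (- (z / 2) * t)) * \<phi> t)"
    using t by (simp add: norm_mult mult_ac)
qed (auto intro!: continuous_intros cont)

text \<open>The second-order Taylor remainder of the exponential in \<open>h\<close> is at most a multiple of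
  \<open>h\<^sup>2 * exp (- (z / 4) * t)\<close>, uniformly in \<open>t\<close>, once \<open>\<bar>h\<bar> \<le> z / 2\<close>.\<close>
lemma laplace_has_vector_derivative:
  fixes \<phi> :: "real \<Rightarrow> complex"
  assumes cont: "continuous_on {0<..} \<phi>"
    and int: "\<And>z. z > 0 \<Longrightarrow> (\<lambda>t. of_real (exp (- z * t)) * \<phi> t) absolutely_integrable_on {0<..}"
    and z: "z > 0"
  shows "((\<lambda>z. integral {0<..} (\<lambda>t. of_real (exp (- z * t)) * \<phi> t)) has_vector_derivative
           - integral {0<..} (\<lambda>t. of_real (exp (- z * t)) * (of_real t * \<phi> t))) (at z)"
proof -
  \<comment> \<open>of the decay \<open>exp (- z * t)\<close>, one half pays for the shift by \<open>h\<close>, one quarter for \<open>t\<^sup>2\<close>\<close>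
  define c where "c = z / 4"
  have c: "c > 0" using z by (simp add: c_def)
  define B where "B = integral {0<..} (\<lambda>t. norm (of_real (exp (- c * t)) * \<phi> t))"
  show ?thesis
  proof (rule has_vector_derivative_quadratic_bound[where \<delta> = "z / 2" and K = "1 / c\<^sup>2 * B"])
    fix h :: real assume h: "\<bar>h\<bar> \<le> z / 2"
    note i = set_lebesgue_integral_eq_integral(1)
    have i1: "(\<lambda>t. of_real (exp (- (z + h) * t)) * \<phi> t) integrable_on {0<..}" using h z by (intro i int) auto
    have i2: "(\<lambda>t. of_real (exp (- z * t)) * \<phi> t) integrable_on {0<..}" using z by (intro i int)
    have i3: "(\<lambda>t. of_real h * (of_real (exp (- z * t)) * (of_real t * \<phi> t))) integrable_on {0<..}" 
      using z by (intro integrable_on_mult_right i laplace_moment_integrable cont int) auto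
    define A where "A = integral {0<..} (\<lambda>t. of_real (exp (- (z + h) * t)) * \<phi> t) - integral {0<..} (\<lambda>t. of_real (exp (- z * t)) * \<phi> t) -
      of_real h * - integral {0<..} (\<lambda>t. of_real (exp (- z * t)) * (of_real t * \<phi> t))"
    define g where "g = (\<lambda>t. of_real (exp (- (z + h) * t)) * \<phi> t - of_real (exp (- z * t)) * \<phi> t + of_real h * (of_real (exp (- z * t)) * (of_real t * \<phi> t)))"
    have A: "A = integral {0<..} g"
      unfolding A_def g_def using i1 i2 i3 by (simp add: integral_add integral_diff integrable_diff)
    have "norm A = norm (integral {0<..} g)" by (simp only: A)
    also have "\<dots> \<le> integral {0<..} (\<lambda>t. h\<^sup>2 / c\<^sup>2 * norm (of_real (exp (- c * t)) * \<phi> t))"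
      unfolding g_def
    proof (rule integral_norm_bound_integral)
      show "(\<lambda>t. of_real (exp (- (z + h) * t)) * \<phi> t - of_real (exp (- z * t)) * \<phi> t + of_real h * (of_real (exp (- z * t)) * (of_real t * \<phi> t))) integrable_on {0<..}"
        by (intro integrable_add integrable_diff i1 i2 i3)
      show "(\<lambda>t. h\<^sup>2 / c\<^sup>2 * norm (of_real (exp (- c * t)) * \<phi> t)) integrable_on {0<..}"
        using int[OF c] by (intro integrable_on_mult_right) (auto simp: absolutely_integrable_on_def)
      fix t :: real assume t: "t \<in> {0<..}"
      have "exp (- (z + h) * t) - exp (- z * t) + h * exp (- z * t) * t = exp (- z * t) * (exp (- h * t) - 1 - (- h * t))"
        by (simp add: algebra_simps flip: exp_add)
      hence "\<bar>exp (- (z + h) * t) - exp (- z * t) + h * exp (- z * t) * t\<bar> \<le> exp (- z * t) * (exp \<bar>- h * t\<bar> * (- h * t)\<^sup>2 / 2)"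
        using exp_quadratic_remainder[of "- h * t"] by (simp add: abs_mult mult_left_mono)
      also have "\<dots> \<le> exp (- z * t) * (exp (z / 2 * t) * (h\<^sup>2 * (2 / c\<^sup>2 * exp (c * t))) / 2)"
      proof (intro mult_left_mono divide_right_mono mult_mono)
        show "(- h * t)\<^sup>2 \<le> h\<^sup>2 * (2 / c\<^sup>2 * exp (c * t))"
          using mult_left_mono[OF square_le_exp[of t c], of "h\<^sup>2"] t c by (simp add: power_mult_distrib)
        show "exp \<bar>- h * t\<bar> \<le> exp (z / 2 * t)" using h t by (simp add: abs_mult mult_right_mono)
      qed auto
      also have "\<dots> = h\<^sup>2 / c\<^sup>2 * (exp (- z * t) * exp (z / 2 * t) * exp (c * t))" by simp
      also have "exp (- z * t) * exp (z / 2 * t) * exp (c * t) = exp (- c * t)"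
        unfolding exp_add[symmetric] by (simp add: c_def algebra_simps)
      finally have "\<bar>exp (- (z + h) * t) - exp (- z * t) + h * exp (- z * t) * t\<bar> * norm (\<phi> t) \<le> h\<^sup>2 / c\<^sup>2 * exp (- c * t) * norm (\<phi> t)"
        by (rule mult_right_mono) auto
      moreover have "of_real (exp (- (z + h) * t)) * \<phi> t - of_real (exp (- z * t)) * \<phi> t + of_real h * (of_real (exp (- z * t)) * (of_real t * \<phi> t))
         = of_real (exp (- (z + h) * t) - exp (- z * t) + h * exp (- z * t) * t) * \<phi> t"
        by (simp add: algebra_simps)
      ultimately show "norm (of_real (exp (- (z + h) * t)) * \<phi> t - of_real (exp (- z * t)) * \<phi> t + of_real h * (of_real (exp (- z * t)) * (of_real t * \<phi> t)))
        \<le> h\<^sup>2 / c\<^sup>2 * norm (of_real (exp (- c * t)) * \<phi> t)"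
        by (simp only: norm_mult norm_of_real) simp
    qed
    also have "\<dots> = h\<^sup>2 / c\<^sup>2 * B" unfolding B_def by (rule integral_mult_right)
    also have "h\<^sup>2 / c\<^sup>2 * B = 1 / c\<^sup>2 * B * h\<^sup>2" by simp
    finally show "norm (integral {0<..} (\<lambda>t. of_real (exp (- (z + h) * t)) * \<phi> t) - integral {0<..} (\<lambda>t. of_real (exp (- z * t)) * \<phi> t) -
      of_real h * - integral {0<..} (\<lambda>t. of_real (exp (- z * t)) * (of_real t * \<phi> t))) \<le> 1 / c\<^sup>2 * B * h\<^sup>2"
      unfolding A_def .
  qed (use z in auto)
qed

text \<open>Interchanging the order of integration turns the Mellin transform of a Laplace transform into
  a Mellin transform of the density.\<close>
lemma mellin_laplace:
  fixes h :: "real \<Rightarrow> complex"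
  assumes w: "Re w > 0" and cont: "continuous_on {0<..} h"
    and int: "(\<lambda>x. of_real x powr (- w) * h x) absolutely_integrable_on {0<..}"
    and int_L: "\<And>t. t > 0 \<Longrightarrow> (\<lambda>x. of_real (exp (- t * x)) * h x) absolutely_integrable_on {0<..}"
  defines "H \<equiv> \<lambda>t. integral {0<..} (\<lambda>x. of_real (exp (- t * x)) * h x)"
  shows "(\<lambda>t. of_real t powr (w - 1) * H t) absolutely_integrable_on {0<..}"
    and "integral {0<..} (\<lambda>t. of_real t powr (w - 1) * H t) = Gamma w * integral {0<..} (\<lambda>x. of_real x powr (- w) * h x)"
proof -
  define f where "f = (\<lambda>(x,t). indicat_real ({0<..} \<times> {0<..}) (x, t) *\<^sub>R (of_real t powr (w - 1) * (of_real (exp (- t * x)) * h x)))"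
  have cont_H: "continuous_on {0<..} H"
    unfolding H_def using laplace_has_vector_derivative[OF cont int_L]
    by (intro continuous_at_imp_continuous_on ballI has_vector_derivative_continuous) auto
  have "continuous_on ({0<..} \<times> {0<..}) (\<lambda>p. of_real (snd p) powr (w - 1) * (of_real (exp (- snd p * fst p)) * h (fst p)))"
    by (intro continuous_intros continuous_on_powr_complex continuous_on_compose2[OF cont])
       (auto simp: complex_nonpos_Reals_iff)
  hence "(\<lambda>p. indicat_real ({0<..} \<times> {0<..}) p *\<^sub>R (of_real (snd p) powr (w - 1) * (of_real (exp (- snd p * fst p)) * h (fst p)))) \<in> borel_measurable borel"
    by (intro borel_measurable_continuous_on_indicator borel_open open_Times) auto
  hence meas: "f \<in> borel_measurable (lborel \<Otimes>\<^sub>M lborel)"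
    unfolding f_def lborel_prod by (simp add: case_prod_unfold)
  have f1: "f (x, t) = indicat_real {0<..} x *\<^sub>R (h x * (indicat_real {0<..} t *\<^sub>R (of_real (exp (- x * t)) * of_real t powr (w - 1))))" for x t
    by (auto simp: f_def indicator_def mult_ac)
  have f2: "f (x, t) = indicat_real {0<..} t *\<^sub>R (of_real t powr (w - 1) * (indicat_real {0<..} x *\<^sub>R (of_real (exp (- t * x)) * h x)))" for x t
    by (auto simp: f_def indicator_def mult_ac)
  have cont_G: "continuous_on {0<..} (\<lambda>t. of_real (exp (- x * t)) * of_real t powr (v - 1) :: complex)" for x v
    by (intro continuous_intros) auto
  have G_int: "integrable lborel (\<lambda>t. indicat_real {0<..} t *\<^sub>R (of_real (exp (- x * t)) * of_real t powr (v - 1) :: complex))"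
    if "Re v > 0" "x > 0" for v x
    using Gamma_integral_scaled(1)[OF that] lborel_lebesgue_continuous(1)[OF cont_G, of x v]
    unfolding set_integrable_def by simp
  have G_val: "(LINT t|lborel. indicat_real {0<..} t *\<^sub>R (of_real (exp (- x * t)) * of_real t powr (v - 1) :: complex)) = Gamma v * of_real x powr (- v)"
    if "Re v > 0" "x > 0" for v x
    using Gamma_integral_scaled(2)[OF that] LBINT_eq_integral[OF cont_G _ Gamma_integral_scaled(1)[OF that]]
    unfolding set_lebesgue_integral_def by simp
  have inner1: "integrable lborel (\<lambda>t. f (x, t))" for x
  proof (cases "x > 0")
    case True
    show ?thesis unfolding f1 by (intro integrable_scaleR_right integrable_mult_right G_int w True)
  qed (simp add: f1)
  have norm1: "(LINT t|lborel. norm (f (x, t))) = norm (indicat_real {0<..} x *\<^sub>R (of_real (Gamma (Re w)) * (of_real x powr (- w) * h x)))" for x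
  proof (cases "x > 0")
    case True
    have eq: "indicat_real {0<..} t *\<^sub>R (of_real (exp (- x * t)) * of_real t powr (of_real (Re w) - 1) :: complex)
        = of_real (norm (indicat_real {0<..} t *\<^sub>R (of_real (exp (- x * t)) * of_real t powr (w - 1) :: complex)))" for t
    proof (cases "t > 0")
      case True
      have "of_real t powr (of_real (Re w) - 1) = (of_real (t powr (Re w - 1)) :: complex)"
        using powr_of_real[of t "Re w - 1"] True by simp
      thus ?thesis using True by (simp add: norm_mult norm_of_real_powr)
    qed auto
    have "complex_of_real (LINT t|lborel. norm (indicat_real {0<..} t *\<^sub>R (of_real (exp (- x * t)) * of_real t powr (w - 1) :: complex)))
       = (LINT t|lborel. of_real (norm (indicat_real {0<..} t *\<^sub>R (of_real (exp (- x * t)) * of_real t powr (w - 1) :: complex))))"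
      by (rule integral_complex_of_real[symmetric])
    also have "\<dots> = Gamma (of_real (Re w)) * (of_real x powr (- of_real (Re w)) :: complex)"
      unfolding eq[symmetric] by (rule G_val) (use w True in auto)
    also have "\<dots> = of_real (Gamma (Re w) * x powr (- Re w))"
      using True w by (simp add: Gamma_complex_of_real powr_of_real flip: of_real_minus)
    finally have "(LINT t|lborel. norm (indicat_real {0<..} t *\<^sub>R (of_real (exp (- x * t)) * of_real t powr (w - 1) :: complex)))
       = Gamma (Re w) * x powr (- Re w)" by (simp only: of_real_eq_iff)
    hence val: "norm (h x) * (LINT t|lborel. norm (indicat_real {0<..} t *\<^sub>R (of_real (exp (- x * t)) * of_real t powr (w - 1) :: complex)))
       = norm (h x) * (Gamma (Re w) * x powr (- Re w))" by (simp only:)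
    have "(LINT t|lborel. norm (f (x, t))) = (LINT t|lborel. norm (h x) * norm (indicat_real {0<..} t *\<^sub>R (of_real (exp (- x * t)) * of_real t powr (w - 1) :: complex)))"
      unfolding f1 using True by (intro Bochner_Integration.integral_cong refl) (simp add: norm_mult)
    also have "\<dots> = norm (h x) * (LINT t|lborel. norm (indicat_real {0<..} t *\<^sub>R (of_real (exp (- x * t)) * of_real t powr (w - 1) :: complex)))"
      by (rule integral_mult_right_zero)
    also note val
    finally show ?thesis using True Gamma_real_pos[OF w] by (simp add: norm_mult norm_of_real_powr)
  qed (auto simp: f1)
  have contx: "continuous_on {0<..} (\<lambda>x. of_real x powr (- w) * h x)"
    by (intro continuous_intros cont) auto
  have intx: "integrable lborel (\<lambda>x. indicat_real {0<..} x *\<^sub>R (of_real x powr (- w) * h x))"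
    using int lborel_lebesgue_continuous(1)[OF contx] unfolding set_integrable_def by simp
  have "integrable lborel (\<lambda>x. norm (of_real (Gamma (Re w)) * (indicat_real {0<..} x *\<^sub>R (of_real x powr (- w) * h x))))"
    by (intro integrable_norm integrable_mult_right intx)
  hence norm_int: "integrable lborel (\<lambda>x. LINT t|lborel. norm (f (x, t)))"
    unfolding norm1 by (simp add: mult_ac)
  have f_int: "integrable (lborel \<Otimes>\<^sub>M lborel) f"
    using inner1 by (intro lborel_pair.Fubini_integrable meas norm_int) auto
  have H_eq: "(LINT x|lborel. f (x, t)) = indicat_real {0<..} t *\<^sub>R (of_real t powr (w - 1) * H t)" for t
  proof (cases "t > 0")
    case True
    have c: "continuous_on {0<..} (\<lambda>x. of_real (exp (- t * x)) * h x)" by (intro continuous_intros cont)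
    have "(LINT x|lborel. f (x, t)) = indicat_real {0<..} t *\<^sub>R (of_real t powr (w - 1) * (LBINT x:{0<..}. of_real (exp (- t * x)) * h x))"
      unfolding f2 set_lebesgue_integral_def by (simp only: integral_scaleR_right integral_mult_right_zero)
    thus ?thesis using LBINT_eq_integral[OF c _ int_L[OF True]] by (simp add: H_def)
  qed (simp add: f2)
  have cont_tH: "continuous_on {0<..} (\<lambda>t. of_real t powr (w - 1) * H t)"
    by (intro continuous_intros cont_H) auto
  have "integrable lborel (\<lambda>t. LINT x|lborel. f (x, t))"
    using lborel_pair.integrable_snd[of "\<lambda>x t. f (x, t)"] f_int by (simp add: case_prod_unfold)
  hence "set_integrable lborel {0<..} (\<lambda>t. of_real t powr (w - 1) * H t)"
    unfolding H_eq set_integrable_def .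
  thus int_tH: "(\<lambda>t. of_real t powr (w - 1) * H t) absolutely_integrable_on {0<..}"
    using lborel_lebesgue_continuous(1)[OF cont_tH] by simp
  have "integral {0<..} (\<lambda>t. of_real t powr (w - 1) * H t) = (LBINT t:{0<..}. of_real t powr (w - 1) * H t)"
    by (intro LBINT_eq_integral[symmetric] cont_tH int_tH) auto
  also have "\<dots> = (LINT t|lborel. LINT x|lborel. f (x, t))"
    unfolding H_eq set_lebesgue_integral_def ..
  also have "\<dots> = (LINT x|lborel. LINT t|lborel. f (x, t))"
    using lborel_pair.Fubini_integral[of "\<lambda>x t. f (x, t)"] f_int by (simp add: case_prod_unfold)
  also have "\<dots> = (LINT x|lborel. Gamma w * (indicat_real {0<..} x *\<^sub>R (of_real x powr (- w) * h x)))"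
  proof (intro Bochner_Integration.integral_cong refl)
    fix x :: real
    show "(LINT t|lborel. f (x, t)) = Gamma w * (indicat_real {0<..} x *\<^sub>R (of_real x powr (- w) * h x))"
      unfolding f1 using G_val[OF w, of x] by (cases "x > 0") (simp_all del: mult_scaleR_right add: mult_ac)
  qed
  also have "\<dots> = Gamma w * (LBINT x:{0<..}. of_real x powr (- w) * h x)"
    unfolding set_lebesgue_integral_def by (rule integral_mult_right_zero)
  also have "(LBINT x:{0<..}. of_real x powr (- w) * h x) = integral {0<..} (\<lambda>x. of_real x powr (- w) * h x)"
    by (intro LBINT_eq_integral contx int) auto
  finally show "integral {0<..} (\<lambda>t. of_real t powr (w - 1) * H t) = Gamma w * integral {0<..} (\<lambda>x. of_real x powr (- w) * h x)" .
qed

section \<open>The integral representation\<close>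

lemma Gamma_integral_scaled_real:
  assumes p: "p > 0" and x: "x > (0::real)"
  shows "((\<lambda>t. exp (- x * t) * t powr (p - 1)) has_integral Gamma p * x powr (- p)) {0<..}"
proof -
  have "((\<lambda>t. of_real (exp (- x * t)) * of_real t powr (of_real p - 1) :: complex) has_integral
      Gamma (of_real p) * of_real x powr (- of_real p)) {0<..}"
    using set_lebesgue_integral_eq_integral(1)[OF Gamma_integral_scaled(1)[of "of_real p" x]]
      Gamma_integral_scaled(2)[of "of_real p" x] p x by (simp add: has_integral_iff)
  also have "Gamma (of_real p) * of_real x powr (- of_real p) = (of_real (Gamma p * x powr (- p)) :: complex)"
    using x p powr_of_real[of x "-p"] by (simp add: Gamma_complex_of_real)
  finally have "((\<lambda>t. Re (of_real (exp (- x * t)) * of_real t powr (of_real p - 1))) has_integral Gamma p * x powr (- p)) {0<..}"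
    by (drule_tac has_integral_Re) simp
  moreover have "Re (of_real (exp (- x * t)) * of_real t powr (of_real p - 1)) = exp (- x * t) * t powr (p - 1)" if "t > 0" for t
    using powr_of_real[of t "p - 1"] that by simp
  ultimately show ?thesis by (subst has_integral_cong[of _ _ "\<lambda>t. Re (of_real (exp (- x * t)) * of_real t powr (of_real p - 1))"]) auto
qed

text \<open>The Laplace transform of \<open>kernel a (c - a - 1)\<close> is \<open>Gamma a * U(a; c; z)\<close>.\<close>
definition kernel :: "complex \<Rightarrow> complex \<Rightarrow> real \<Rightarrow> complex" where
  "kernel a c t = of_real t powr (a - 1) * of_real (1 + t) powr c"

lemma continuous_on_kernel [continuous_intros]: "continuous_on {0<..} (kernel a c)"
  unfolding kernel_def by (intro continuous_intros) auto

lemma norm_kernel: "t > 0 \<Longrightarrow> norm (kernel a c t) = t powr (Re a - 1) * (1 + t) powr Re c"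
  using norm_of_real_powr[of t "a - 1"] norm_of_real_powr[of "1 + t" c] by (simp add: kernel_def norm_mult)

lemma kernel_Suc: "t > 0 \<Longrightarrow> kernel a (c + 1) t = (1 + of_real t) * kernel a c t"
proof -
  assume "t > 0"
  hence "1 + complex_of_real t \<noteq> 0" by (metis add_pos_pos less_numeral_extra(1,3) of_real_1 of_real_add of_real_eq_0_iff)
  thus ?thesis by (simp add: kernel_def powr_add)
qed

lemma powr_le_1_of_nonpos: "t > 0 \<Longrightarrow> c \<le> 0 \<Longrightarrow> (1 + t) powr c \<le> (1::real)"
  using powr_mono[of c 0 "1 + t"] by simp

lemma laplace_kernel_integrable:
  assumes "Re a > 0" "Re c \<le> 0" "z > 0"
  shows "(\<lambda>t. of_real (exp (- z * t)) * kernel a c t) absolutely_integrable_on {0<..}"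
proof (rule continuous_bounded_imp_absolutely_integrable)
  show "(\<lambda>t. exp (- z * t) * t powr (Re a - 1)) integrable_on {0<..}"
    using Gamma_integral_scaled_real[of "Re a" z] assms by blast
  fix t :: real assume t: "t \<in> {0<..}"
  have "norm (of_real (exp (- z * t)) * kernel a c t) = exp (- z * t) * t powr (Re a - 1) * (1 + t) powr Re c"
    using t by (simp add: norm_mult norm_kernel)
  also have "\<dots> \<le> exp (- z * t) * t powr (Re a - 1) * 1"
    using t assms by (intro mult_left_mono powr_le_1_of_nonpos) auto
  finally show "norm (of_real (exp (- z * t)) * kernel a c t) \<le> exp (- z * t) * t powr (Re a - 1)" by simp
qed (auto intro!: continuous_intros)

definition laplace_kernel :: "complex \<Rightarrow> complex \<Rightarrow> real \<Rightarrow> complex" where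
  "laplace_kernel a c z = integral {0<..} (\<lambda>t. of_real (exp (- z * t)) * kernel a c t)"

lemma laplace_kernel_deriv:
  assumes "Re a > 0" "Re c \<le> -1" "z > 0"
  shows "(laplace_kernel a c has_vector_derivative laplace_kernel a c z - laplace_kernel a (c + 1) z) (at z)"
proof -
  have "(laplace_kernel a c has_vector_derivative - integral {0<..} (\<lambda>t. of_real (exp (- z * t)) * (of_real t * kernel a c t))) (at z)"
    unfolding laplace_kernel_def
    by (rule laplace_has_vector_derivative[OF continuous_on_kernel laplace_kernel_integrable]) (use assms in auto)
  also have "integral {0<..} (\<lambda>t. of_real (exp (- z * t)) * (of_real t * kernel a c t)) =
     integral {0<..} (\<lambda>t. of_real (exp (- z * t)) * kernel a (c + 1) t - of_real (exp (- z * t)) * kernel a c t)"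
    by (intro integral_cong, simp only: kernel_Suc greaterThan_iff) (simp add: algebra_simps)
  also have "\<dots> = laplace_kernel a (c + 1) z - laplace_kernel a c z"
    unfolding laplace_kernel_def using assms
    by (intro integral_diff set_lebesgue_integral_eq_integral(1) laplace_kernel_integrable) auto
  finally show ?thesis by simp
qed

text \<open>The second first-order equation: \<open>exp (- z * t) * t powr a * (1 + t) powr (1 - a)\<close> vanishes at
  both ends of the half-line, so its derivative integrates to \<open>0\<close>.\<close>
lemma laplace_kernel_deriv':
  assumes a: "Re a > 1" and z: "z > 0"
  shows "(laplace_kernel a (1 - a) has_vector_derivative
     ((1 - a) * laplace_kernel a (- a) z - laplace_kernel a (1 - a) z) / of_real z) (at z)"
proof -
  define f where "f = (\<lambda>t. - of_real z * (of_real (exp (- z * t)) * (of_real t * kernel a (1 - a) t)) +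
     of_real (exp (- z * t)) * kernel a (1 - a) t - (1 - a) * (of_real (exp (- z * t)) * kernel a (- a) t))"
  define T where "T = integral {0<..} (\<lambda>t. of_real (exp (- z * t)) * (of_real t * kernel a (1 - a) t))"
  have i1: "(\<lambda>t. of_real (exp (- z * t)) * kernel a (1 - a) t) absolutely_integrable_on {0<..}"
    and i2: "(\<lambda>t. of_real (exp (- z * t)) * kernel a (- a) t) absolutely_integrable_on {0<..}"
    by (rule laplace_kernel_integrable; use assms in simp)+
  have i3: "(\<lambda>t. of_real (exp (- z * t)) * (of_real t * kernel a (1 - a) t)) absolutely_integrable_on {0<..}"
    using assms by (intro laplace_moment_integrable continuous_intros laplace_kernel_integrable) auto
  have f_int: "f absolutely_integrable_on {0<..}"
    unfolding f_def by (intro set_integral_add set_integral_diff set_integrable_mult_right i1 i2 i3)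
  have f_val: "integral {0<..} f = - of_real z * T + laplace_kernel a (1 - a) z - (1 - a) * laplace_kernel a (- a) z"
    unfolding f_def T_def laplace_kernel_def using i1 i2 i3
    by (simp add: integral_add integral_diff integrable_diff integrable_add set_lebesgue_integral_eq_integral(1)
        integrable_on_mult_right integrable_neg)
  define F where "F = (\<lambda>t. of_real (exp (- z * t)) * (of_real t powr a * of_real (1 + t) powr (1 - a)) :: complex)"
  have F': "(F has_vector_derivative f t) (at t)" if t: "t \<in> {0<..}" for t
  proof -
    have nz: "1 + complex_of_real t \<noteq> 0" "complex_of_real t \<noteq> 0"
      using t by (auto simp: complex_eq_iff)
    have np: "1 + complex_of_real t \<notin> \<real>\<^sub>\<le>\<^sub>0" "complex_of_real t \<notin> \<real>\<^sub>\<le>\<^sub>0"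
      using t by (auto simp: complex_nonpos_Reals_iff)
    define E where "E = exp (- complex_of_real z * of_real t)"
    define X where "X = complex_of_real t powr (a - 1)"
    define Y where "Y = (1 + complex_of_real t) powr (- a)"
    have XY: "of_real t powr a = of_real t * X" "(1 + of_real t) powr (1 - a) = (1 + of_real t) * Y"
      using nz by (simp_all add: X_def Y_def powr_diff powr_minus field_simps)
    have d1: "((\<lambda>w. exp (- of_real z * w)) has_field_derivative - of_real z * E) (at (of_real t))"
      unfolding E_def by (auto intro!: derivative_eq_intros)
    have d2: "((\<lambda>w. w powr a) has_field_derivative a * X) (at (of_real t))"
      unfolding X_def using np by (intro has_field_derivative_powr)
    have d3: "((\<lambda>w. (1 + w) powr (1 - a)) has_field_derivative (1 - a) * Y) (at (of_real t))"
      unfolding Y_def using np by (auto intro!: derivative_eq_intros)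
    from has_vector_derivative_real_field[OF DERIV_mult[OF d1 DERIV_mult[OF d2 d3]]]
    have "(F has_vector_derivative - of_real z * E * (of_real t powr a * (1 + of_real t) powr (1 - a)) +
       ((a * X) * (1 + of_real t) powr (1 - a) + (1 - a) * Y * of_real t powr a) * exp (- of_real z * of_real t)) (at t)"
      unfolding F_def by (simp flip: exp_of_real)
    also have "- of_real z * E * (of_real t powr a * (1 + of_real t) powr (1 - a)) +
       ((a * X) * (1 + of_real t) powr (1 - a) + (1 - a) * Y * of_real t powr a) * exp (- of_real z * of_real t) = f t"
    proof -
      have E: "of_real (exp (- z * t)) = E" unfolding E_def exp_of_real[symmetric] by simp
      show ?thesis
        unfolding f_def kernel_def E E_def[symmetric] X_def[symmetric] of_real_add of_real_1 XY Y_def[symmetric]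
        by (simp add: algebra_simps)
    qed
    finally show ?thesis .
  qed
  have normF: "norm (F t) \<le> exp (- z * t) * t powr Re a" if "t > 0" for t
  proof -
    have "norm (F t) = exp (- z * t) * t powr Re a * (1 + t) powr Re (1 - a)"
      using that norm_of_real_powr[of t a] norm_of_real_powr[of "1 + t" "1 - a"]
      by (simp add: F_def norm_mult)
    also have "\<dots> \<le> exp (- z * t) * t powr Re a * 1"
      using that a by (intro mult_left_mono powr_le_1_of_nonpos) auto
    finally show ?thesis by simp
  qed
  have F0: "(F \<longlongrightarrow> 0) (at_right 0)"
  proof (rule Lim_null_comparison)
    show "\<forall>\<^sub>F t in at_right 0. norm (F t) \<le> exp (- z * t) * t powr Re a"
      by (intro eventually_mono[OF eventually_at_right_less] normF)
    have "Re a > 0" using a by simp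
    thus "((\<lambda>t. exp (- z * t) * t powr Re a) \<longlongrightarrow> 0) (at_right 0)"
      by real_asymp
  qed
  have F1: "(F \<longlongrightarrow> 0) at_top"
  proof (rule Lim_null_comparison)
    show "\<forall>\<^sub>F t in at_top. norm (F t) \<le> exp (- z * t) * t powr Re a"
      using eventually_gt_at_top[of 0] by eventually_elim (rule normF)
    show "((\<lambda>t. exp (- z * t) * t powr Re a) \<longlongrightarrow> 0) at_top"
      using z by real_asymp
  qed
  have cont_f: "continuous_on {0<..} f" unfolding f_def by (intro continuous_intros)
  have "(LINT t:{0<..}|lebesgue. f t) = 0 - 0"
    by (rule FTC_Ioi_0[OF F' cont_f f_int F0 F1])
  hence "integral {0<..} f = 0" using set_lebesgue_integral_eq_integral(2)[OF f_int] by simp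
  hence T: "- T = ((1 - a) * laplace_kernel a (- a) z - laplace_kernel a (1 - a) z) / of_real z"
    using z unfolding f_val by (simp add: field_simps)
  have "(laplace_kernel a (1 - a) has_vector_derivative - T) (at z)"
    unfolding laplace_kernel_def T_def
    by (rule laplace_has_vector_derivative[OF continuous_on_kernel laplace_kernel_integrable]) (use assms in auto)
  thus ?thesis unfolding T .
qed

text \<open>The derivative \<open>c * (1 + x) powr (c - 1)\<close> has norm at most \<open>norm c\<close> for \<open>x > 0\<close>.\<close>
lemma norm_one_plus_powr_minus_one:
  assumes "Re c \<le> 1" "t > 0"
  shows "norm (of_real (1 + t) powr c - 1 :: complex) \<le> norm c * t"
proof -
  have "norm (of_real (1 + t) powr c - of_real (1 + 0) powr c :: complex) \<le> norm c * t - norm c * 0"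
  proof (rule differentiable_bound_general[OF \<open>t > 0\<close>, where f' = "\<lambda>x. c * of_real (1 + x) powr (c - 1)" and \<phi>' = "\<lambda>_. norm c"])
    show "((\<lambda>x. of_real (1 + x) powr c) has_vector_derivative c * of_real (1 + x) powr (c - 1)) (at x)" if "0 < x" for x
    proof -
      have "1 + complex_of_real x \<notin> \<real>\<^sub>\<le>\<^sub>0" using that by (auto simp: complex_nonpos_Reals_iff)
      hence "((\<lambda>w. (1 + w) powr c) has_field_derivative c * (1 + of_real x) powr (c - 1)) (at (of_real x))"
        by (auto intro!: derivative_eq_intros)
      from has_vector_derivative_real_field[OF this] show ?thesis by simp
    qed
    show "norm (c * of_real (1 + x) powr (c - 1)) \<le> norm c" if "0 < x" for x
      using that assms norm_of_real_powr[of "1 + x" "c - 1"] powr_le_1_of_nonpos[of x "Re c - 1"]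
      by (simp add: norm_mult mult_left_le)
    show "((\<lambda>x. norm c * x) has_vector_derivative norm c) (at x)" for x
      unfolding has_real_derivative_iff_has_vector_derivative[symmetric] by (auto intro!: derivative_eq_intros)
  qed (intro continuous_intros; auto)+
  thus ?thesis by simp
qed

text \<open>With \<open>1\<close> in place of \<open>(1 + t) powr c\<close> the integral is exactly \<open>Gamma a * z powr (- a)\<close>, and the error
  \<open>O(t)\<close> of this replacement gains a factor \<open>1 / z\<close>.\<close>
lemma laplace_kernel_asymp:
  assumes a: "Re a > 0" and c: "Re c \<le> 0"
  shows "((\<lambda>z. of_real z powr a * laplace_kernel a c z) \<longlongrightarrow> Gamma a) at_top"
proof -
  have bound: "norm (of_real z powr a * laplace_kernel a c z - Gamma a) \<le> norm c * Gamma (Re a + 1) / z" if z: "z > 0" for z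
  proof -
    have i1: "(\<lambda>t. of_real (exp (- z * t)) * kernel a c t) integrable_on {0<..}"
      by (rule set_lebesgue_integral_eq_integral(1)[OF laplace_kernel_integrable[OF a c z]])
    have i2: "(\<lambda>t. of_real (exp (- z * t)) * of_real t powr (a - 1) :: complex) integrable_on {0<..}"
      by (rule set_lebesgue_integral_eq_integral(1)[OF Gamma_integral_scaled(1)[OF a z]])
    have G: "((\<lambda>t. norm c * (exp (- z * t) * t powr (Re a + 1 - 1))) has_integral norm c * (Gamma (Re a + 1) * z powr (- (Re a + 1)))) {0<..}"
      by (intro has_integral_mult_right Gamma_integral_scaled_real) (use a z in auto)
    define g where "g = (\<lambda>t. of_real (exp (- z * t)) * kernel a c t - of_real (exp (- z * t)) * of_real t powr (a - 1))"
    have eq: "laplace_kernel a c z - Gamma a * of_real z powr (- a) = integral {0<..} g"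
      unfolding laplace_kernel_def Gamma_integral_scaled(2)[OF a z, symmetric] g_def by (rule integral_diff[OF i1 i2, symmetric])
    have "norm (laplace_kernel a c z - Gamma a * of_real z powr (- a)) = norm (integral {0<..} g)"
      by (simp only: eq)
    also have "\<dots> \<le> integral {0<..} (\<lambda>t. norm c * (exp (- z * t) * t powr (Re a + 1 - 1)))"
      unfolding g_def
    proof (rule integral_norm_bound_integral[OF integrable_diff[OF i1 i2]])
      show "(\<lambda>t. norm c * (exp (- z * t) * t powr (Re a + 1 - 1))) integrable_on {0<..}" using G by blast
      fix t :: real assume t: "t \<in> {0<..}"
      have "norm (of_real (exp (- z * t)) * kernel a c t - of_real (exp (- z * t)) * of_real t powr (a - 1))
         = exp (- z * t) * t powr (Re a - 1) * norm (of_real (1 + t) powr c - 1 :: complex)"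
      proof -
        have "of_real (exp (- z * t)) * kernel a c t - of_real (exp (- z * t)) * of_real t powr (a - 1) =
          of_real (exp (- z * t)) * of_real t powr (a - 1) * (of_real (1 + t) powr c - 1)"
          by (simp add: kernel_def algebra_simps)
        thus ?thesis using t norm_of_real_powr[of t "a - 1"] by (simp add: norm_mult)
      qed
      also have "\<dots> \<le> exp (- z * t) * t powr (Re a - 1) * (norm c * t)"
        using t c by (intro mult_left_mono norm_one_plus_powr_minus_one) auto
      also have "\<dots> = norm c * (exp (- z * t) * t powr (Re a + 1 - 1))"
        using t by (simp add: powr_diff)
      finally show "norm (of_real (exp (- z * t)) * kernel a c t - of_real (exp (- z * t)) * of_real t powr (a - 1))
        \<le> norm c * (exp (- z * t) * t powr (Re a + 1 - 1))" .
    qed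
    also have "\<dots> = norm c * (Gamma (Re a + 1) * z powr (- (Re a + 1)))" using G by (rule integral_unique)
    finally have "z powr Re a * norm (laplace_kernel a c z - Gamma a * of_real z powr (- a)) \<le> z powr Re a * (norm c * (Gamma (Re a + 1) * z powr (- (Re a + 1))))"
      by (intro mult_left_mono) auto
    also have "\<dots> = norm c * Gamma (Re a + 1) * (z powr Re a * z powr (- (Re a + 1)))" by simp
    also have "z powr Re a * z powr (- (Re a + 1)) = z powr (-1)" by (simp flip: powr_add)
    also have "\<dots> = 1 / z" using z by (simp add: powr_minus divide_inverse)
    finally have "norm (of_real z powr a * (laplace_kernel a c z - Gamma a * of_real z powr (- a))) \<le> norm c * Gamma (Re a + 1) / z"
      using norm_of_real_powr[OF z, of a] by (simp add: norm_mult)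
    also have "of_real z powr a * (laplace_kernel a c z - Gamma a * of_real z powr (- a)) = of_real z powr a * laplace_kernel a c z - Gamma a"
      using z by (simp add: powr_minus field_simps)
    finally show ?thesis .
  qed
  show ?thesis
  proof (rule Lim_null[THEN iffD2], rule Lim_null_comparison)
    show "\<forall>\<^sub>F z in at_top. norm (of_real z powr a * laplace_kernel a c z - Gamma a) \<le> norm c * Gamma (Re a + 1) / z"
      using eventually_gt_at_top[of 0] by eventually_elim (rule bound)
    show "((\<lambda>z. norm c * Gamma (Re a + 1) / z) \<longlongrightarrow> 0) at_top" by real_asymp
  qed
qed

text \<open>The exponent \<open>-3/4\<close> makes the transform \<open>O(z powr (-1/4))\<close>, so that products of two of
  them are integrable at \<open>0\<close>.\<close>
lemma norm_kernel_bound: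
  assumes "Re a > 1/4" "t > 0"
  shows "norm (kernel a (- a) t) \<le> t powr (-3/4)"
proof -
  have "norm (kernel a (- a) t) = t powr (-3/4) * (t powr (Re a - 1/4) * (1 + t) powr (- Re a))"
    using assms by (simp add: norm_kernel powr_add[symmetric])
  also have "\<dots> \<le> t powr (-3/4) * ((1 + t) powr (Re a - 1/4) * (1 + t) powr (- Re a))"
    using assms by (intro mult_left_mono mult_right_mono powr_mono2) auto
  also have "(1 + t) powr (Re a - 1/4) * (1 + t) powr (- Re a) = (1 + t) powr (-1/4)"
    by (simp flip: powr_add)
  also have "t powr (-3/4) * (1 + t) powr (-1/4) \<le> t powr (-3/4) * 1"
    using assms by (intro mult_left_mono powr_le_1_of_nonpos) auto
  finally show ?thesis by simp
qed

lemma norm_laplace_kernel_bound: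
  assumes "Re a > 1/4" "z > 0"
  shows "norm (laplace_kernel a (- a) z) \<le> Gamma (1/4) * z powr (-1/4)"
proof -
  have G: "((\<lambda>t. exp (- z * t) * t powr (1/4 - 1)) has_integral Gamma (1/4) * z powr (- (1/4))) {0<..}"
    using assms by (intro Gamma_integral_scaled_real) auto
  have "norm (laplace_kernel a (- a) z) \<le> integral {0<..} (\<lambda>t. exp (- z * t) * t powr (1/4 - 1))"
    unfolding laplace_kernel_def
  proof (rule integral_norm_bound_integral)
    show "(\<lambda>t. of_real (exp (- z * t)) * kernel a (- a) t) integrable_on {0<..}"
      using assms by (intro set_lebesgue_integral_eq_integral(1) laplace_kernel_integrable) auto
    show "(\<lambda>t. exp (- z * t) * t powr (1/4 - 1)) integrable_on {0<..}" using G by blast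
    show "norm (of_real (exp (- z * t)) * kernel a (- a) t) \<le> exp (- z * t) * t powr (1/4 - 1)" if "t \<in> {0<..}" for t
      using norm_kernel_bound[OF assms(1), of t] that by (simp add: norm_mult mult_left_mono)
  qed
  thus ?thesis using G by (simp add: integral_unique)
qed

lemma kernel_mellin_integrable:
  assumes "Re a > 2" "0 < s" "s < 1"
  shows "(\<lambda>t. of_real t powr (- of_real s) * kernel a (- a) t) absolutely_integrable_on {0<..}"
proof -
  have n: "norm (of_real t powr (- of_real s) * kernel a (- a) t) = t powr (Re a - 1 - s) * (1 + t) powr (- Re a)" if "t > 0" for t
    unfolding norm_mult norm_kernel[OF that] norm_of_real_powr[OF that]
    by (simp add: mult.assoc[symmetric] powr_add[symmetric])
  have "(\<lambda>t. of_real t powr (- of_real s) * kernel a (- a) t) absolutely_integrable_on {0<..<1}"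
  proof (rule continuous_bounded_imp_absolutely_integrable[where g = "\<lambda>_. 1"])
    fix t :: real assume t: "t \<in> {0<..<1}"
    have "t powr (Re a - 1 - s) * (1 + t) powr (- Re a) \<le> 1 * 1"
      using t assms by (intro mult_mono powr_le_1_of_nonpos powr_le1) auto
    thus "norm (of_real t powr (- of_real s) * kernel a (- a) t) \<le> 1" using n[of t] t by simp
  qed (auto intro!: continuous_intros continuous_on_subset[OF continuous_on_kernel] simp: integrable_on_Icc_iff_Ioo[symmetric])
  moreover have "(\<lambda>t. of_real t powr (- of_real s) * kernel a (- a) t) absolutely_integrable_on {1..}"
  proof (rule continuous_bounded_imp_absolutely_integrable[where g = "\<lambda>t. t powr (- 1 - s)"])
    fix t :: real assume t: "t \<in> {1..}"
    have "t powr (Re a - 1 - s) * (1 + t) powr (- Re a) \<le> t powr (Re a - 1 - s) * t powr (- Re a)"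
      using t assms by (intro mult_left_mono powr_mono2') auto
    also have "\<dots> = t powr (- 1 - s)" by (simp flip: powr_add)
    finally show "norm (of_real t powr (- of_real s) * kernel a (- a) t) \<le> t powr (- 1 - s)" using n[of t] t by simp
  next
    show "(\<lambda>t. t powr (- 1 - s)) integrable_on {1..}"
      using has_integral_powr_to_inf[of "- 1 - s" 1] assms by auto
  qed (auto intro!: continuous_intros continuous_on_subset[OF continuous_on_kernel])
  ultimately have "(\<lambda>t. of_real t powr (- of_real s) * kernel a (- a) t) absolutely_integrable_on ({0<..<1} \<union> {1..})"
    by (rule set_integrable_Un) auto
  moreover have "{0<..<1::real} \<union> {1..} = {0<..}" by auto
  ultimately show ?thesis by (simp only:)
qed

text \<open>A Beta integral: \<open>Gamma a * (1 + t) powr (- a)\<close> is itself the Laplace transform of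
  \<open>x powr (a - 1) * exp (- x)\<close>, so \<open>mellin_laplace\<close> evaluates it.\<close>
lemma mellin_kernel:
  assumes a: "Re a > 2" and s: "0 < s" "s < 1"
  shows "Gamma a * integral {0<..} (\<lambda>t. of_real t powr (- of_real s) * kernel a (- a) t) = Gamma (a - of_real s) * Gamma (of_real s)"
proof -
  define h where "h = (\<lambda>x. of_real x powr (a - 1) * of_real (exp (- x)) :: complex)"
  have H: "integral {0<..} (\<lambda>x. of_real (exp (- t * x)) * h x) = Gamma a * of_real (1 + t) powr (- a)"
    and Hint: "(\<lambda>x. of_real (exp (- t * x)) * h x) absolutely_integrable_on {0<..}" if "t > 0" for t
  proof -
    have "of_real (exp (- t * x)) * h x = of_real (exp (- (1 + t) * x)) * of_real x powr (a - 1)" for x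
      by (simp add: h_def algebra_simps flip: exp_add of_real_mult)
    thus "integral {0<..} (\<lambda>x. of_real (exp (- t * x)) * h x) = Gamma a * of_real (1 + t) powr (- a)"
      "(\<lambda>x. of_real (exp (- t * x)) * h x) absolutely_integrable_on {0<..}"
      using Gamma_integral_scaled[of a "1 + t"] that a by simp_all
  qed
  have eq: "of_real x powr (- (a - of_real s)) * h x = of_real (exp (- 1 * x)) * of_real x powr (of_real s - 1)" if "x > 0" for x
    using that by (simp add: h_def powr_diff powr_minus field_simps)
  have hint: "(\<lambda>x. of_real x powr (- (a - of_real s)) * h x) absolutely_integrable_on {0<..}"
    by (rule absolutely_integrable_eq_on[OF _ Gamma_integral_scaled(1)[of "of_real s" 1]]) (use eq s in auto)
  have "integral {0<..} (\<lambda>x. of_real x powr (- (a - of_real s)) * h x) = integral {0<..} (\<lambda>x. of_real (exp (- 1 * x)) * of_real x powr (of_real s - 1))"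
    by (intro integral_cong eq) auto
  also have "\<dots> = Gamma (of_real s)" using Gamma_integral_scaled(2)[of "of_real s" 1] s by simp
  finally have I: "integral {0<..} (\<lambda>x. of_real x powr (- (a - of_real s)) * h x) = Gamma (of_real s)" .
  have "Gamma a * integral {0<..} (\<lambda>t. of_real t powr (- of_real s) * kernel a (- a) t) = 
        integral {0<..} (\<lambda>t. Gamma a * (of_real t powr (- of_real s) * kernel a (- a) t))"
    by simp
  also have "\<dots> = integral {0<..} (\<lambda>t. of_real t powr (a - of_real s - 1) * integral {0<..} (\<lambda>x. of_real (exp (- t * x)) * h x))"
  proof (intro integral_cong)
    fix t :: real assume t: "t \<in> {0<..}"
    have "of_real t powr (a - of_real s - 1) = (of_real t powr (- of_real s) * of_real t powr (a - 1) :: complex)"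
      by (simp add: algebra_simps flip: powr_add)
    thus "Gamma a * (of_real t powr (- of_real s) * kernel a (- a) t) =
        of_real t powr (a - of_real s - 1) * integral {0<..} (\<lambda>x. of_real (exp (- t * x)) * h x)"
      using t unfolding kernel_def by (simp only: H greaterThan_iff) (simp only: mult_ac)
  qed
  also have "\<dots> = Gamma (a - of_real s) * integral {0<..} (\<lambda>x. of_real x powr (- (a - of_real s)) * h x)"
    by (rule mellin_laplace(2)[OF _ _ hint Hint]) (use a s in \<open>auto simp: h_def intro!: continuous_intros\<close>)
  finally show ?thesis by (simp only: I)
qed

text \<open>\<open>U(a; 1; z)\<close> and \<open>U(a; 2; z)\<close>, for large \<open>Re a\<close>.\<close>
definition tri_u :: "complex \<Rightarrow> real \<Rightarrow> complex" where "tri_u a z = rGamma a * laplace_kernel a (- a) z"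
definition tri_v :: "complex \<Rightarrow> real \<Rightarrow> complex" where "tri_v a z = rGamma a * laplace_kernel a (1 - a) z"

lemma tri_u_deriv:
  "Re a > 1 \<Longrightarrow> z > 0 \<Longrightarrow> (tri_u a has_vector_derivative tri_u a z - tri_v a z) (at z)"
  unfolding tri_u_def tri_v_def right_diff_distrib[symmetric]
  using laplace_kernel_deriv[of a "- a" z] by (intro has_vector_derivative_mult_right) simp

lemma tri_v_deriv:
  assumes "Re a > 1" "z > 0"
  shows "(tri_v a has_vector_derivative ((1 - a) * tri_u a z - tri_v a z) / of_real z) (at z)"
proof -
  have "(tri_v a has_vector_derivative rGamma a * (((1 - a) * laplace_kernel a (- a) z - laplace_kernel a (1 - a) z) / of_real z)) (at z)"
    unfolding tri_v_def by (intro has_vector_derivative_mult_right laplace_kernel_deriv' assms)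
  thus ?thesis by (simp add: tri_u_def tri_v_def algebra_simps)
qed

lemma tri_u_continuous: "Re a > 1 \<Longrightarrow> continuous_on {0<..} (tri_u a)"
  by (intro continuous_at_imp_continuous_on ballI has_vector_derivative_continuous[OF tri_u_deriv]) auto

lemma tri_u_bound:
  assumes "Re a > 1/4" "z > 0"
  shows "norm (tri_u a z) \<le> norm (rGamma a) * Gamma (1/4) * z powr (-1/4)"
  using norm_laplace_kernel_bound[OF assms] by (simp add: tri_u_def norm_mult mult_left_mono mult.assoc)

lemma tri_u_mellin:
  assumes a: "Re a > 2" and s: "0 < s" "s < 1"
  shows "(\<lambda>z. of_real z powr (of_real s - 1) * tri_u a z) absolutely_integrable_on {0<..}"
    and "of_real s ^ 2 * integral {0<..} (\<lambda>z. of_real z powr (of_real s - 1) * tri_u a z) = 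
         rGamma a ^ 2 * Gamma (1 + of_real s) ^ 2 * Gamma (a - of_real s)"
proof -
  have L: "(\<lambda>z. of_real z powr (of_real s - 1) * laplace_kernel a (- a) z) absolutely_integrable_on {0<..}"
     "integral {0<..} (\<lambda>z. of_real z powr (of_real s - 1) * laplace_kernel a (- a) z) = 
       Gamma (of_real s) * integral {0<..} (\<lambda>t. of_real t powr (- of_real s) * kernel a (- a) t)"
    unfolding laplace_kernel_def
    by (rule mellin_laplace[OF _ continuous_on_kernel kernel_mellin_integrable laplace_kernel_integrable]; use a s in simp)+
  show "(\<lambda>z. of_real z powr (of_real s - 1) * tri_u a z) absolutely_integrable_on {0<..}"
    using set_integrable_mult_right[of "rGamma a", OF L(1)] by (simp add: tri_u_def mult_ac)
  have Ga: "rGamma a * Gamma a = 1"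
  proof -
    have "a \<notin> \<int>\<^sub>\<le>\<^sub>0" using a by (auto elim!: nonpos_Ints_cases)
    thus ?thesis by (simp add: rGamma_inverse_Gamma Gamma_eq_zero_iff)
  qed
  have Gs: "of_real s * Gamma (of_real s) = (Gamma (1 + of_real s) :: complex)"
  proof -
    have "complex_of_real s \<notin> \<int>\<^sub>\<le>\<^sub>0" using s by (auto elim!: nonpos_Ints_cases simp: complex_eq_iff)
    thus ?thesis using Gamma_plus1[of "complex_of_real s"] by (simp add: add.commute)
  qed
  have "integral {0<..} (\<lambda>z. of_real z powr (of_real s - 1) * tri_u a z) = integral {0<..} (\<lambda>z. rGamma a * (of_real z powr (of_real s - 1) * laplace_kernel a (- a) z))"
    by (simp add: tri_u_def mult_ac)
  also have "\<dots> = rGamma a * (Gamma (of_real s) * integral {0<..} (\<lambda>t. of_real t powr (- of_real s) * kernel a (- a) t))"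
    unfolding L(2)[symmetric] by simp
  finally have I: "integral {0<..} (\<lambda>z. of_real z powr (of_real s - 1) * tri_u a z) = 
       rGamma a * (Gamma (of_real s) * integral {0<..} (\<lambda>t. of_real t powr (- of_real s) * kernel a (- a) t))" .
  define X where "X = integral {0<..} (\<lambda>t. of_real t powr (- of_real s) * kernel a (- a) t)"
  have X: "Gamma a * X = Gamma (a - of_real s) * Gamma (of_real s)"
    unfolding X_def by (rule mellin_kernel[OF a s])
  have "X = rGamma a * (Gamma a * X)" using Ga by (simp add: mult.assoc[symmetric])
  hence "X = rGamma a * (Gamma (a - of_real s) * Gamma (of_real s))" by (simp only: X)
  thus "of_real s ^ 2 * integral {0<..} (\<lambda>z. of_real z powr (of_real s - 1) * tri_u a z) = 
         rGamma a ^ 2 * Gamma (1 + of_real s) ^ 2 * Gamma (a - of_real s)"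
    unfolding I X_def[symmetric] Gs[symmetric] by (simp add: power2_eq_square mult_ac)
qed

lemma powr_ln_integral:
  assumes s: "0 < (s::real)"
  shows "(\<lambda>z. of_real z powr (of_real s - 1) * of_real (ln z) :: complex) absolutely_integrable_on {0<..<1}"
    and "integral {0<..<1} (\<lambda>z. of_real z powr (of_real s - 1) * of_real (ln z) :: complex) = - 1 / of_real s ^ 2"
proof -
  show int: "(\<lambda>z. of_real z powr (of_real s - 1) * of_real (ln z) :: complex) absolutely_integrable_on {0<..<1}"
  proof (rule continuous_bounded_imp_absolutely_integrable[where g = "\<lambda>z. 2 / s * z powr (s / 2 - 1)"])
    show "(\<lambda>z. 2 / s * z powr (s / 2 - 1)) integrable_on {0<..<1}"
      using integrable_on_powr_from_0[of "s / 2 - 1" 1] s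
      by (intro integrable_on_mult_right) (simp add: integrable_on_Icc_iff_Ioo)
    fix z :: real assume z: "z \<in> {0<..<1}"
    have "- ln z \<le> 2 / s * z powr (- (s / 2))"
    proof -
      have "s / 2 * - ln z = ln (z powr (- (s / 2)))" using z by (simp add: ln_powr)
      also have "\<dots> \<le> z powr (- (s / 2))" using z ln_le_minus_one[of "z powr (- (s / 2))"] by simp
      finally show ?thesis using s by (simp add: field_simps)
    qed
    hence "z powr (s - 1) * - ln z \<le> z powr (s - 1) * (2 / s * z powr (- (s / 2)))"
      by (intro mult_left_mono) auto
    also have "\<dots> = 2 / s * (z powr (s - 1) * z powr (- (s / 2)))" by simp
    also have "z powr (s - 1) * z powr (- (s / 2)) = z powr (s / 2 - 1)" by (simp flip: powr_add)
    finally show "norm (of_real z powr (of_real s - 1) * of_real (ln z) :: complex) \<le> 2 / s * z powr (s / 2 - 1)"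
      using z norm_of_real_powr[of z "of_real s - 1"] by (simp add: norm_mult)
  qed (auto intro!: continuous_intros)
  define F where "F = (\<lambda>z. z powr s * ln z / s - z powr s / s\<^sup>2)"
  have F': "((\<lambda>z. of_real (F z) :: complex) has_vector_derivative of_real z powr (of_real s - 1) * of_real (ln z)) (at z)" if "z \<in> {0<..<1}" for z
  proof -
    have "(F has_real_derivative z powr (s - 1) * ln z) (at z)"
      unfolding F_def using that s
      by (auto intro!: derivative_eq_intros simp: powr_diff power2_eq_square field_simps)
    hence "((\<lambda>z. of_real (F z) :: complex) has_vector_derivative of_real (z powr (s - 1) * ln z)) (at z)"
      by (rule has_vector_derivative_of_real)
    thus ?thesis using that powr_of_real[of z "s - 1"] by simp
  qed
  have 0: "((\<lambda>z. of_real (F z) :: complex) \<longlongrightarrow> of_real 0) (at_right 0)"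
    unfolding F_def using s by (intro tendsto_of_real) real_asymp
  have "(F \<longlongrightarrow> 0 - 1 / s\<^sup>2) (at_left 1)"
    unfolding F_def using s by (auto intro!: tendsto_eq_intros)
  hence 1: "((\<lambda>z. of_real (F z) :: complex) \<longlongrightarrow> of_real (0 - 1 / s\<^sup>2)) (at_left 1)"
    by (intro tendsto_of_real)
  have "(LINT z:{0<..<1}|lebesgue. of_real z powr (of_real s - 1) * of_real (ln z) :: complex) = of_real (0 - 1 / s\<^sup>2) - of_real 0"
    by (rule FTC_Ioo_0_1[OF F' _ int 0 1]) (auto intro!: continuous_intros)
  thus "integral {0<..<1} (\<lambda>z. of_real z powr (of_real s - 1) * of_real (ln z) :: complex) = - 1 / of_real s ^ 2"
    using set_lebesgue_integral_eq_integral(2)[OF int] by simp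
qed

text \<open>Since \<open>u = O(z powr (-1/4))\<close>, the equation \<open>(z * v)' = (1 - a) * u\<close> gives \<open>z * v = C + O(z powr (3/4))\<close>, and
  then \<open>u' = u - v\<close> gives the expansion of \<open>u\<close>.\<close>
lemma tri_u_expansion_exists:
  assumes a: "Re a > 2"
  obtains C M K where "\<And>z. z \<in> {0<..1} \<Longrightarrow> norm (tri_u a z + C * of_real (ln z) - M) \<le> K * z powr (3/4)"
    and "((\<lambda>z. of_real z * tri_v a z) \<longlongrightarrow> C) (at_right 0)"
proof -
  have a1: "Re a > 1" using a by simp
  define B where "B = norm (rGamma a) * Gamma (1/4)"
  have B: "norm (tri_u a z) \<le> B * z powr (-1/4)" if "z > 0" for z
    unfolding B_def using tri_u_bound[of a z] a that by simp
  have d: "((\<lambda>z. of_real z * tri_v a z) has_vector_derivative (1 - a) * tri_u a z) (at z)" if "z > 0" for z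
  proof -
    have i: "((\<lambda>z. of_real z :: complex) has_vector_derivative 1) (at z)"
      by (rule has_vector_derivative_real_field) (auto intro!: derivative_eq_intros)
    show ?thesis using has_vector_derivative_mult[OF i tri_v_deriv[OF a1 that]] that by simp
  qed
  have "norm ((1 - a) * tri_u a z) \<le> norm (1 - a) * B * z powr (3/4 - 1)" if "0 < z" for z
    using B[OF that] by (simp add: norm_mult mult_left_mono mult.assoc)
  hence "\<exists>C. \<forall>z\<in>{0<..1}. norm (of_real z * tri_v a z - C) \<le> norm (1 - a) * B / (3/4) * z powr (3/4)"
    by (intro primitive_bound_at_0) (auto intro!: d)
  then obtain C where C: "\<And>z. z \<in> {0<..1} \<Longrightarrow> norm (of_real z * tri_v a z - C) \<le> norm (1 - a) * B / (3/4) * z powr (3/4)" by blast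
  have d2: "((\<lambda>z. tri_u a z + C * of_real (ln z)) has_vector_derivative tri_u a z - tri_v a z + C * of_real (1 / z)) (at z)" if "z > 0" for z
    using that by (intro has_vector_derivative_add tri_u_deriv a1 has_vector_derivative_mult_right has_vector_derivative_of_real)
       (auto intro!: derivative_eq_intros simp: has_real_derivative_iff_has_vector_derivative[symmetric])
  have "norm (tri_u a z - tri_v a z + C * of_real (1 / z)) \<le> (B + norm (1 - a) * B / (3/4)) * z powr (3/4 - 1)" if "0 < z" "z \<le> 1" for z
  proof -
    have eq: "tri_u a z - tri_v a z + C * of_real (1 / z) = tri_u a z - (of_real z * tri_v a z - C) / of_real z"
      using that by (simp add: field_simps)
    have "norm ((of_real z * tri_v a z - C) / of_real z) \<le> norm (1 - a) * B / (3/4) * z powr (3/4) / z"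
      using divide_right_mono[OF C[of z], of z] that by (simp add: norm_divide)
    also have "\<dots> = norm (1 - a) * B / (3/4) * z powr (3/4 - 1)"
    proof -
      have "z powr (3/4) / z = z powr (3/4 - 1)" unfolding powr_diff using that by simp
      thus ?thesis by (simp only: times_divide_eq_right[symmetric])
    qed
    finally have "norm (tri_u a z - (of_real z * tri_v a z - C) / of_real z) \<le> B * z powr (3/4 - 1) + norm (1 - a) * B / (3/4) * z powr (3/4 - 1)"
      using B[OF that(1)] norm_triangle_ineq4[of "tri_u a z" "(of_real z * tri_v a z - C) / of_real z"] by simp
    thus ?thesis unfolding eq by (simp add: distrib_right)
  qed
  hence "\<exists>M. \<forall>z\<in>{0<..1}. norm (tri_u a z + C * of_real (ln z) - M) \<le> (B + norm (1 - a) * B / (3/4)) / (3/4) * z powr (3/4)"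
    by (intro primitive_bound_at_0) (auto intro!: d2[simplified])
  then obtain M where M: "\<And>z. z \<in> {0<..1} \<Longrightarrow> norm (tri_u a z + C * of_real (ln z) - M) \<le> (B + norm (1 - a) * B / (3/4)) / (3/4) * z powr (3/4)" by blast
  have "((\<lambda>z. of_real z * tri_v a z) \<longlongrightarrow> C) (at_right 0)"
  proof (rule Lim_null[THEN iffD2], rule Lim_null_comparison)
    show "\<forall>\<^sub>F z in at_right 0. norm (of_real z * tri_v a z - C) \<le> norm (1 - a) * B / (3/4) * z powr (3/4)"
      using C unfolding eventually_at_right_field by (intro exI[of _ 1]) auto
    show "((\<lambda>z. norm (1 - a) * B / (3/4) * z powr (3/4)) \<longlongrightarrow> 0) (at_right 0)"
      by real_asymp
  qed
  thus ?thesis using M that by blast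
qed

text \<open>The constants in \<open>u = - C * ln z + M + o(1)\<close> are the coefficients of the double pole of the Mellin
  transform at \<open>s = 0\<close>: \<open>s\<^sup>2\<close> times the transform is \<open>C + M * s + O(s\<^sup>2)\<close>.\<close>
lemma tri_u_constants:
  assumes a: "Re a > 2"
    and exp: "\<And>z. z \<in> {0<..1} \<Longrightarrow> norm (tri_u a z + C * of_real (ln z) - M) \<le> K * z powr (3/4)"
  shows "C = rGamma a" and "M = - rGamma a * (Digamma a + 2 * euler_mascheroni)"
proof -
  have a1: "Re a > 1" using a by simp
  have np: "a \<notin> \<int>\<^sub>\<le>\<^sub>0" using a by (auto elim!: nonpos_Ints_cases)
  define Q where "Q = (\<lambda>s. rGamma a ^ 2 * Gamma (1 + s) ^ 2 * Gamma (a - s))"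
  define I where "I = (\<lambda>s::real. integral {0<..} (\<lambda>z. of_real z powr (of_real s - 1) * tri_u a z))"
  define B where "B = norm (rGamma a) * Gamma (1/4)"
  have B: "norm (tri_u a z) \<le> B * z powr (-1/4)" if "z > 0" for z
    unfolding B_def using tri_u_bound[of a z] a that by simp
  have B0: "B \<ge> 0" using order_trans[OF norm_ge_zero B[of 1]] by simp
  have K0: "K \<ge> 0" using order_trans[OF norm_ge_zero exp[of 1]] by simp
  define B1 where "B1 = integral {0<..<1} (\<lambda>z. K * z powr (-1/2))"
  define B2 where "B2 = integral {1..} (\<lambda>z. B * z powr (-9/8))"
  have int2: "(\<lambda>z. B * z powr (-9/8)) integrable_on {1..}"
    using has_integral_powr_to_inf[of "-9/8" 1] by (intro integrable_on_mult_right) auto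
  \<comment> \<open>for \<open>s < 1/8\<close> the integrand on \<open>{1..}\<close> is at most \<open>B * z powr (1/8 - 1 - 1/4)\<close>, uniformly in \<open>s\<close>\<close>
  have main: "norm (I s - (C / of_real s ^ 2 + M / of_real s)) \<le> B1 + B2" if s: "0 < s" "s < 1/8" for s
  proof -
    define f where "f = (\<lambda>z. of_real z powr (of_real s - 1) * tri_u a z)"
    have f: "f absolutely_integrable_on {0<..}" unfolding f_def using tri_u_mellin(1)[OF a, of s] s by simp
    have f1: "f integrable_on {0<..<1}" and f2: "f integrable_on {1..}"
      by (rule set_lebesgue_integral_eq_integral(1)[OF set_integrable_subset[OF f]]; auto)+
    define g where "g = (\<lambda>z. of_real z powr (of_real s - 1) * (M - C * of_real (ln z)) :: complex)"
    have g1: "(\<lambda>z. of_real z powr (of_real s - 1) :: complex) integrable_on {0<..<1}"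
      "integral {0<..<1} (\<lambda>z. of_real z powr (of_real s - 1) :: complex) = 1 / of_real s"
      using powr_absolutely_integrable_Ioo[of "of_real s - 1"] s set_lebesgue_integral_eq_integral[of "{0<..<1::real}" "\<lambda>z. of_real z powr (of_real s - 1) :: complex"]
      by auto
    have g2: "(\<lambda>z. of_real z powr (of_real s - 1) * of_real (ln z) :: complex) integrable_on {0<..<1}"
      using powr_ln_integral(1)[of s] s set_lebesgue_integral_eq_integral(1) by blast
    have g_eq: "g = (\<lambda>z. M * of_real z powr (of_real s - 1) - C * (of_real z powr (of_real s - 1) * of_real (ln z)))"
      by (auto simp: g_def algebra_simps)
    have g: "g integrable_on {0<..<1}" 
      unfolding g_eq using g1 g2 by (intro integrable_diff integrable_on_mult_right)
    have g_val: "integral {0<..<1} g = C / of_real s ^ 2 + M / of_real s"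
      unfolding g_eq using g1 g2 s powr_ln_integral(2)[of s] by (simp add: integral_diff integrable_on_mult_right)
    have "{0<..} = {0<..<1::real} \<union> {1..}" "{0<..<1} \<inter> {1..} = ({}::real set)" by auto
    hence "I s = integral {0<..<1} f + integral {1..} f"
      using integral_Un[OF f1 f2] unfolding I_def f_def[symmetric] by simp
    also have "\<dots> - (C / of_real s ^ 2 + M / of_real s) = integral {0<..<1} (\<lambda>z. f z - g z) + integral {1..} f"
      unfolding g_val[symmetric] using f1 g by (simp add: integral_diff)
    finally have *: "I s - (C / of_real s ^ 2 + M / of_real s) = integral {0<..<1} (\<lambda>z. f z - g z) + integral {1..} f" .
    have 1: "norm (integral {0<..<1} (\<lambda>z. f z - g z)) \<le> B1"
      unfolding B1_def
    proof (rule integral_norm_bound_integral[OF integrable_diff[OF f1 g] powr_minus_half_integrable])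
      fix z :: real assume z: "z \<in> {0<..<1}"
      have "f z - g z = of_real z powr (of_real s - 1) * (tri_u a z + C * of_real (ln z) - M)"
        by (simp add: f_def g_def algebra_simps)
      hence "norm (f z - g z) \<le> z powr (s - 1) * (K * z powr (3/4))"
        using exp[of z] z norm_of_real_powr[of z "of_real s - 1"] by (simp add: norm_mult mult_left_mono)
      also have "\<dots> = K * (z powr (s - 1) * z powr (3/4))" by simp
      also have "z powr (s - 1) * z powr (3/4) = z powr (s - 1/4)" by (simp flip: powr_add)
      also have "K * z powr (s - 1/4) \<le> K * z powr (-1/2)"
        using z s K0 by (intro mult_left_mono powr_mono') auto
      finally show "norm (f z - g z) \<le> K * z powr (-1/2)" .
    qed
    have 2: "norm (integral {1..} f) \<le> B2"
      unfolding B2_def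
    proof (rule integral_norm_bound_integral[OF f2 int2])
      fix z :: real assume z: "z \<in> {1..}"
      have "norm (f z) \<le> z powr (s - 1) * (B * z powr (-1/4))"
        using B[of z] z norm_of_real_powr[of z "of_real s - 1"] by (simp add: f_def norm_mult mult_left_mono)
      also have "\<dots> = B * (z powr (s - 1) * z powr (-1/4))" by simp
      also have "z powr (s - 1) * z powr (-1/4) = z powr (s - 5/4)" by (simp flip: powr_add)
      also have "B * z powr (s - 5/4) \<le> B * z powr (-9/8)"
        using z s B0 by (intro mult_left_mono powr_mono) auto
      finally show "norm (f z) \<le> B * z powr (-9/8)" .
    qed
    show ?thesis unfolding * using norm_triangle_mono[OF 1 2] .
  qed
  have Qs: "norm (Q (of_real s) - C - M * of_real s) \<le> (B1 + B2) * s\<^sup>2" if s: "0 < s" "s < 1/8" for s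
  proof -
    have "Q (of_real s) = of_real s ^ 2 * I s"
      unfolding Q_def I_def using tri_u_mellin(2)[OF a, of s] s by simp
    hence "Q (of_real s) - C - M * of_real s = of_real s ^ 2 * (I s - (C / of_real s ^ 2 + M / of_real s))"
      using s by (simp add: field_simps power2_eq_square)
    thus ?thesis using mult_left_mono[OF main[OF s], of "s\<^sup>2"] by (simp add: norm_mult norm_power mult_ac)
  qed
  define D where "D = rGamma a ^ 2 * (2 * Gamma 1 * (Gamma 1 * Digamma 1) * Gamma a) - rGamma a ^ 2 * Gamma 1 ^ 2 * (Gamma a * Digamma a)"
  have Q': "(Q has_field_derivative D) (at 0)"
    unfolding Q_def D_def using np by (auto intro!: derivative_eq_intros simp: algebra_simps power2_eq_square)
  have of0: "filterlim (\<lambda>s. complex_of_real s) (at 0) (at_right 0)"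
    unfolding filterlim_at by (auto intro!: tendsto_eq_intros eventually_mono[OF eventually_at_right_less])
  have lim0: "((\<lambda>s. Q (of_real s)) \<longlongrightarrow> Q 0) (at_right 0)"
    by (rule filterlim_compose[OF _ of0]) (use DERIV_isCont[OF Q'] in \<open>simp add: isCont_def\<close>)
  have ev: "\<forall>\<^sub>F s in at_right 0. 0 < s \<and> s < (1/8::real)"
    unfolding eventually_at_right_field by (intro exI[of _ "1/8"]) auto
  have r0: "((\<lambda>s. Q (of_real s) - C - M * of_real s) \<longlongrightarrow> 0) (at_right 0)"
  proof (rule Lim_null_comparison)
    show "\<forall>\<^sub>F s in at_right 0. norm (Q (of_real s) - C - M * of_real s) \<le> (B1 + B2) * s\<^sup>2"
      using ev by eventually_elim (use Qs in auto)
  qed (auto intro!: tendsto_eq_intros)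
  have "((\<lambda>s. Q (of_real s) - C - M * of_real s) \<longlongrightarrow> Q 0 - C - M * of_real 0) (at_right 0)"
    by (intro tendsto_intros lim0)
  from tendsto_unique[OF _ this r0] have C: "C = Q 0" by simp
  have R: "rGamma a * Gamma a = 1" using np by (simp add: rGamma_inverse_Gamma Gamma_eq_zero_iff)
  have Q0: "Q 0 = rGamma a" unfolding Q_def using R by (simp add: power2_eq_square mult.assoc)
  show "C = rGamma a" using C Q0 by simp
  have r1: "((\<lambda>s. (Q (of_real s) - C - M * of_real s) / of_real s) \<longlongrightarrow> 0) (at_right 0)"
  proof (rule Lim_null_comparison)
    show "\<forall>\<^sub>F s in at_right 0. norm ((Q (of_real s) - C - M * of_real s) / of_real s) \<le> (B1 + B2) * s"
      using ev
    proof eventually_elim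
      case (elim s)
      thus ?case using Qs[of s] by (simp add: norm_divide divide_le_eq power2_eq_square mult_ac)
    qed
  qed (auto intro!: tendsto_eq_intros)
  have "((\<lambda>h. (Q (0 + h) - Q 0) / h) \<longlongrightarrow> D) (at 0)" using Q' by (simp add: DERIV_def)
  from filterlim_compose[OF this of0]
  have "((\<lambda>s. (Q (of_real s) - C) / of_real s - M) \<longlongrightarrow> D - M) (at_right 0)" unfolding C
    by (intro tendsto_intros) simp
  hence "((\<lambda>s. (Q (of_real s) - C - M * of_real s) / of_real s) \<longlongrightarrow> D - M) (at_right 0)"
    by (rule Lim_transform_eventually) (auto intro!: eventually_mono[OF eventually_at_right_less] simp: field_simps)
  from tendsto_unique[OF _ this r1] have "M = D" by simp
  also have "D = (rGamma a * Gamma a) * (- rGamma a * (Digamma a + 2 * euler_mascheroni))"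
    by (simp add: D_def power2_eq_square algebra_simps)
  finally show "M = - rGamma a * (Digamma a + 2 * euler_mascheroni)" using R by simp
qed

section \<open>Kummer's equation as a first-order system\<close>

text \<open>
  The pair consists of \<open>U(a; 1; z)\<close> and \<open>U(a; 2; z)\<close>; eliminating \<open>v\<close> from the two equations gives
  Kummer's equation for \<open>u\<close>. The constants at \<open>0\<close> are written with \<open>rGamma\<close> and its derivative, since the
  form \<open>- rGamma a * (Digamma a + 2 * euler_mascheroni)\<close> makes no sense at the poles of \<open>Digamma\<close>.
\<close>
definition tricomi_pair :: "complex \<Rightarrow> (real \<Rightarrow> complex) \<Rightarrow> (real \<Rightarrow> complex) \<Rightarrow> bool" where
  "tricomi_pair a u v \<longleftrightarrow>
     (\<forall>z>0. (u has_vector_derivative u z - v z) (at z)) \<and>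
     (\<forall>z>0. (v has_vector_derivative ((1 - a) * u z - v z) / of_real z) (at z)) \<and>
     ((\<lambda>z. of_real z powr a * u z) \<longlongrightarrow> 1) at_top \<and>
     ((\<lambda>z. of_real z powr a * v z) \<longlongrightarrow> 1) at_top \<and>
     polar_expansion 0 (\<lambda>_. 0) (- rGamma a) (deriv rGamma a - 2 * euler_mascheroni * rGamma a) u \<and>
     ((\<lambda>z. of_real z * v z) \<longlongrightarrow> rGamma a) (at_right 0)"

lemma deriv_rGamma_shift: "deriv rGamma (a - 1) = rGamma a + (a - 1) * deriv rGamma (a :: complex)"
proof -
  have d: "(rGamma has_field_derivative deriv rGamma w) (at w)" for w :: complex
    using field_differentiable_rGamma[of w UNIV] by (simp add: field_differentiable_derivI)
  have "((\<lambda>w. rGamma (w + 1)) has_field_derivative deriv rGamma a * 1) (at (a - 1))"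
    by (rule DERIV_chain2[of rGamma]) (use d[of a] in \<open>auto intro!: derivative_eq_intros\<close>)
  from DERIV_mult[OF DERIV_ident this]
  have "((\<lambda>w. w * rGamma (w + 1)) has_field_derivative rGamma a + (a - 1) * deriv rGamma a) (at (a - 1))"
    by (simp add: algebra_simps)
  thus ?thesis unfolding rGamma_plus1 by (rule DERIV_imp_deriv)
qed

lemma tricomi_pair_tri:
  assumes a: "Re a > 2"
  shows "tricomi_pair a (tri_u a) (tri_v a)"
proof -
  have np: "a \<notin> \<int>\<^sub>\<le>\<^sub>0" using a by (auto elim!: nonpos_Ints_cases)
  have R: "rGamma a * Gamma a = 1" using np by (simp add: rGamma_inverse_Gamma Gamma_eq_zero_iff)
  obtain C M K where exp: "\<And>z. z \<in> {0<..1} \<Longrightarrow> norm (tri_u a z + C * of_real (ln z) - M) \<le> K * z powr (3/4)"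
    and v: "((\<lambda>z. of_real z * tri_v a z) \<longlongrightarrow> C) (at_right 0)"
    using tri_u_expansion_exists[OF a] by blast
  have C: "C = rGamma a" and M: "M = - rGamma a * (Digamma a + 2 * euler_mascheroni)"
    using tri_u_constants[OF a exp] by auto
  have "deriv rGamma a = - rGamma a * Digamma a"
    by (rule DERIV_imp_deriv[OF has_field_derivative_rGamma_no_nonpos_int[OF np]])
  hence M': "M = deriv rGamma a - 2 * euler_mascheroni * rGamma a"
    unfolding M by (simp add: algebra_simps)
  have "((\<lambda>z. tri_u a z + C * of_real (ln z) - M) \<longlongrightarrow> 0) (at_right 0)"
  proof (rule Lim_null_comparison)
    show "\<forall>\<^sub>F z in at_right 0. norm (tri_u a z + C * of_real (ln z) - M) \<le> K * z powr (3/4)"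
      using exp unfolding eventually_at_right_field by (intro exI[of _ 1]) auto
    show "((\<lambda>z. K * z powr (3/4)) \<longlongrightarrow> 0) (at_right 0)" by real_asymp
  qed
  hence pe: "polar_expansion 0 (\<lambda>_. 0) (- rGamma a) (deriv rGamma a - 2 * euler_mascheroni * rGamma a) (tri_u a)"
    unfolding polar_expansion_def M'[symmetric] C by (simp add: algebra_simps)
  have "((\<lambda>z. rGamma a * (of_real z powr a * laplace_kernel a c z)) \<longlongrightarrow> rGamma a * Gamma a) at_top" if "Re c \<le> 0" for c
    using a that by (intro tendsto_mult tendsto_const laplace_kernel_asymp) auto
  from this[of "- a"] this[of "1 - a"] have
    "((\<lambda>z. of_real z powr a * tri_u a z) \<longlongrightarrow> 1) at_top" "((\<lambda>z. of_real z powr a * tri_v a z) \<longlongrightarrow> 1) at_top"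
    using a R by (simp_all add: tri_u_def tri_v_def mult_ac)
  thus ?thesis unfolding tricomi_pair_def
    using pe v C a by (auto intro!: tri_u_deriv tri_v_deriv)
qed

lemma of_real_hvd: "((\<lambda>z. of_real z :: complex) has_vector_derivative 1) (at z)"
  by (rule has_vector_derivative_real_field) (auto intro!: derivative_eq_intros)

lemma inverse_of_real_tendsto_0: "((\<lambda>z. inverse (of_real z) :: complex) \<longlongrightarrow> 0) at_top"
proof -
  have "((\<lambda>z::real. inverse z) \<longlongrightarrow> 0) at_top" by (rule tendsto_inverse_0_at_top[OF filterlim_ident])
  from tendsto_of_real[OF this, where 'a = complex] show ?thesis by simp
qed

text \<open>The contiguous relations lowering \<open>a\<close> by one carry a pair for \<open>a\<close> into a pair for \<open>a - 1\<close>.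
  Since they hold for every \<open>a\<close>, the case of large real part is enough.\<close>
lemma tricomi_pair_lower:
  assumes "tricomi_pair a u v"
  shows "tricomi_pair (a - 1) (\<lambda>z. (a - 1) * u z + of_real z * v z) (\<lambda>z. (a - 1) * u z + (a - 1 + of_real z) * v z)"
proof -
  have u: "(u has_vector_derivative u z - v z) (at z)" 
    and v: "(v has_vector_derivative ((1 - a) * u z - v z) / of_real z) (at z)" if "z > 0" for z
    using assms that unfolding tricomi_pair_def by auto
  have lu: "((\<lambda>z. of_real z powr a * u z) \<longlongrightarrow> 1) at_top"
   and lv: "((\<lambda>z. of_real z powr a * v z) \<longlongrightarrow> 1) at_top" 
   and pe: "polar_expansion 0 (\<lambda>_. 0) (- rGamma a) (deriv rGamma a - 2 * euler_mascheroni * rGamma a) u"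
   and zv: "((\<lambda>z. of_real z * v z) \<longlongrightarrow> rGamma a) (at_right 0)"
    using assms unfolding tricomi_pair_def by auto
  have R: "rGamma (a - 1) = (a - 1) * rGamma a" using rGamma_plus1[of "a - 1"] by simp
  have d1: "((\<lambda>z. (a - 1) * u z + of_real z * v z) has_vector_derivative 
     ((a - 1) * u z + of_real z * v z) - ((a - 1) * u z + (a - 1 + of_real z) * v z)) (at z)" if z: "z > 0" for z
  proof -
    have "((\<lambda>z. (a - 1) * u z + of_real z * v z) has_vector_derivative 
     (a - 1) * (u z - v z) + (of_real z * (((1 - a) * u z - v z) / of_real z) + 1 * v z)) (at z)"
      by (intro has_vector_derivative_add has_vector_derivative_mult_right has_vector_derivative_mult of_real_hvd u v z)
    thus ?thesis by (rule has_vector_derivative_eq_rhs) (use z in \<open>simp add: field_simps\<close>)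
  qed
  have d2: "((\<lambda>z. (a - 1) * u z + (a - 1 + of_real z) * v z) has_vector_derivative 
     ((1 - (a - 1)) * ((a - 1) * u z + of_real z * v z) - ((a - 1) * u z + (a - 1 + of_real z) * v z)) / of_real z) (at z)" if z: "z > 0" for z
  proof -
    have "((\<lambda>z. (a - 1) * u z + (a - 1 + of_real z) * v z) has_vector_derivative 
     (a - 1) * (u z - v z) + ((a - 1 + of_real z) * (((1 - a) * u z - v z) / of_real z) + (0 + 1) * v z)) (at z)"
      by (intro has_vector_derivative_add has_vector_derivative_mult_right has_vector_derivative_mult of_real_hvd u v z has_vector_derivative_const)
    moreover have "(a - 1) * (u z - v z) + ((a - 1 + of_real z) * (((1 - a) * u z - v z) / of_real z) + (0 + 1) * v z) = 
     ((1 - (a - 1)) * ((a - 1) * u z + of_real z * v z) - ((a - 1) * u z + (a - 1 + of_real z) * v z)) / of_real z"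
      using z by (simp add: field_simps)
    ultimately show ?thesis by simp
  qed
  have "((\<lambda>z. (a - 1) * inverse (of_real z) * (of_real z powr a * u z) + of_real z powr a * v z) \<longlongrightarrow> (a - 1) * 0 * 1 + 1) at_top"
    by (intro tendsto_intros lu lv inverse_of_real_tendsto_0)
  hence l1: "((\<lambda>z. of_real z powr (a - 1) * ((a - 1) * u z + of_real z * v z)) \<longlongrightarrow> 1) at_top"
    by (simp, elim Lim_transform_eventually)
       (auto intro!: eventually_mono[OF eventually_gt_at_top[of 0]] simp: powr_diff field_simps)
  have "((\<lambda>z. (a - 1) * inverse (of_real z) * (of_real z powr a * u z) + ((a - 1) * inverse (of_real z) + 1) * (of_real z powr a * v z)) \<longlongrightarrow> (a - 1) * 0 * 1 + ((a - 1) * 0 + 1) * 1) at_top"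
    by (intro tendsto_intros lu lv inverse_of_real_tendsto_0)
  hence l2: "((\<lambda>z. of_real z powr (a - 1) * ((a - 1) * u z + (a - 1 + of_real z) * v z)) \<longlongrightarrow> 1) at_top"
    by (simp, elim Lim_transform_eventually)
       (auto intro!: eventually_mono[OF eventually_gt_at_top[of 0]] simp: powr_diff field_simps)
  have "((\<lambda>z. (a - 1) * (u z - ((\<Sum>k=1..0. 0 / of_real z ^ k) + (- rGamma a) * of_real (ln z) + (deriv rGamma a - 2 * euler_mascheroni * rGamma a)))
     + (of_real z * v z - rGamma a)) \<longlongrightarrow> (a - 1) * 0 + (rGamma a - rGamma a)) (at_right 0)"
    using pe unfolding polar_expansion_def by (intro tendsto_intros zv)
  hence pe': "polar_expansion 0 (\<lambda>_. 0) (- rGamma (a - 1)) (deriv rGamma (a - 1) - 2 * euler_mascheroni * rGamma (a - 1)) (\<lambda>z. (a - 1) * u z + of_real z * v z)"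
    unfolding polar_expansion_def R deriv_rGamma_shift by (simp add: algebra_simps)
  have zu: "((\<lambda>z. of_real z ^ 1 * u z) \<longlongrightarrow> 0) (at_right 0)"
    using polar_expansion_leading[OF pe, of 1] by simp
  have z0: "((\<lambda>z. of_real z :: complex) \<longlongrightarrow> 0) (at_right 0)" by (auto intro!: tendsto_eq_intros)
  have "((\<lambda>z. (a - 1) * (of_real z ^ 1 * u z) + (a - 1 + of_real z) * (of_real z * v z)) \<longlongrightarrow> (a - 1) * 0 + (a - 1 + 0) * rGamma a) (at_right 0)"
    by (intro tendsto_intros zu zv z0)
  hence zv': "((\<lambda>z. of_real z * ((a - 1) * u z + (a - 1 + of_real z) * v z)) \<longlongrightarrow> rGamma (a - 1)) (at_right 0)"
    unfolding R by (simp add: algebra_simps)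
  show ?thesis unfolding tricomi_pair_def using d1 d2 l1 l2 pe' zv' by blast
qed

text \<open>\<open>tricomi_seq a u v m\<close> is \<open>U(a; m + 1; z)\<close> when \<open>u\<close> and \<open>v\<close> are the first two members. The
  recursion is the three-term contiguous relation in the second parameter.\<close>
fun tricomi_seq :: "complex \<Rightarrow> (real \<Rightarrow> complex) \<Rightarrow> (real \<Rightarrow> complex) \<Rightarrow> nat \<Rightarrow> real \<Rightarrow> complex" where
  "tricomi_seq a u v 0 z = u z"
| "tricomi_seq a u v (Suc 0) z = v z"
| "tricomi_seq a u v (Suc (Suc m)) z =
     ((of_nat (Suc m) + of_real z) * tricomi_seq a u v (Suc m) z - (of_nat (Suc m) - a) * tricomi_seq a u v m z) / of_real z"

text \<open>The constant term at \<open>0\<close> of \<open>exp (- z) * U(a; m + 1; z)\<close>.\<close>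
primrec tricomi_const :: "complex \<Rightarrow> nat \<Rightarrow> complex" where
  "tricomi_const a 0 = deriv rGamma a - 2 * euler_mascheroni * rGamma a"
| "tricomi_const a (Suc m) = tricomi_const a m * (1 - a / of_nat (Suc m)) - a * (pochhammer (1 - a) m / fact m * rGamma a) / of_nat (Suc m) ^ 2"

locale tricomi =
  fixes a :: complex and u v :: "real \<Rightarrow> complex"
  assumes pair: "tricomi_pair a u v"
begin

abbreviation f :: "nat \<Rightarrow> real \<Rightarrow> complex" where "f \<equiv> tricomi_seq a u v"

lemma f_0: "f 0 = u"
  by (rule ext) simp

lemma f_rec: "z > 0 \<Longrightarrow> of_real z * f (Suc (Suc m)) z = (of_nat (Suc m) + of_real z) * f (Suc m) z - (of_nat (Suc m) - a) * f m z"
  by simp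

lemma f_deriv: "z > 0 \<Longrightarrow> (f m has_vector_derivative f m z - f (Suc m) z) (at z)"
proof (induction m rule: induct_nat_012)
  case 0
  thus ?case using pair by (simp add: tricomi_pair_def)
next
  case 1
  hence "(v has_vector_derivative ((1 - a) * u z - v z) / of_real z) (at z)"
    using pair by (simp add: tricomi_pair_def)
  moreover have "((1 - a) * u z - v z) / of_real z = f (Suc 0) z - f (Suc (Suc 0)) z"
    using 1 by (simp add: field_simps)
  ultimately show ?case by simp
next
  case (ge2 m)
  define N where "N = (\<lambda>z. (of_nat (Suc m) + of_real z) * f (Suc m) z - (of_nat (Suc m) - a) * f m z)"
  have i: "((\<lambda>z. inverse (of_real z) :: complex) has_vector_derivative - (1 / of_real z ^ 2)) (at z)"
    by (rule has_vector_derivative_real_field)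
       (use ge2.prems in \<open>auto intro!: derivative_eq_intros simp: power2_eq_square divide_inverse\<close>)
  have N': "(N has_vector_derivative ((of_nat (Suc m) + of_real z) * (f (Suc m) z - f (Suc (Suc m)) z) + (0 + 1) * f (Suc m) z) - (of_nat (Suc m) - a) * (f m z - f (Suc m) z)) (at z)"
    unfolding N_def using ge2
    by (intro has_vector_derivative_diff has_vector_derivative_mult has_vector_derivative_mult_right
        has_vector_derivative_add has_vector_derivative_const of_real_hvd) auto
  have "((\<lambda>z. N z * inverse (of_real z)) has_vector_derivative
      N z * (- (1 / of_real z ^ 2)) + (((of_nat (Suc m) + of_real z) * (f (Suc m) z - f (Suc (Suc m)) z) + (0 + 1) * f (Suc m) z) - (of_nat (Suc m) - a) * (f m z - f (Suc m) z)) * inverse (of_real z)) (at z)"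
    by (intro has_vector_derivative_mult N' i)
  moreover have "(\<lambda>z. N z * inverse (of_real z)) = f (Suc (Suc m))"
    by (auto simp: N_def divide_inverse)
  moreover have "N z * (- (1 / of_real z ^ 2)) + (((of_nat (Suc m) + of_real z) * (f (Suc m) z - f (Suc (Suc m)) z) + (0 + 1) * f (Suc m) z) - (of_nat (Suc m) - a) * (f m z - f (Suc m) z)) * inverse (of_real z)
     = f (Suc (Suc m)) z - f (Suc (Suc (Suc m))) z"
    using ge2.prems by (simp add: N_def field_simps power2_eq_square)
  ultimately show ?case by (simp only:)
qed

lemma f_continuous: "continuous_on {0<..} (f m)"
  by (intro continuous_at_imp_continuous_on ballI has_vector_derivative_continuous[OF f_deriv]) auto

lemma f_asymp: "((\<lambda>z. of_real z powr a * f m z) \<longlongrightarrow> 1) at_top"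
proof (induction m rule: induct_nat_012)
  case (ge2 m)
  have "((\<lambda>z. (of_nat (Suc m) * inverse (of_real z) + 1) * (of_real z powr a * f (Suc m) z) - (of_nat (Suc m) - a) * inverse (of_real z) * (of_real z powr a * f m z))
     \<longlongrightarrow> (of_nat (Suc m) * 0 + 1) * 1 - (of_nat (Suc m) - a) * 0 * 1) at_top"
    by (intro tendsto_intros ge2 inverse_of_real_tendsto_0)
  thus ?case
    by (simp del: of_nat_Suc, elim Lim_transform_eventually)
       (auto intro!: eventually_mono[OF eventually_gt_at_top[of 0]] simp: field_simps simp del: of_nat_Suc)
qed (use pair in \<open>simp_all add: tricomi_pair_def\<close>)

lemma f_primitive: 
  assumes "z > 0"
  shows "((\<lambda>z. of_real z ^ Suc m * f (Suc m) z) has_vector_derivative of_real z ^ m * ((of_nat (Suc m) - a) * f m z)) (at z)"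
proof -
  have p: "((\<lambda>z. of_real z ^ Suc m :: complex) has_vector_derivative of_nat (Suc m) * of_real z ^ m) (at z)"
    by (rule has_vector_derivative_real_field, rule DERIV_cong[OF DERIV_power[OF DERIV_ident]]) simp
  have "((\<lambda>z. of_real z ^ Suc m * f (Suc m) z) has_vector_derivative 
     of_real z ^ Suc m * (f (Suc m) z - f (Suc (Suc m)) z) + of_nat (Suc m) * of_real z ^ m * f (Suc m) z) (at z)"
    by (intro has_vector_derivative_mult p f_deriv assms)
  moreover have "of_real z ^ Suc m * (f (Suc m) z - f (Suc (Suc m)) z) + of_nat (Suc m) * of_real z ^ m * f (Suc m) z =
     of_real z ^ m * (of_real z * f (Suc m) z - of_real z * f (Suc (Suc m)) z + of_nat (Suc m) * f (Suc m) z)"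
    by (simp only: power_Suc algebra_simps)
  moreover have "of_real z * f (Suc m) z - of_real z * f (Suc (Suc m)) z + of_nat (Suc m) * f (Suc m) z = (of_nat (Suc m) - a) * f m z"
    unfolding f_rec[OF assms] by (simp only: algebra_simps)
  ultimately show ?thesis by simp
qed

text \<open>By the three-term recursion the leading coefficients satisfy \<open>C (m + 2) = (m + 1) * C (m + 1)\<close>,
  because the member two steps back has a weaker pole.\<close>
lemma f_leading:
  "((\<lambda>z. of_real z ^ Suc m * f (Suc m) z) \<longlongrightarrow> fact m * rGamma a) (at_right 0) \<and>
   ((\<lambda>z. of_real z ^ Suc m * f m z) \<longlongrightarrow> 0) (at_right 0)"
proof (induction m)
  case 0
  have pe: "polar_expansion 0 (\<lambda>_. 0) (- rGamma a) (deriv rGamma a - 2 * euler_mascheroni * rGamma a) u"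
    using pair by (simp add: tricomi_pair_def)
  show ?case using polar_expansion_leading[OF pe, of 1] pair by (simp add: tricomi_pair_def)
next
  case (Suc m)
  have z0: "((\<lambda>z. of_real z :: complex) \<longlongrightarrow> 0) (at_right 0)" by (auto intro!: tendsto_eq_intros)
  have "((\<lambda>z. (of_nat (Suc m) + of_real z) * (of_real z ^ Suc m * f (Suc m) z) - (of_nat (Suc m) - a) * (of_real z ^ Suc m * f m z)) \<longlongrightarrow>
      (of_nat (Suc m) + 0) * (fact m * rGamma a) - (of_nat (Suc m) - a) * 0) (at_right 0)"
    by (rule tendsto_diff[OF tendsto_mult[OF tendsto_add[OF tendsto_const z0] conjunct1[OF Suc]] tendsto_mult[OF tendsto_const conjunct2[OF Suc]]])
  moreover have "(of_nat (Suc m) + of_real z) * (of_real z ^ Suc m * f (Suc m) z) - (of_nat (Suc m) - a) * (of_real z ^ Suc m * f m z) = of_real z ^ Suc (Suc m) * f (Suc (Suc m)) z" if "z > 0" for z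
  proof -
    have "of_real z ^ Suc (Suc m) * f (Suc (Suc m)) z = of_real z ^ Suc m * (of_real z * f (Suc (Suc m)) z)"
      by (simp only: power_Suc mult_ac)
    also have "\<dots> = (of_nat (Suc m) + of_real z) * (of_real z ^ Suc m * f (Suc m) z) - (of_nat (Suc m) - a) * (of_real z ^ Suc m * f m z)"
      unfolding f_rec[OF that] by (simp only: algebra_simps)
    finally show ?thesis ..
  qed
  ultimately have "((\<lambda>z. of_real z ^ Suc (Suc m) * f (Suc (Suc m)) z) \<longlongrightarrow> (of_nat (Suc m) + 0) * (fact m * rGamma a) - (of_nat (Suc m) - a) * 0) (at_right 0)"
    by (elim Lim_transform_eventually) (auto intro!: eventually_mono[OF eventually_at_right_less])
  moreover have "(of_nat (Suc m) + 0) * (fact m * rGamma a) - (of_nat (Suc m) - a) * 0 = fact (Suc m) * rGamma a"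
    by simp
  moreover have "((\<lambda>z. of_real z * (of_real z ^ Suc m * f (Suc m) z)) \<longlongrightarrow> 0 * (fact m * rGamma a)) (at_right 0)"
    by (rule tendsto_mult[OF z0 conjunct1[OF Suc]])
  ultimately show ?case by (simp add: mult.assoc del: tricomi_seq.simps)
qed

text \<open>Each step integrates \<open>f_primitive\<close>; the constant of integration is the limit in \<open>f_leading\<close>.\<close>
lemma f_expansion:
  "\<exists>L M. polar_expansion m (\<lambda>k. fact (k - 1) * pochhammer (of_nat (Suc k) - a) (m - k) / fact (m - k) * rGamma a) L M (f m)"
proof (induction m)
  case 0
  have "polar_expansion 0 (\<lambda>_. 0) (- rGamma a) (deriv rGamma a - 2 * euler_mascheroni * rGamma a) (f 0)"
    unfolding f_0 using pair by (simp add: tricomi_pair_def)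
  hence "polar_expansion 0 (\<lambda>k. fact (k - 1) * pochhammer (of_nat (Suc k) - a) (0 - k) / fact (0 - k) * rGamma a) (- rGamma a) (deriv rGamma a - 2 * euler_mascheroni * rGamma a) (f 0)"
    by (rule polar_expansion_cong) auto
  thus ?case by blast
next
  case (Suc m)
  define c where "c = (\<lambda>m k. fact (k - 1) * pochhammer (of_nat (Suc k) - a) (m - k) / fact (m - k) * rGamma a)"
  define s where "s = of_nat (Suc m) - a"
  obtain L M where "polar_expansion m (c m) L M (f m)" using Suc unfolding c_def by blast
  from polar_expansion_linear[OF this this, of s 0]
  have "polar_expansion m (\<lambda>k. s * c m k) (s * L) (s * M) (\<lambda>z. s * f m z)" by simp
  from polar_expansion_primitive[OF this f_primitive[of _ m, folded s_def]]
  obtain C L' M' where C: "polar_expansion (Suc m) (\<lambda>k. if k = Suc m then C else s * c m k / of_nat (Suc m - k)) L' M' (\<lambda>z. of_real z ^ Suc m * f (Suc m) z / of_real z ^ Suc m)"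
    by blast
  hence C': "polar_expansion (Suc m) (\<lambda>k. if k = Suc m then C else s * c m k / of_nat (Suc m - k)) L' M' (f (Suc m))"
    by (rule polar_expansion_cong) auto
  have "((\<lambda>z. of_real z ^ Suc m * f (Suc m) z) \<longlongrightarrow> C) (at_right 0)"
    using polar_expansion_leading[OF C', of "Suc m"] by simp
  from tendsto_unique[OF _ this conjunct1[OF f_leading]] have C_eq: "C = fact m * rGamma a" by simp
  have "polar_expansion (Suc m) (c (Suc m)) L' M' (f (Suc m))"
  proof (rule polar_expansion_cong[OF C'])
    fix k assume k: "1 \<le> k" "k \<le> Suc m"
    show "(if k = Suc m then C else s * c m k / of_nat (Suc m - k)) = c (Suc m) k"
    proof (cases "k = Suc m")
      case False
      hence k': "Suc m - k = Suc (m - k)" "k \<le> m" using k by auto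
      have "of_nat (Suc k) - a + of_nat (m - k) = s" using k' by (simp add: s_def of_nat_diff)
      hence "pochhammer (of_nat (Suc k) - a) (Suc (m - k)) = pochhammer (of_nat (Suc k) - a) (m - k) * s"
        by (simp only: pochhammer_Suc)
      moreover have "of_nat (Suc (m - k)) \<noteq> (0::complex)" using of_nat_neq_0 by blast
      ultimately show ?thesis using False unfolding c_def k'(1) fact_Suc by (simp add: divide_simps del: of_nat_Suc)
    qed (simp add: c_def C_eq)
  qed auto
  thus ?case unfolding c_def by blast
qed

abbreviation g :: "nat \<Rightarrow> real \<Rightarrow> complex" where "g m z \<equiv> of_real (exp (- z)) * f m z"

lemma exp_minus_hvd: "((\<lambda>z. of_real (exp (- z)) :: complex) has_vector_derivative - of_real (exp (- z))) (at z)"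
proof -
  have "((\<lambda>z. exp (- z)) has_real_derivative - exp (- z)) (at z)" by (auto intro!: derivative_eq_intros)
  from has_vector_derivative_of_real[OF this] show ?thesis by simp
qed

lemma g_deriv:
  assumes "z > 0"
  shows "(g m has_vector_derivative - g (Suc m) z) (at z)"
  using has_vector_derivative_mult[OF exp_minus_hvd f_deriv[OF assms], of m] by (simp add: algebra_simps)

lemma g_continuous: "continuous_on {0<..} (g m)"
  by (intro continuous_intros f_continuous)

text \<open>In this form no exponential factor is left, so the expansion of \<open>exp (- z) * f m z\<close> can be integrated
  directly, without multiplying an expansion by the Taylor series of \<open>exp\<close>.\<close>
lemma g_primitive:
  assumes "z > 0"
  shows "((\<lambda>z. of_real z ^ Suc m * (g (Suc m) z - g m z)) has_vector_derivative of_real z ^ m * (- a * g m z)) (at z)"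
proof -
  define E where "E = complex_of_real (exp (- z))"
  have p: "((\<lambda>z. of_real z ^ Suc m :: complex) has_vector_derivative of_nat (Suc m) * of_real z ^ m) (at z)"
    by (rule has_vector_derivative_real_field, rule DERIV_cong[OF DERIV_power[OF DERIV_ident]]) simp
  have 1: "((\<lambda>z. of_real (exp (- z)) * (of_real z ^ Suc m * f (Suc m) z)) has_vector_derivative
     E * (of_real z ^ m * ((of_nat (Suc m) - a) * f m z)) + - E * (of_real z ^ Suc m * f (Suc m) z)) (at z)"
    unfolding E_def by (intro has_vector_derivative_mult exp_minus_hvd f_primitive assms)
  have 2: "((\<lambda>z. of_real z ^ Suc m * g m z) has_vector_derivative of_real z ^ Suc m * (- (E * f (Suc m) z)) + of_nat (Suc m) * of_real z ^ m * (E * f m z)) (at z)"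
    unfolding E_def by (intro has_vector_derivative_mult p g_deriv assms)
  have eq: "(\<lambda>z. of_real z ^ Suc m * (g (Suc m) z - g m z)) = (\<lambda>z. of_real (exp (- z)) * (of_real z ^ Suc m * f (Suc m) z) - of_real z ^ Suc m * g m z)"
    by (intro ext) (simp only: algebra_simps)
  show ?thesis unfolding eq
    by (rule has_vector_derivative_eq_rhs[OF has_vector_derivative_diff[OF 1 2]])
       (simp add: E_def[symmetric] algebra_simps del: of_nat_Suc)
qed

abbreviation const_term :: "nat \<Rightarrow> complex" where "const_term \<equiv> tricomi_const a"

lemma g_expansion:
  "polar_expansion m (\<lambda>k. fact (k - 1) * pochhammer (1 - a) (m - k) / fact (m - k) * rGamma a)
     (- pochhammer (1 - a) m / fact m * rGamma a) (const_term m) (g m)"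
proof (induction m)
  case 0
  define L where "L = - rGamma a"
  define M where "M = const_term 0"
  have pe: "((\<lambda>z. u z - (L * of_real (ln z) + M)) \<longlongrightarrow> 0) (at_right 0)"
    using pair by (simp add: tricomi_pair_def polar_expansion_def L_def M_def)
  have e: "((\<lambda>z. of_real (exp (- z)) :: complex) \<longlongrightarrow> of_real 1) (at_right 0)"
    by (intro tendsto_of_real) (auto intro!: tendsto_eq_intros)
  have l: "((\<lambda>z. of_real ((exp (- z) - 1) * ln z) :: complex) \<longlongrightarrow> of_real 0) (at_right 0)"
    by (intro tendsto_of_real) real_asymp
  have "((\<lambda>z. of_real (exp (- z)) * (u z - (L * of_real (ln z) + M)) + (L * of_real ((exp (- z) - 1) * ln z) + (of_real (exp (- z)) - 1) * M))
     \<longlongrightarrow> of_real 1 * 0 + (L * of_real 0 + (of_real 1 - 1) * M)) (at_right 0)"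
    by (intro tendsto_add tendsto_mult tendsto_diff tendsto_const pe e l)
  hence "((\<lambda>z. g 0 z - (L * of_real (ln z) + M)) \<longlongrightarrow> 0) (at_right 0)"
    by (simp add: algebra_simps)
  thus ?case by (simp add: polar_expansion_def L_def M_def)
next
  case (Suc m)
  define q where "q = (\<lambda>m k. fact (k - 1) * pochhammer (1 - a) (m - k) / fact (m - k) * rGamma a)"
  define L where "L = (\<lambda>m. - pochhammer (1 - a) m / fact m * rGamma a)"
  define s :: complex where "s = of_nat (Suc m)"
  have s: "s \<noteq> 0" unfolding s_def using of_nat_neq_0 by blast
  have IH: "polar_expansion m (q m) (L m) (const_term m) (g m)" using Suc unfolding q_def L_def .
  from polar_expansion_linear[OF this this, of "- a" 0]
  have "polar_expansion m (\<lambda>k. - a * q m k) (- a * L m) (- a * const_term m) (\<lambda>z. - a * g m z)" by simp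
  from polar_expansion_primitive[OF this g_primitive[of _ m]]
  obtain C where C: "polar_expansion (Suc m) (\<lambda>k. if k = Suc m then C else - a * q m k / of_nat (Suc m - k))
     (- a * L m / s) (- a * const_term m / s - - a * L m / s ^ 2)
     (\<lambda>z. of_real z ^ Suc m * (g (Suc m) z - g m z) / of_real z ^ Suc m)"
    unfolding s_def by blast
  from polar_expansion_linear[OF C polar_expansion_Suc[OF IH], of 1 1]
  have C': "polar_expansion (Suc m) (\<lambda>k. (if k = Suc m then C else - a * q m k / of_nat (Suc m - k)) + (if k = Suc m then 0 else q m k))
     (- a * L m / s + L m) ((- a * const_term m / s - - a * L m / s ^ 2) + const_term m) (g (Suc m))"
    by (rule polar_expansion_cong) simp_all
  have e: "((\<lambda>z. of_real (exp (- z)) :: complex) \<longlongrightarrow> of_real 1) (at_right 0)"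
    by (intro tendsto_of_real) (auto intro!: tendsto_eq_intros)
  have 1: "((\<lambda>z. of_real z ^ Suc m * g (Suc m) z) \<longlongrightarrow> C) (at_right 0)"
    using polar_expansion_leading[OF C', of "Suc m"] by simp
  have "((\<lambda>z. of_real (exp (- z)) * (of_real z ^ Suc m * f (Suc m) z)) \<longlongrightarrow> of_real 1 * (fact m * rGamma a)) (at_right 0)"
    by (rule tendsto_mult[OF e conjunct1[OF f_leading]])
  hence 2: "((\<lambda>z. of_real z ^ Suc m * g (Suc m) z) \<longlongrightarrow> fact m * rGamma a) (at_right 0)"
    by (simp add: mult_ac)
  have C_eq: "C = fact m * rGamma a" using tendsto_unique[OF _ 1 2] by simp
  have "polar_expansion (Suc m) (q (Suc m)) (L (Suc m)) (const_term (Suc m)) (g (Suc m))"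
  proof (rule polar_expansion_cong[OF C'])
    fix k assume k: "1 \<le> k" "k \<le> Suc m"
    show "(if k = Suc m then C else - a * q m k / of_nat (Suc m - k)) + (if k = Suc m then 0 else q m k) = q (Suc m) k"
    proof (cases "k = Suc m")
      case False
      hence k': "Suc m - k = Suc (m - k)" using k by auto
      define t :: complex where "t = of_nat (Suc (m - k))"
      have t: "t \<noteq> 0" unfolding t_def using of_nat_neq_0 by blast
      have "1 - a + of_nat (m - k) = t - a" by (simp add: t_def)
      hence "q (Suc m) k = fact (k - 1) * (pochhammer (1 - a) (m - k) * (t - a)) / (t * fact (m - k)) * rGamma a"
        unfolding q_def k' pochhammer_Suc fact_Suc t_def by (simp only: of_nat_mult of_nat_fact)
      also have "\<dots> = q m k * (t - a) / t" unfolding q_def by (simp add: mult_ac)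
      also have "\<dots> = - a * q m k / t + q m k" using t by (simp add: field_simps)
      finally show ?thesis using False k' by (simp add: t_def)
    qed (simp add: q_def C_eq)
  next
    have "1 - a + of_nat m = s - a" by (simp add: s_def)
    hence "L (Suc m) = - (pochhammer (1 - a) m * (s - a)) / (s * fact m) * rGamma a"
      unfolding L_def pochhammer_Suc fact_Suc s_def by (simp only: of_nat_mult of_nat_fact)
    moreover have "- a * L m / s + L m = L m * (s - a) / s" using s by (simp add: field_simps)
    moreover have "L m * (s - a) / s = - (pochhammer (1 - a) m * (s - a)) / (s * fact m) * rGamma a"
      by (simp add: L_def mult_ac)
    ultimately show "- a * L m / s + L m = L (Suc m)" by (simp only:)
  next
    show "(- a * const_term m / s - - a * L m / s ^ 2) + const_term m = const_term (Suc m)"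
      unfolding tricomi_const.simps s_def[symmetric] L_def using s by (simp add: field_simps)
  qed auto
  thus ?case unfolding q_def L_def .
qed

end

section \<open>Uniqueness of Tricomi's function\<close>

text \<open>The increment of \<open>k\<close> over \<open>{z..z+1}\<close> tends both to \<open>0\<close> and to \<open>W\<close>.\<close>
lemma tendsto_0_imp_deriv_limit_0:
  fixes k :: "real \<Rightarrow> complex"
  assumes k: "\<And>z. z > 0 \<Longrightarrow> (k has_vector_derivative k' z) (at z)"
    and lim: "(k \<longlongrightarrow> 0) at_top" and lim': "(k' \<longlongrightarrow> W) at_top"
  shows "W = 0"
proof -
  have le: "norm W \<le> e" if "e > 0" for e
  proof -
    obtain Z where Z: "\<And>z. z \<ge> Z \<Longrightarrow> norm (k' z - W) < e"
      using tendstoD[OF lim' \<open>e > 0\<close>] unfolding eventually_at_top_linorder dist_norm by blast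
    have "norm (k (z + 1) - k z - W) \<le> e" if z: "z \<ge> max Z 1" for z
    proof -
      have "norm ((k (z + 1) - W * of_real (z + 1)) - (k z - W * of_real z)) \<le> e * (z + 1) - e * z"
      proof (rule differentiable_bound_general[where f' = "\<lambda>z. k' z - W" and \<phi>' = "\<lambda>_. e"])
        show "continuous_on {z..z+1} (\<lambda>z. k z - W * of_real z)"
          using z by (intro continuous_intros continuous_at_imp_continuous_on ballI has_vector_derivative_continuous[OF k]) auto
        show "((\<lambda>z. k z - W * of_real z) has_vector_derivative k' x - W) (at x)" if "z < x" for x
          using has_vector_derivative_diff[OF k has_vector_derivative_mult_right[OF of_real_hvd, of W]] that z by simp
        show "((\<lambda>z. e * z) has_vector_derivative e) (at x)" for x
          unfolding has_real_derivative_iff_has_vector_derivative[symmetric] by (auto intro!: derivative_eq_intros)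
        show "norm (k' x - W) \<le> e" if "z < x" for x using Z[of x] that z by auto
      qed (auto intro!: continuous_intros)
      thus ?thesis by (simp add: algebra_simps)
    qed
    hence ev: "\<forall>\<^sub>F z in at_top. norm (k (z + 1) - k z - W) \<le> e"
      unfolding eventually_at_top_linorder by blast
    have lim_norm: "((\<lambda>z. norm (k (z + 1) - k z - W)) \<longlongrightarrow> norm (0 - 0 - W)) at_top"
      by (intro tendsto_intros lim filterlim_compose[OF lim]) real_asymp
    show ?thesis using tendsto_upperbound[OF lim_norm ev] by simp
  qed
  have "norm W \<le> 0"
  proof (rule field_le_epsilon)
    show "norm W \<le> 0 + e" if "e > 0" for e using le[OF that] by simp
  qed
  thus ?thesis by simp
qed

definition kummer_solution :: "complex \<Rightarrow> complex \<Rightarrow> (real \<Rightarrow> complex) \<Rightarrow> (real \<Rightarrow> complex) \<Rightarrow> (real \<Rightarrow> complex) \<Rightarrow> bool" where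
  "kummer_solution a c f f' f'' \<longleftrightarrow> (\<forall>z>0.
        (f has_vector_derivative f' z) (at z) \<and>
        (f' has_vector_derivative f'' z) (at z) \<and>
        of_real z * f'' z + (c - of_real z) * f' z - a * f z = 0)"

lemma kummer_solution_diff:
  assumes "kummer_solution a c f f' f''" "kummer_solution a c g g' g''"
  shows "kummer_solution a c (\<lambda>z. f z - g z) (\<lambda>z. f' z - g' z) (\<lambda>z. f'' z - g'' z)"
proof -
  have "of_real z * (f'' z - g'' z) + (c - of_real z) * (f' z - g' z) - a * (f z - g z) = 
    (of_real z * f'' z + (c - of_real z) * f' z - a * f z) - (of_real z * g'' z + (c - of_real z) * g' z - a * g z)" for z
    by (simp add: algebra_simps)
  thus ?thesis using assms unfolding kummer_solution_def by (auto intro: has_vector_derivative_diff)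
qed

lemma inner_le_half_squares: "\<bar>inner x y\<bar> \<le> (norm x ^ 2 + norm y ^ 2) / 2" for x y :: complex
proof -
  have "0 \<le> (norm x - norm y) ^ 2" by simp
  hence "norm x * norm y \<le> (norm x ^ 2 + norm y ^ 2) / 2" by (simp add: power2_diff)
  thus ?thesis using Cauchy_Schwarz_ineq2[of x y] by linarith
qed

text \<open>A solution vanishing near infinity vanishes everywhere: with a large constant \<open>K\<close> the energy
  \<open>(\<bar>d\<bar>\<^sup>2 + \<bar>d'\<bar>\<^sup>2) * exp (K * z)\<close> increases on \<open>{z0..Z}\<close>.\<close>
lemma kummer_solution_zero:
  assumes d: "kummer_solution a c d d' d''" and Z: "Z > 0" "\<And>z. z \<ge> Z \<Longrightarrow> d z = 0" and z0: "z0 > 0"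
  shows "d z0 = 0"
proof (cases "z0 < Z + 1")
  case True
  define Z1 where "Z1 = Z + 1"
  have dd: "(d has_vector_derivative d' z) (at z)" and dd': "(d' has_vector_derivative d'' z) (at z)"
    and ode: "of_real z * d'' z + (c - of_real z) * d' z - a * d z = 0" if "z > 0" for z
    using d that unfolding kummer_solution_def by auto
  have dZ1: "d Z1 = 0" using Z by (simp add: Z1_def)
  have "(d has_vector_derivative 0) (at Z1)"
    by (rule has_vector_derivative_transform_within_open[of "\<lambda>_. 0" _ _ "{Z<..}"])
       (use Z in \<open>auto simp: Z1_def intro: less_imp_le\<close>)
  hence d'Z1: "d' Z1 = 0"
    using vector_derivative_unique_at[OF dd[of Z1]] Z by (auto simp: Z1_def)
  define B where "B = (norm c + Z1 + norm a) / z0"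
  \<comment> \<open>\<open>K\<close> times the energy dominates its derivative: the mixed term of \<open>d\<close> and \<open>d'\<close> costs \<open>1\<close>, that of \<open>d'\<close> and \<open>d''\<close> costs \<open>3 * B\<close>\<close>
  define K where "K = 1 + 3 * B"
  define E where "E = (\<lambda>z. (inner (d z) (d z) + inner (d' z) (d' z)) * exp (K * z))"
  have B: "B \<ge> 0" using z0 Z by (simp add: B_def Z1_def)
  have "\<exists>y. (E has_real_derivative y) (at z) \<and> y \<ge> 0" if z: "z0 \<le> z" "z \<le> Z1" for z
  proof -
    have z': "z > 0" using z z0 by simp
    have e: "((\<lambda>z. exp (K * z)) has_vector_derivative K * exp (K * z)) (at z)"
      unfolding has_real_derivative_iff_has_vector_derivative[symmetric] by (auto intro!: derivative_eq_intros)
    have E': "(E has_vector_derivative (inner (d z) (d z) + inner (d' z) (d' z)) * (K * exp (K * z)) +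
        ((inner (d z) (d' z) + inner (d' z) (d z)) + (inner (d' z) (d'' z) + inner (d'' z) (d' z))) * exp (K * z)) (at z)"
      unfolding E_def
      by (intro has_vector_derivative_mult e has_vector_derivative_add
          bounded_bilinear.has_vector_derivative[OF bounded_bilinear_inner] dd dd' z')
    have "of_real z * d'' z = a * d z - (c - of_real z) * d' z" using ode[OF z'] by (simp add: algebra_simps)
    hence "norm (of_real z * d'' z) \<le> norm a * norm (d z) + (norm c + z) * norm (d' z)"
      using norm_triangle_ineq4[of "a * d z" "(c - of_real z) * d' z"] norm_triangle_ineq4[of c "of_real z"] z'
        mult_right_mono[of "norm (c - of_real z)" "norm c + z" "norm (d' z)"]
      by (simp add: norm_mult)
    also have "\<dots> \<le> (norm c + Z1 + norm a) * norm (d z) + (norm c + Z1 + norm a) * norm (d' z)"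
      by (rule add_mono; rule mult_right_mono) (use z z' norm_ge_zero[of a] norm_ge_zero[of c] in \<open>linarith | simp\<close>)+
    finally have "z * norm (d'' z) \<le> (norm c + Z1 + norm a) * (norm (d z) + norm (d' z))"
      using z' by (simp add: norm_mult distrib_left)
    moreover have "z0 * norm (d'' z) \<le> z * norm (d'' z)" using z by (intro mult_right_mono) auto
    ultimately have d'': "norm (d'' z) \<le> B * (norm (d z) + norm (d' z))"
      using z0 by (simp add: B_def field_simps)
    define P where "P = norm (d z) ^ 2 + norm (d' z) ^ 2"
    have P: "P \<ge> 0" by (simp add: P_def)
    have 1: "\<bar>inner (d z) (d' z)\<bar> \<le> P / 2" using inner_le_half_squares[of "d z" "d' z"] by (simp add: P_def)
    have "\<bar>inner (d' z) (d'' z)\<bar> \<le> norm (d' z) * (B * (norm (d z) + norm (d' z)))"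
      using Cauchy_Schwarz_ineq2[of "d' z" "d'' z"] mult_left_mono[OF d'', of "norm (d' z)"] by simp
    also have "\<dots> = B * (norm (d z) * norm (d' z) + norm (d' z) ^ 2)" by (simp add: algebra_simps power2_eq_square)
    also have "\<dots> \<le> B * (3 / 2 * P)"
    proof (rule mult_left_mono[OF _ B])
      have "0 \<le> (norm (d z) - norm (d' z)) ^ 2" by simp
      hence "2 * (norm (d z) * norm (d' z)) \<le> P" by (simp add: P_def power2_diff)
      moreover have "norm (d' z) ^ 2 \<le> P" by (simp add: P_def)
      ultimately show "norm (d z) * norm (d' z) + norm (d' z) ^ 2 \<le> 3 / 2 * P" by linarith
    qed
    finally have 2: "\<bar>inner (d' z) (d'' z)\<bar> \<le> B * (3 / 2 * P)" .
    have "P * K + ((inner (d z) (d' z) + inner (d' z) (d z)) + (inner (d' z) (d'' z) + inner (d'' z) (d' z))) \<ge> 0"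
    proof -
      have "P * K = P + 2 * (B * (3 / 2 * P))" by (simp add: K_def algebra_simps)
      thus ?thesis using 1 2 by (simp add: inner_commute)
    qed
    hence "(P * K + ((inner (d z) (d' z) + inner (d' z) (d z)) + (inner (d' z) (d'' z) + inner (d'' z) (d' z)))) * exp (K * z) \<ge> 0"
      by simp
    moreover have "P = inner (d z) (d z) + inner (d' z) (d' z)" by (simp add: P_def power2_norm_eq_inner)
    ultimately show ?thesis using E' unfolding has_real_derivative_iff_has_vector_derivative
      by (auto simp: algebra_simps intro!: exI)
  qed
  from DERIV_nonneg_imp_nondecreasing[of z0 Z1 E, OF _ this] True have "E z0 \<le> E Z1" by (simp add: Z1_def)
  also have "E Z1 = 0" by (simp add: E_def dZ1 d'Z1)
  finally have "inner (d z0) (d z0) + inner (d' z0) (d' z0) \<le> 0" by (simp add: E_def mult_le_0_iff)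
  moreover have "inner (d' z0) (d' z0) \<ge> 0" by simp
  ultimately have "inner (d z0) (d z0) \<le> 0" by linarith
  thus ?thesis by (metis inner_gt_zero_iff not_le)
qed (use Z in auto)

text \<open>
  For a second solution with the same leading asymptotics, let \<open>d\<close> be the difference. The weighted
  Wronskian of \<open>d\<close> and \<open>u\<close> is a constant \<open>W\<close>; it is also the limit of the derivative of
  \<open>z powr c * exp (- z) * d z * u z\<close>, which decays. Hence \<open>W = 0\<close>, so \<open>d\<close> is a multiple of \<open>u\<close>.
\<close>
lemma kummer_solution_unique:
  assumes u: "kummer_solution a c u u' u''" and f: "kummer_solution a c f f' f''"
    and lu: "((\<lambda>z. of_real z powr a * u z) \<longlongrightarrow> 1) at_top" and lu': "((\<lambda>z. of_real z powr a * u' z) \<longlongrightarrow> 0) at_top"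
    and lf: "((\<lambda>z. of_real z powr a * f z) \<longlongrightarrow> 1) at_top"
    and z0: "z0 > 0"
  shows "f z0 = u z0"
proof -
  define d where "d = (\<lambda>z. f z - u z)"
  define d' where "d' = (\<lambda>z. f' z - u' z)"
  define d'' where "d'' = (\<lambda>z. f'' z - u'' z)"
  have d: "kummer_solution a c d d' d''"
    unfolding d_def d'_def d''_def by (rule kummer_solution_diff[OF f u])
  have dd: "(d has_vector_derivative d' z) (at z)" and dd': "(d' has_vector_derivative d'' z) (at z)"
    and ode: "of_real z * d'' z + (c - of_real z) * d' z = a * d z" if "z > 0" for z
    using d that unfolding kummer_solution_def by auto
  have du: "(u has_vector_derivative u' z) (at z)" and du': "(u' has_vector_derivative u'' z) (at z)"
    and odeu: "of_real z * u'' z + (c - of_real z) * u' z = a * u z" if "z > 0" for z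
    using u that unfolding kummer_solution_def by auto
  have ld: "((\<lambda>z. of_real z powr a * d z) \<longlongrightarrow> 0) at_top"
    using tendsto_diff[OF lf lu] by (simp add: d_def right_diff_distrib)
  define p where "p = (\<lambda>z. of_real z powr c * of_real (exp (- z)) :: complex)"
  have p': "(p has_vector_derivative (c / of_real z - 1) * p z) (at z)" if "z > 0" for z
  proof -
    have e: "((\<lambda>z. of_real (exp (- z)) :: complex) has_vector_derivative - of_real (exp (- z))) (at z)"
    proof -
      have "((\<lambda>z. exp (- z)) has_real_derivative - exp (- z)) (at z)" by (auto intro!: derivative_eq_intros)
      from has_vector_derivative_of_real[OF this] show ?thesis by simp
    qed
    show ?thesis unfolding p_def
      by (rule has_vector_derivative_eq_rhs[OF has_vector_derivative_mult[OF has_vector_derivative_of_real_powr[OF that] e]])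
         (use that in \<open>simp add: powr_diff field_simps\<close>)
  qed
  define w where "w = (\<lambda>z. p z * (d' z * u z - d z * u' z))"
  have w': "(w has_vector_derivative 0) (at z)" if z: "z > 0" for z
  proof -
    have "(w has_vector_derivative p z * ((d' z * u' z + d'' z * u z) - (d z * u'' z + d' z * u' z)) + (c / of_real z - 1) * p z * (d' z * u z - d z * u' z)) (at z)"
      unfolding w_def by (intro has_vector_derivative_mult has_vector_derivative_diff p' dd dd' du du' z)
    also have "p z * ((d' z * u' z + d'' z * u z) - (d z * u'' z + d' z * u' z)) + (c / of_real z - 1) * p z * (d' z * u z - d z * u' z)
       = p z / of_real z * (u z * (of_real z * d'' z + (c - of_real z) * d' z) - d z * (of_real z * u'' z + (c - of_real z) * u' z))"
      using z by (simp add: field_simps)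
    also have "\<dots> = 0" unfolding ode[OF z] odeu[OF z] by simp
    finally show ?thesis .
  qed
  have "(w has_vector_derivative 0) (at z within {0<..})" if "z \<in> {0<..}" for z
    by (rule has_vector_derivative_at_within[OF w']) (use that in simp)
  then obtain W where "\<And>z. z \<in> {0<..} \<Longrightarrow> w z = W"
    using has_vector_derivative_zero_constant[of "{0<..}" w] by (metis convex_real_interval(3))
  hence W: "w z = W" if "z > 0" for z using that by simp
  define k where "k = (\<lambda>z. p z * (d z * u z))"
  define k' where "k' = (\<lambda>z. W + p z * (d z * (2 * u' z + (c / of_real z - 1) * u z)))"
  have k_deriv: "(k has_vector_derivative k' z) (at z)" if z: "z > 0" for z
  proof -
    have "(k has_vector_derivative p z * (d z * u' z + d' z * u z) + (c / of_real z - 1) * p z * (d z * u z)) (at z)"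
      unfolding k_def by (intro has_vector_derivative_mult p' dd du z)
    also have "p z * (d z * u' z + d' z * u z) + (c / of_real z - 1) * p z * (d z * u z) = k' z"
      unfolding k'_def W[OF z, symmetric] w_def by (simp add: algebra_simps)
    finally show ?thesis .
  qed
  have pa: "((\<lambda>z. p z * of_real z powr (- 2 * a)) \<longlongrightarrow> 0) at_top"
  proof (rule Lim_null_comparison)
    show "\<forall>\<^sub>F z in at_top. norm (p z * of_real z powr (- 2 * a)) \<le> z powr Re c * exp (- z) * z powr (- 2 * Re a)"
      using eventually_gt_at_top[of 0]
    proof eventually_elim
      case (elim z)
      thus ?case using norm_of_real_powr[OF elim, of "- 2 * a"] norm_of_real_powr[OF elim, of c] by (simp add: p_def norm_mult)
    qed
    show "((\<lambda>z. z powr Re c * exp (- z) * z powr (- 2 * Re a)) \<longlongrightarrow> 0) at_top" by real_asymp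
  qed
  have cz: "((\<lambda>z. c / of_real z - 1) \<longlongrightarrow> c * 0 - 1) at_top"
    unfolding divide_inverse by (intro tendsto_intros inverse_of_real_tendsto_0)
  have aa: "of_real z powr (- 2 * a) * of_real z powr a * of_real z powr a = (1::complex)" if "z > 0" for z
    using that by (simp flip: powr_add)
  have fac: "p z * (d z * X) = (p z * of_real z powr (- 2 * a)) * (of_real z powr a * d z) * (of_real z powr a * X)" if "z > 0" for z X
  proof -
    have "p z * (d z * X) = (of_real z powr (- 2 * a) * of_real z powr a * of_real z powr a) * (p z * (d z * X))"
      using aa[OF that] by simp
    thus ?thesis by (simp only: mult_ac)
  qed
  have "((\<lambda>z. (p z * of_real z powr (- 2 * a)) * (of_real z powr a * d z) * (of_real z powr a * u z)) \<longlongrightarrow> 0 * 0 * 1) at_top"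
    by (intro tendsto_mult pa ld lu)
  hence "((\<lambda>z. (p z * of_real z powr (- 2 * a)) * (of_real z powr a * d z) * (of_real z powr a * u z)) \<longlongrightarrow> 0) at_top"
    by (simp only: mult_zero_left)
  hence k_lim: "(k \<longlongrightarrow> 0) at_top"
    unfolding k_def by (rule Lim_transform_eventually)
       (intro eventually_mono[OF eventually_gt_at_top[of 0]] fac[symmetric])
  have l2: "((\<lambda>z. of_real z powr a * (2 * u' z + (c / of_real z - 1) * u z)) \<longlongrightarrow> 2 * 0 + (c * 0 - 1) * 1) at_top"
    using tendsto_add[OF tendsto_mult[OF tendsto_const[of 2] lu'] tendsto_mult[OF cz lu]] by (simp add: algebra_simps)
  have "((\<lambda>z. W + (p z * of_real z powr (- 2 * a)) * (of_real z powr a * d z) * (of_real z powr a * (2 * u' z + (c / of_real z - 1) * u z)))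
     \<longlongrightarrow> W + 0 * 0 * (2 * 0 + (c * 0 - 1) * 1)) at_top"
    by (intro tendsto_add tendsto_const tendsto_mult pa ld l2)
  hence "((\<lambda>z. W + (p z * of_real z powr (- 2 * a)) * (of_real z powr a * d z) * (of_real z powr a * (2 * u' z + (c / of_real z - 1) * u z))) \<longlongrightarrow> W) at_top"
    by (simp only: mult_zero_left add_0_right)
  hence k'_lim: "(k' \<longlongrightarrow> W) at_top"
    unfolding k'_def by (rule Lim_transform_eventually)
       (rule eventually_mono[OF eventually_gt_at_top[of 0]], simp only: fac)
  have W0: "W = 0" by (rule tendsto_0_imp_deriv_limit_0[OF k_deriv k_lim k'_lim])
  have "\<forall>\<^sub>F z in at_top. norm (of_real z powr a * u z - 1) < 1"
    using tendstoD[OF lu zero_less_one] by (simp add: dist_norm)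
  then obtain Z' where Z': "\<And>z. z \<ge> Z' \<Longrightarrow> norm (of_real z powr a * u z - 1) < 1"
    unfolding eventually_at_top_linorder by blast
  define Z where "Z = max Z' 1"
  have Z: "Z > 0" and u_nz: "u z \<noteq> 0" if "z \<ge> Z" for z
    using Z'[of z] that by (auto simp: Z_def)
  have "((\<lambda>z. d z / u z) has_vector_derivative 0) (at z within {Z..})" if z: "z \<in> {Z..}" for z
  proof -
    have z': "z > 0" using z Z[of Z] by auto
    have nz: "u z \<noteq> 0" using u_nz z by auto
    have "p z \<noteq> 0" using z' by (simp add: p_def)
    hence W2: "d' z * u z - d z * u' z = 0" using W[OF z'] W0 by (simp add: w_def)
    have "((\<lambda>z. inverse (u z)) has_vector_derivative u' z * (- (inverse (u z) * 1 * inverse (u z)))) (at z)"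
      using field_vector_diff_chain_at[OF du[OF z'], of inverse "- (inverse (u z) * 1 * inverse (u z))"] DERIV_inverse'[OF DERIV_ident nz] 
      by (simp add: o_def)
    from has_vector_derivative_mult[OF dd[OF z'] this]
    have "((\<lambda>z. d z * inverse (u z)) has_vector_derivative (d' z * u z - d z * u' z) * (inverse (u z) * inverse (u z))) (at z)"
      by (rule has_vector_derivative_eq_rhs) (use nz in \<open>simp add: field_simps\<close>)
    thus ?thesis unfolding W2 by (simp add: divide_inverse has_vector_derivative_at_within)
  qed
  then obtain \<kappa> where "\<And>z. z \<in> {Z..} \<Longrightarrow> d z / u z = \<kappa>"
    using has_vector_derivative_zero_constant[of "{Z..}" "\<lambda>z. d z / u z"] by (metis convex_real_interval(1))
  hence \<kappa>: "d z / u z = \<kappa>" if "z \<ge> Z" for z using that by simp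
  have "d z = \<kappa> * u z" if "z \<ge> Z" for z using \<kappa>[OF that] u_nz[OF that] by (simp add: field_simps)
  note d\<kappa> = this
  have "((\<lambda>z. \<kappa> * (of_real z powr a * u z)) \<longlongrightarrow> \<kappa> * 1) at_top" by (intro tendsto_intros lu)
  hence "((\<lambda>z. of_real z powr a * d z) \<longlongrightarrow> \<kappa> * 1) at_top"
    by (rule Lim_transform_eventually) (auto intro!: eventually_mono[OF eventually_ge_at_top[of Z]] simp: d\<kappa>)
  from tendsto_unique[OF _ this ld] have "\<kappa> = 0" by simp
  hence "d z0 = 0" using d\<kappa> by (intro kummer_solution_zero[OF d Z _ z0]) auto
  thus ?thesis by (simp add: d_def)
qed

lemma asymp_equiv_powr_iff:
  "(f \<sim>[at_top] (\<lambda>z. of_real z powr (- a))) \<longleftrightarrow> ((\<lambda>z. of_real z powr a * f z) \<longlongrightarrow> (1::complex)) at_top"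
proof -
  have "\<forall>\<^sub>F z in at_top. (if f z = 0 \<and> of_real z powr (- a) = 0 then 1 else f z / of_real z powr (- a)) = of_real z powr a * f z"
    using eventually_gt_at_top[of 0] by eventually_elim (auto simp: powr_minus field_simps)
  thus ?thesis unfolding asymp_equiv_def by (rule tendsto_cong)
qed

lemma Tricomi_U_eqI:
  assumes u: "kummer_solution a c u u' u''"
    and lu: "((\<lambda>z. of_real z powr a * u z) \<longlongrightarrow> 1) at_top" and lu': "((\<lambda>z. of_real z powr a * u' z) \<longlongrightarrow> 0) at_top"
    and z: "z > 0"
  shows "Tricomi_U a c z = u z"
proof -
  define f where "f = (\<lambda>z. if z > 0 then u z else 0)"
  have "(f has_vector_derivative u' x) (at x)" if "x > 0" for x
    by (rule has_vector_derivative_transform_within_open[of u _ _ "{0<..}"])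
       (use u that in \<open>auto simp: f_def kummer_solution_def\<close>)
  moreover have "of_real x * u'' x + (c - of_real x) * u' x - a * f x = 0" "(u' has_vector_derivative u'' x) (at x)" if "x > 0" for x
    using u that by (auto simp: f_def kummer_solution_def)
  moreover have "((\<lambda>z. of_real z powr a * f z) \<longlongrightarrow> 1) at_top"
    by (rule Lim_transform_eventually[OF lu]) (auto intro!: eventually_mono[OF eventually_gt_at_top[of 0]] simp: f_def)
  ultimately have f: "is_Tricomi_U a c f"
    unfolding is_Tricomi_U_def asymp_equiv_powr_iff
    by (intro conjI exI[of _ u'] exI[of _ u'']) (auto simp: f_def)
  have "g = f" if "is_Tricomi_U a c g" for g
  proof
    fix x :: real
    obtain g' g'' where g: "kummer_solution a c g g' g''" and lg: "((\<lambda>z. of_real z powr a * g z) \<longlongrightarrow> 1) at_top"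
      and g0: "\<And>z. z \<le> 0 \<Longrightarrow> g z = 0"
      using \<open>is_Tricomi_U a c g\<close> unfolding is_Tricomi_U_def asymp_equiv_powr_iff kummer_solution_def by blast
    show "g x = f x" using kummer_solution_unique[OF u g lu lu' lg, of x] g0[of x] by (auto simp: f_def)
  qed
  hence "Tricomi_U a c = f" unfolding Tricomi_U_def using f by (intro the_equality)
  thus ?thesis using z by (simp add: f_def)
qed

context tricomi
begin

lemma Tricomi_U_eq_f:
  assumes "z > 0"
  shows "Tricomi_U a (1 + of_nat m) z = f m z"
proof (rule Tricomi_U_eqI[where u' = "\<lambda>z. f m z - f (Suc m) z" and u'' = "\<lambda>z. (f m z - f (Suc m) z) - (f (Suc m) z - f (Suc (Suc m)) z)"])
  show "kummer_solution a (1 + of_nat m) (f m) (\<lambda>z. f m z - f (Suc m) z) (\<lambda>z. (f m z - f (Suc m) z) - (f (Suc m) z - f (Suc (Suc m)) z))"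
    unfolding kummer_solution_def
  proof (intro allI impI conjI)
    fix z :: real assume z: "z > 0"
    have "of_real z * ((f m z - f (Suc m) z) - (f (Suc m) z - f (Suc (Suc m)) z)) + (1 + of_nat m - of_real z) * (f m z - f (Suc m) z) - a * f m z = 
      of_real z * f m z - 2 * of_real z * f (Suc m) z + of_real z * f (Suc (Suc m)) z + (1 + of_nat m - of_real z) * (f m z - f (Suc m) z) - a * f m z"
      by (simp only: algebra_simps mult_2)
    also have "\<dots> = 0" unfolding f_rec[OF z] of_nat_Suc by (simp only: algebra_simps mult_2) (simp add: algebra_simps)
    finally show "of_real z * ((f m z - f (Suc m) z) - (f (Suc m) z - f (Suc (Suc m)) z)) + (1 + of_nat m - of_real z) * (f m z - f (Suc m) z) - a * f m z = 0" .
  qed (intro has_vector_derivative_diff f_deriv; assumption)+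
  show "((\<lambda>z. of_real z powr a * (f m z - f (Suc m) z)) \<longlongrightarrow> 0) at_top"
    using tendsto_diff[OF f_asymp[of m] f_asymp[of "Suc m"]] by (simp add: right_diff_distrib)
qed (use assms f_asymp in auto)

text \<open>Kummer's transformation: \<open>z ^ m * f m z\<close> solves the equation with the parameters \<open>a - m\<close> and \<open>1 - m\<close>,
  and its leading term at infinity is the right one.\<close>
lemma Tricomi_U_eq_f_neg:
  assumes "z > 0"
  shows "Tricomi_U (a - of_nat m) (1 - of_nat m) z = of_real z ^ m * f m z"
proof -
  define n :: complex where "n = of_nat m"
  define D where "D = (\<lambda>z. f m z - f (Suc m) z)"
  define D2 where "D2 = (\<lambda>z. (f m z - f (Suc m) z) - (f (Suc m) z - f (Suc (Suc m)) z))"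
  define r :: "real \<Rightarrow> complex" where "r = (\<lambda>z. n / of_real z)"
  define y' where "y' = (\<lambda>z. of_real z ^ m * (r z * f m z + D z))"
  define y'' where "y'' = (\<lambda>z. of_real z ^ m * (r z * (r z * f m z + D z) + ((r z * D z - r z / of_real z * f m z) + D2 z)))"
  have p: "((\<lambda>z. of_real z ^ m :: complex) has_vector_derivative of_real z ^ m * r z) (at z)" if "z > 0" for z
  proof -
    have "((\<lambda>z. of_real z ^ m :: complex) has_vector_derivative of_nat m * of_real z ^ (m - 1)) (at z)"
      by (rule has_vector_derivative_real_field, rule DERIV_cong[OF DERIV_power[OF DERIV_ident]]) simp
    thus ?thesis by (rule has_vector_derivative_eq_rhs) (use that in \<open>cases m; simp add: r_def n_def\<close>)
  qed
  have r': "(r has_vector_derivative - (r z / of_real z)) (at z)" if "z > 0" for z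
    unfolding r_def by (rule has_vector_derivative_real_field)
       (use that in \<open>auto intro!: derivative_eq_intros simp: power2_eq_square\<close>)
  have D': "(D has_vector_derivative D2 z) (at z)" if "z > 0" for z
    unfolding D_def D2_def by (intro has_vector_derivative_diff f_deriv that)
  have fD: "(f m has_vector_derivative D z) (at z)" if "z > 0" for z
    unfolding D_def by (intro f_deriv that)
  have ode: "of_real z * D2 z + (1 + n - of_real z) * D z - a * f m z = 0" if z: "z > 0" for z
  proof -
    have "of_real z * D2 z + (1 + n - of_real z) * D z - a * f m z = 
      of_real z * f m z - 2 * of_real z * f (Suc m) z + of_real z * f (Suc (Suc m)) z + (1 + of_nat m - of_real z) * (f m z - f (Suc m) z) - a * f m z"
      unfolding D_def D2_def n_def by (simp only: algebra_simps mult_2)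
    also have "\<dots> = 0" unfolding f_rec[OF z] of_nat_Suc by (simp only: algebra_simps mult_2) (simp add: algebra_simps)
    finally show ?thesis .
  qed
  show ?thesis
  proof (rule Tricomi_U_eqI[where u' = y' and u'' = y''])
    show "kummer_solution (a - of_nat m) (1 - of_nat m) (\<lambda>z. of_real z ^ m * f m z) y' y''"
      unfolding kummer_solution_def
    proof (intro allI impI conjI)
      fix z :: real assume z: "z > 0"
      show "((\<lambda>z. of_real z ^ m * f m z) has_vector_derivative y' z) (at z)"
        by (rule has_vector_derivative_eq_rhs[OF has_vector_derivative_mult[OF p[OF z] fD[OF z]]])
           (simp add: y'_def algebra_simps)
      have "((\<lambda>z. r z * f m z + D z) has_vector_derivative (r z * D z + - (r z / of_real z) * f m z) + D2 z) (at z)"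
        by (intro has_vector_derivative_add has_vector_derivative_mult r' fD D' z)
      from has_vector_derivative_mult[OF p[OF z] this]
      show "(y' has_vector_derivative y'' z) (at z)"
        unfolding y'_def by (rule has_vector_derivative_eq_rhs) (simp add: y''_def algebra_simps)
      have zr: "of_real z * r z = n" using z by (simp add: r_def)
      have zrz: "of_real z * (r z / of_real z) = r z" using z by simp
      have "of_real z * y'' z + (1 - of_nat m - of_real z) * y' z - (a - of_nat m) * (of_real z ^ m * f m z) =
        of_real z ^ m * ((of_real z * r z) * (r z * f m z + D z) + ((of_real z * r z) * D z - of_real z * (r z / of_real z) * f m z) + of_real z * D2 z
         + (1 - n) * (r z * f m z + D z) - (of_real z * r z) * f m z - of_real z * D z - (a - n) * f m z)"
        unfolding y''_def y'_def n_def by (simp only: algebra_simps)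
      also have "\<dots> = of_real z ^ m * (of_real z * D2 z + (1 + n - of_real z) * D z - a * f m z)"
        unfolding zr zrz by (simp add: algebra_simps)
      also have "\<dots> = 0" unfolding ode[OF z] by simp
      finally show "of_real z * y'' z + (1 - of_nat m - of_real z) * y' z - (a - of_nat m) * (of_real z ^ m * f m z) = 0" .
    qed
    have pw: "of_real z powr (a - of_nat m) * (of_real z ^ m * X) = of_real z powr a * X" if "z > 0" for z X
      using that by (simp add: powr_diff powr_nat)
    show "((\<lambda>z. of_real z powr (a - of_nat m) * (of_real z ^ m * f m z)) \<longlongrightarrow> 1) at_top"
      by (rule Lim_transform_eventually[OF f_asymp[of m]]) (intro eventually_mono[OF eventually_gt_at_top[of 0]] pw[symmetric])
    have "((\<lambda>z. n * inverse (of_real z) * (of_real z powr a * f m z) + (of_real z powr a * f m z - of_real z powr a * f (Suc m) z)) \<longlongrightarrow> n * 0 * 1 + (1 - 1)) at_top"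
      by (intro tendsto_add tendsto_mult tendsto_diff f_asymp tendsto_const inverse_of_real_tendsto_0)
    hence "((\<lambda>z. n * inverse (of_real z) * (of_real z powr a * f m z) + (of_real z powr a * f m z - of_real z powr a * f (Suc m) z)) \<longlongrightarrow> 0) at_top"
      by simp
    thus "((\<lambda>z. of_real z powr (a - of_nat m) * y' z) \<longlongrightarrow> 0) at_top"
      by (rule Lim_transform_eventually)
         (intro eventually_mono[OF eventually_gt_at_top[of 0]], unfold y'_def, simp only: pw, simp add: r_def D_def divide_inverse algebra_simps)
  qed (rule assms)
qed

end

section \<open>Generalized integrals of products\<close>

lemma polar_integrable_Suc:
  assumes "polar_integrable N g"
  shows "polar_integrable (Suc N) g"
proof -
  obtain d K where 1: "\<And>z. z \<in> {0<..1} \<Longrightarrow> norm (g z - (polar_sum N d z)) \<le> K * z powr (-1/2)"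
    using assms unfolding polar_integrable_def by blast
  have "(\<Sum>k=1..Suc N. (if k = Suc N then 0 else d k) / of_real z ^ k) = (polar_sum N d z)" for z :: real
    by (auto intro!: sum.cong)
  with 1 show ?thesis unfolding polar_integrable_def
    by (intro exI[of _ "\<lambda>k. if k = Suc N then 0 else d k"] exI[of _ K]) simp
qed

lemma polar_integrable_mult:
  assumes "polar_integrable N g"
  shows "polar_integrable N (\<lambda>z. c * g z)"
proof -
  obtain d K where 1: "\<And>z. z \<in> {0<..1} \<Longrightarrow> norm (g z - (polar_sum N d z)) \<le> K * z powr (-1/2)"
    using assms unfolding polar_integrable_def by blast
  have "norm (c * g z - (\<Sum>k=1..N. c * d k / of_real z ^ k)) \<le> norm c * K * z powr (-1/2)" if "z \<in> {0<..1}" for z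
  proof -
    have "c * g z - (\<Sum>k=1..N. c * d k / of_real z ^ k) = c * (g z - (polar_sum N d z))"
      by (simp add: right_diff_distrib sum_distrib_left)
    thus ?thesis using mult_left_mono[OF 1[OF that], of "norm c"] by (simp add: norm_mult mult.assoc)
  qed
  thus ?thesis unfolding polar_integrable_def
    by (intro exI[of _ "\<lambda>k. c * d k"] exI[of _ "norm c * K"]) blast
qed

lemma has_finite_part_Suc:
  assumes "has_finite_part N g \<beta>"
  shows "has_finite_part (Suc N) g \<beta>"
proof -
  obtain b l where 1: "((\<lambda>z. g z - ((polar_sum N b z) + l * of_real (ln z))) \<longlongrightarrow> \<beta>) (at_right 0)"
    using assms unfolding has_finite_part_def by blast
  have "(\<Sum>k=1..Suc N. (if k = Suc N then 0 else b k) / of_real z ^ k) = (polar_sum N b z)" for z :: real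
    by (auto intro!: sum.cong)
  with 1 show ?thesis unfolding has_finite_part_def
    by (intro exI[of _ "\<lambda>k. if k = Suc N then 0 else b k"] exI[of _ l]) simp
qed

lemma has_finite_part_diff:
  assumes "has_finite_part N f \<beta>" "has_finite_part N g \<gamma>"
  shows "has_finite_part N (\<lambda>z. f z - g z) (\<beta> - \<gamma>)"
proof -
  obtain b l where 1: "((\<lambda>z. f z - ((polar_sum N b z) + l * of_real (ln z))) \<longlongrightarrow> \<beta>) (at_right 0)"
    using assms(1) unfolding has_finite_part_def by blast
  obtain b' l' where 2: "((\<lambda>z. g z - ((polar_sum N b' z) + l' * of_real (ln z))) \<longlongrightarrow> \<gamma>) (at_right 0)"
    using assms(2) unfolding has_finite_part_def by blast
  show ?thesis unfolding has_finite_part_def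
    by (intro exI[of _ "\<lambda>k. b k - b' k"] exI[of _ "l - l'"])
       (use tendsto_diff[OF 1 2] in \<open>simp add: algebra_simps diff_divide_distrib sum_subtractf\<close>)
qed

lemma has_gen_integral_deriv':
  assumes P: "\<And>z. z > 0 \<Longrightarrow> (P has_vector_derivative P' z) (at z)"
    and cont: "continuous_on {0<..} P'"
    and int1: "P' absolutely_integrable_on {1<..}"
    and top: "(P \<longlongrightarrow> 0) at_top"
    and pi: "polar_integrable N P'" and fp: "has_finite_part N P \<beta>"
  shows "has_gen_integral P' (- \<beta>)"
proof -
  obtain d where d: "(\<lambda>z. P' z - (polar_sum N d z)) absolutely_integrable_on {0<..<1}"
    by (rule polar_integrable_imp_absolutely_integrable[OF pi cont])
  obtain b l where "((\<lambda>z. P z - ((polar_sum N b z) + l * of_real (ln z))) \<longlongrightarrow> \<beta>) (at_right 0)"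
    using fp unfolding has_finite_part_def by blast
  from has_gen_integral_deriv[OF P cont int1 top d this] show ?thesis .
qed

lemma continuous_decaying_bounded:
  fixes h :: "real \<Rightarrow> complex"
  assumes cont: "continuous_on {1..} h" and lim: "(h \<longlongrightarrow> 0) at_top"
  obtains K where "\<And>z. z \<ge> 1 \<Longrightarrow> norm (h z) \<le> K"
proof -
  obtain Z where Z: "\<And>z. z \<ge> Z \<Longrightarrow> norm (h z) < 1"
    using tendstoD[OF lim zero_less_one] unfolding eventually_at_top_linorder by auto
  have "compact (h ` {1..Z})"
    by (intro compact_continuous_image continuous_on_subset[OF cont]) auto
  then obtain B where B: "\<And>z. z \<in> {1..Z} \<Longrightarrow> norm (h z) \<le> B"
    using compact_imp_bounded[of "h ` {1..Z}"] unfolding bounded_iff by blast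
  have "norm (h z) \<le> max 1 B" if "z \<ge> 1" for z
    using Z[of z] B[of z] that by (cases "z \<ge> Z") auto
  thus ?thesis by (rule that)
qed

text \<open>The boundary term at \<open>0\<close> in the integration by parts that raises \<open>m\<close>: the product of the leading
  coefficient of \<open>U(a; m + 2; z)\<close> with the constant term of the other factor, and the products of matching polar coefficients.\<close>
definition gen_bdry :: "complex \<Rightarrow> complex \<Rightarrow> nat \<Rightarrow> complex" where
  "gen_bdry a b m = fact m * rGamma a * tricomi_const b m +
     rGamma a * rGamma b * (\<Sum>j<m. pochhammer (of_nat (j + 2) - a) (m - j) * pochhammer (1 - b) j / of_nat (m - j))"

locale two_tricomi = A: tricomi a u v + B: tricomi b w x
  for a b :: complex and u v w x :: "real \<Rightarrow> complex"
begin

definition prod_fun :: "nat \<Rightarrow> nat \<Rightarrow> nat \<Rightarrow> real \<Rightarrow> complex" where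
  "prod_fun n i j z = of_real z ^ n * A.f i z * B.g j z"

lemma prod_fun_continuous: "continuous_on {0<..} (prod_fun n i j)"
  unfolding prod_fun_def by (intro continuous_intros A.f_continuous B.f_continuous)

lemma prod_fun_decay: "((\<lambda>z. of_real (exp (z / 2)) * prod_fun n i j z) \<longlongrightarrow> 0) at_top"
proof -
  define e where "e = (\<lambda>z. of_real (exp (z / 2)) * of_real (exp (- z)) * of_real z ^ n * of_real z powr (- a) * of_real z powr (- b) :: complex)"
  have e0: "(e \<longlongrightarrow> 0) at_top"
  proof (rule Lim_null_comparison)
    show "\<forall>\<^sub>F z in at_top. norm (e z) \<le> exp (z / 2) * exp (- z) * z ^ n * z powr (- Re a) * z powr (- Re b)"
      using eventually_gt_at_top[of 0]
    proof eventually_elim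
      case (elim z)
      thus ?case using norm_of_real_powr[OF elim, of "- a"] norm_of_real_powr[OF elim, of "- b"]
        by (simp add: e_def norm_mult norm_power)
    qed
    show "((\<lambda>z. exp (z / 2) * exp (- z) * z ^ n * z powr (- Re a) * z powr (- Re b)) \<longlongrightarrow> 0) at_top"
      by real_asymp
  qed
  have "((\<lambda>z. e z * (of_real z powr a * A.f i z) * (of_real z powr b * B.f j z)) \<longlongrightarrow> 0 * 1 * 1) at_top"
    by (intro tendsto_mult e0 A.f_asymp B.f_asymp)
  hence lim: "((\<lambda>z. e z * (of_real z powr a * A.f i z) * (of_real z powr b * B.f j z)) \<longlongrightarrow> 0) at_top" by simp
  show ?thesis
  proof (rule Lim_transform_eventually[OF lim], rule eventually_mono[OF eventually_gt_at_top[of 0]])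
    fix z :: real assume z: "z > 0"
    have 1: "of_real z powr (- a) * of_real z powr a = (1::complex)" "of_real z powr (- b) * of_real z powr b = (1::complex)"
      using z by (simp_all flip: powr_add)
    have "e z * (of_real z powr a * A.f i z) * (of_real z powr b * B.f j z) = 
      (of_real z powr (- a) * of_real z powr a) * (of_real z powr (- b) * of_real z powr b) * (of_real (exp (z / 2)) * prod_fun n i j z)"
      unfolding e_def prod_fun_def by (simp only: mult_ac)
    thus "e z * (of_real z powr a * A.f i z) * (of_real z powr b * B.f j z) = of_real (exp (z / 2)) * prod_fun n i j z"
      unfolding 1 by simp
  qed
qed

lemma prod_fun_tendsto_0: "(prod_fun n i j \<longlongrightarrow> 0) at_top"
proof -
  have e: "((\<lambda>z. of_real (exp (- z / 2)) :: complex) \<longlongrightarrow> of_real 0) at_top"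
    by (intro tendsto_of_real) real_asymp
  have lim: "((\<lambda>z. of_real (exp (- z / 2)) * (of_real (exp (z / 2)) * prod_fun n i j z)) \<longlongrightarrow> of_real 0 * 0) at_top"
    by (rule tendsto_mult[OF e prod_fun_decay])
  have cancel: "of_real (exp (- z / 2)) * (of_real (exp (z / 2)) * X) = (X :: complex)" for z X
    by (simp flip: mult.assoc of_real_mult exp_add)
  show ?thesis using lim unfolding cancel by simp
qed

lemma prod_fun_integrable_Ioi: "prod_fun n i j absolutely_integrable_on {1<..}"
proof -
  have "continuous_on {1..} (\<lambda>z. of_real (exp (z / 2)) * prod_fun n i j z)"
    by (intro continuous_intros continuous_on_subset[OF prod_fun_continuous]) auto
  then obtain K where K: "\<And>z. z \<ge> 1 \<Longrightarrow> norm (of_real (exp (z / 2)) * prod_fun n i j z) \<le> K"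
    using continuous_decaying_bounded prod_fun_decay by blast
  have "prod_fun n i j absolutely_integrable_on {1..}"
  proof (rule continuous_bounded_imp_absolutely_integrable)
    show "(\<lambda>z. K * exp (- (1/2) * z)) integrable_on {1..}"
      using has_integral_exp_minus_to_infinity[of "1/2" 1] by (intro integrable_on_mult_right) auto
    fix z :: real assume z: "z \<in> {1..}"
    have "norm (prod_fun n i j z) = exp (- (1/2) * z) * norm (of_real (exp (z / 2)) * prod_fun n i j z)"
      by (simp add: norm_mult flip: mult.assoc exp_add)
    also have "\<dots> \<le> exp (- (1/2) * z) * K" using z by (intro mult_left_mono K) auto
    finally show "norm (prod_fun n i j z) \<le> K * exp (- (1/2) * z)" by (simp add: mult_ac)
  qed (auto intro!: continuous_on_subset[OF prod_fun_continuous])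
  thus ?thesis by (rule set_integrable_subset) auto
qed

lemma prod_fun_polar: "polar_integrable m (prod_fun m m m)"
proof -
  obtain L M where f: "polar_expansion m (\<lambda>k. fact (k - 1) * pochhammer (of_nat (Suc k) - a) (m - k) / fact (m - k) * rGamma a) L M (A.f m)"
    using A.f_expansion by blast
  show ?thesis unfolding prod_fun_def
    by (rule polar_integrable_product[OF f A.f_continuous B.g_expansion B.g_continuous])
qed

lemma bdry_finite_part: "has_finite_part m (prod_fun (Suc m) (Suc m) m) (gen_bdry a b m)"
proof -
  define c where "c = (\<lambda>k. fact (k - 1) * pochhammer (of_nat (Suc k) - a) (Suc m - k) / fact (Suc m - k) * rGamma a)"
  define q where "q = (\<lambda>k. fact (k - 1) * pochhammer (1 - b) (m - k) / fact (m - k) * rGamma b)"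
  obtain L M where f: "polar_expansion (Suc m) c L M (A.f (Suc m))"
    using A.f_expansion[of "Suc m"] unfolding c_def by blast
  have "has_finite_part m (prod_fun (Suc m) (Suc m) m) (c (Suc m) * tricomi_const b m + (\<Sum>k=1..m. c (Suc m - k) * q k))"
    unfolding prod_fun_def by (rule has_finite_part_product[OF f B.g_expansion[of m, folded q_def]])
  also have "(\<Sum>k=1..m. c (Suc m - k) * q k) = (\<Sum>k=1..m. rGamma a * rGamma b * (pochhammer (of_nat (m - k + 2) - a) (m - (m - k)) * pochhammer (1 - b) (m - k) / of_nat (m - (m - k))))"
  proof (rule sum.cong[OF refl])
    fix k assume k: "k \<in> {1..m}"
    have k1: "Suc m - k - 1 = m - k" "Suc m - (Suc m - k) = k" "m - (m - k) = k" "Suc (Suc m - k) = m - k + 2" using k by auto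
    have "fact k = (of_nat k * fact (k - 1) :: complex)" using k by (cases k) simp_all
    moreover have "of_nat k \<noteq> (0::complex)" using k by auto
    ultimately show "c (Suc m - k) * q k = rGamma a * rGamma b * (pochhammer (of_nat (m - k + 2) - a) (m - (m - k)) * pochhammer (1 - b) (m - k) / of_nat (m - (m - k)))"
      unfolding c_def q_def k1 by (simp add: divide_simps)
  qed
  also have "\<dots> = rGamma a * rGamma b * (\<Sum>j<m. pochhammer (of_nat (j + 2) - a) (m - j) * pochhammer (1 - b) j / of_nat (m - j))"
    unfolding sum_distrib_left by (rule sum.reindex_bij_witness[of _ "\<lambda>j. m - j" "\<lambda>k. m - k"]) auto
  also have "c (Suc m) * tricomi_const b m = fact m * rGamma a * tricomi_const b m"
    by (simp add: c_def)
  finally show ?thesis unfolding gen_bdry_def .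
qed

text \<open>Integration by parts: \<open>exp (- z) * U(b; m + 1; z)\<close> is a primitive of
  \<open>- exp (- z) * U(b; m + 2; z)\<close>, and \<open>z ^ (m + 1) * U(a; m + 2; z)\<close> one of \<open>(m + 1 - a) * z ^ m * U(a; m + 1; z)\<close>.\<close>
lemma has_gen_integral_Suc:
  assumes "has_gen_integral (prod_fun m m m) J"
  shows "has_gen_integral (prod_fun (Suc m) (Suc m) (Suc m)) ((of_nat (Suc m) - a) * J + gen_bdry a b m)"
proof -
  define P' where "P' = (\<lambda>z. (of_nat (Suc m) - a) * prod_fun m m m z - prod_fun (Suc m) (Suc m) (Suc m) z)"
  have P: "(prod_fun (Suc m) (Suc m) m has_vector_derivative P' z) (at z)" if z: "z > 0" for z
  proof -
    have "((\<lambda>z. (of_real z ^ Suc m * A.f (Suc m) z) * B.g m z) has_vector_derivative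
       (of_real z ^ Suc m * A.f (Suc m) z) * (- B.g (Suc m) z) + (of_real z ^ m * ((of_nat (Suc m) - a) * A.f m z)) * B.g m z) (at z)"
      by (rule has_vector_derivative_mult[OF A.f_primitive[OF z] B.g_deriv[OF z]])
    moreover have "(of_real z ^ Suc m * A.f (Suc m) z) * (- B.g (Suc m) z) + (of_real z ^ m * ((of_nat (Suc m) - a) * A.f m z)) * B.g m z = P' z"
      unfolding P'_def prod_fun_def by (simp add: mult_ac del: of_nat_Suc tricomi_seq.simps)
    ultimately show ?thesis unfolding prod_fun_def by simp
  qed
  have cont: "continuous_on {0<..} P'" unfolding P'_def by (intro continuous_intros prod_fun_continuous)
  have int: "P' absolutely_integrable_on {1<..}"
    unfolding P'_def by (intro set_integral_diff set_integrable_mult_right prod_fun_integrable_Ioi)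
  have "polar_integrable (Suc m) (\<lambda>z. (of_nat (Suc m) - a) * prod_fun m m m z + (- 1) * prod_fun (Suc m) (Suc m) (Suc m) z)"
    by (intro polar_integrable_add polar_integrable_mult polar_integrable_Suc prod_fun_polar)
  hence pi: "polar_integrable (Suc m) P'" by (simp add: P'_def)
  have "has_gen_integral P' (- gen_bdry a b m)"
    by (rule has_gen_integral_deriv'[OF P cont int prod_fun_tendsto_0 pi has_finite_part_Suc[OF bdry_finite_part]])
  from has_gen_integral_linear[OF assms this, of "of_nat (Suc m) - a" "- 1"]
  have "has_gen_integral (\<lambda>z. (of_nat (Suc m) - a) * prod_fun m m m z + - 1 * P' z) ((of_nat (Suc m) - a) * J + gen_bdry a b m)" by simp
  thus ?thesis by (rule has_gen_integral_cong[rotated]) (simp add: P'_def)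
qed

text \<open>The Wronskian of two solutions, whose derivative is \<open>(a - b)\<close> times the integrand.\<close>
lemma has_gen_integral_0:
  assumes "a \<noteq> b"
  shows "has_gen_integral (prod_fun 0 0 0) ((rGamma a * deriv rGamma b - deriv rGamma a * rGamma b) / (a - b))"
proof -
  interpret BA: two_tricomi b a w x u v by unfold_locales
  define P where "P = (\<lambda>z. BA.prod_fun (Suc 0) (Suc 0) 0 z - prod_fun (Suc 0) (Suc 0) 0 z)"
  define \<beta> where "\<beta> = rGamma b * (deriv rGamma a - 2 * euler_mascheroni * rGamma a) - rGamma a * (deriv rGamma b - 2 * euler_mascheroni * rGamma b)"
  have fp: "has_finite_part 0 P \<beta>"
    using has_finite_part_diff[OF BA.bdry_finite_part[of 0] bdry_finite_part[of 0]]
    unfolding P_def \<beta>_def by (simp add: gen_bdry_def)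
  have P: "(P has_vector_derivative (a - b) * prod_fun 0 0 0 z) (at z)" if z: "z > 0" for z
  proof -
    have "((\<lambda>z. (of_real z ^ Suc 0 * B.f (Suc 0) z) * A.g 0 z - (of_real z ^ Suc 0 * A.f (Suc 0) z) * B.g 0 z) has_vector_derivative
       ((of_real z ^ Suc 0 * B.f (Suc 0) z) * (- A.g (Suc 0) z) + (of_real z ^ 0 * ((of_nat (Suc 0) - b) * B.f 0 z)) * A.g 0 z)
       - ((of_real z ^ Suc 0 * A.f (Suc 0) z) * (- B.g (Suc 0) z) + (of_real z ^ 0 * ((of_nat (Suc 0) - a) * A.f 0 z)) * B.g 0 z)) (at z)"
      by (intro has_vector_derivative_diff has_vector_derivative_mult A.f_primitive[OF z] B.f_primitive[OF z] A.g_deriv[OF z] B.g_deriv[OF z])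
    moreover have "(\<lambda>z. (of_real z ^ Suc 0 * B.f (Suc 0) z) * A.g 0 z - (of_real z ^ Suc 0 * A.f (Suc 0) z) * B.g 0 z) = P"
      by (simp add: P_def prod_fun_def BA.prod_fun_def fun_eq_iff)
    moreover have "((of_real z ^ Suc 0 * B.f (Suc 0) z) * (- A.g (Suc 0) z) + (of_real z ^ 0 * ((of_nat (Suc 0) - b) * B.f 0 z)) * A.g 0 z)
       - ((of_real z ^ Suc 0 * A.f (Suc 0) z) * (- B.g (Suc 0) z) + (of_real z ^ 0 * ((of_nat (Suc 0) - a) * A.f 0 z)) * B.g 0 z) = (a - b) * prod_fun 0 0 0 z"
      by (simp add: prod_fun_def algebra_simps)
    ultimately show ?thesis by simp
  qed
  have top: "(P \<longlongrightarrow> 0) at_top"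
    using tendsto_diff[OF BA.prod_fun_tendsto_0 prod_fun_tendsto_0] unfolding P_def by simp
  have "has_gen_integral (\<lambda>z. (a - b) * prod_fun 0 0 0 z) (- \<beta>)"
  proof (rule has_gen_integral_deriv'[OF P _ _ top _ fp])
    show "continuous_on {0<..} (\<lambda>z. (a - b) * prod_fun 0 0 0 z)"
      by (intro continuous_intros prod_fun_continuous)
    show "(\<lambda>z. (a - b) * prod_fun 0 0 0 z) absolutely_integrable_on {1<..}"
      by (intro set_integrable_mult_right prod_fun_integrable_Ioi)
    show "polar_integrable 0 (\<lambda>z. (a - b) * prod_fun 0 0 0 z)"
      by (intro polar_integrable_mult prod_fun_polar)
  qed
  from has_gen_integral_linear[OF this this, of "1 / (a - b)" 0]
  have "has_gen_integral (prod_fun 0 0 0) (- \<beta> / (a - b))" using assms by simp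
  also have "- \<beta> = rGamma a * deriv rGamma b - deriv rGamma a * rGamma b" by (simp add: \<beta>_def algebra_simps)
  finally show ?thesis .
qed

end

section \<open>The square integral for second parameter one\<close>

lemma has_gen_integral_of_absolutely_integrable:
  assumes f: "f absolutely_integrable_on {0<..}"
  shows "has_gen_integral f (integral {0<..} f)"
proof -
  have 1: "f absolutely_integrable_on {0<..<1}" and 2: "f absolutely_integrable_on {1<..}"
    by (rule set_integrable_subset[OF f]; auto)+
  note i = set_lebesgue_integral_eq_integral
  have "(f has_integral (integral {0<..<1} f + integral {1<..} f)) ({0<..<1} \<union> {1<..})"
  proof (intro has_integral_Un integrable_integral i(1) 1 2)
    have "{0<..<1} \<inter> {1<..} = ({} :: real set)" by auto
    thus "negligible ({0<..<1} \<inter> {1<..} :: real set)" by simp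
  qed
  also have "(f has_integral (integral {0<..<1} f + integral {1<..} f)) ({0<..<1} \<union> {1<..}) \<longleftrightarrow>
     (f has_integral (integral {0<..<1} f + integral {1<..} f)) {0<..}"
    by (intro has_integral_spike_set_eq; rule negligible_subset[of "{1}"]; auto)
  finally have "integral {0<..} f = integral {0<..<1} f + integral {1<..} f" by (rule integral_unique)
  with 1 2 show ?thesis unfolding has_gen_integral_def
    by (intro conjI exI[of _ "{}"]) (simp_all add: i(2))
qed

lemma tri_u_tendsto:
  assumes a: "Re a > 2" and z: "z > 0"
  shows "(\<lambda>n. tri_u (a + of_real (1 / real (Suc n))) z) \<longlonglongrightarrow> tri_u a z"
proof -
  define b where "b = (\<lambda>n. a + complex_of_real (1 / real (Suc n)))"
  have b: "Re (b n) > 2" for n using a by (simp add: b_def add_pos_pos) (smt (verit) divide_nonneg_pos of_nat_0_le_iff zero_less_one)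
  have "(\<lambda>n. complex_of_real (1 / real (Suc n))) \<longlonglongrightarrow> of_real 0" by (intro tendsto_of_real) real_asymp
  from tendsto_add[OF tendsto_const[of a] this] have b_lim: "b \<longlonglongrightarrow> a" unfolding b_def by simp
  have R: "(\<lambda>n. rGamma (b n)) \<longlonglongrightarrow> rGamma a"
    using isCont_tendsto_compose[OF _ b_lim, of rGamma] by (simp add: isCont_rGamma)
  have "(\<lambda>n. integral {0<..} (\<lambda>t. of_real (exp (- z * t)) * kernel (b n) (- b n) t)) \<longlonglongrightarrow> integral {0<..} (\<lambda>t. of_real (exp (- z * t)) * kernel a (- a) t)"
  proof (rule dominated_convergence(2)[where h = "\<lambda>t. exp (- z * t) * t powr (1/4 - 1)"])
    show "(\<lambda>t. of_real (exp (- z * t)) * kernel (b n) (- b n) t) integrable_on {0<..}" for n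
      by (rule set_lebesgue_integral_eq_integral(1)[OF laplace_kernel_integrable]) (use b[of n] z in auto)
    show "(\<lambda>t. exp (- z * t) * t powr (1/4 - 1)) integrable_on {0<..}"
      using Gamma_integral_scaled_real[of "1/4" z] z by auto
    show "norm (of_real (exp (- z * t)) * kernel (b n) (- b n) t) \<le> exp (- z * t) * t powr (1/4 - 1)" if "t \<in> {0<..}" for n t
      using norm_kernel_bound[of "b n" t] b[of n] that by (simp add: norm_mult mult_left_mono)
    show "(\<lambda>n. of_real (exp (- z * t)) * kernel (b n) (- b n) t) \<longlonglongrightarrow> of_real (exp (- z * t)) * kernel a (- a) t" if "t \<in> {0<..}" for t
    proof -
      have np: "complex_of_real t \<notin> \<real>\<^sub>\<le>\<^sub>0" "complex_of_real (1 + t) \<notin> \<real>\<^sub>\<le>\<^sub>0"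
        using that by (auto simp: complex_nonpos_Reals_iff)
      show ?thesis unfolding kernel_def by (intro tendsto_intros b_lim disjI1 np)
    qed
  qed
  hence "(\<lambda>n. laplace_kernel (b n) (- b n) z) \<longlonglongrightarrow> laplace_kernel a (- a) z" unfolding laplace_kernel_def .
  from tendsto_mult[OF R this] show ?thesis unfolding tri_u_def b_def .
qed

definition square_val :: "complex \<Rightarrow> complex" where
  "square_val a = (deriv rGamma a)\<^sup>2 - rGamma a * deriv (deriv rGamma) a"

lemma deriv_rGamma_holomorphic: "deriv rGamma holomorphic_on (UNIV :: complex set)"
  by (intro holomorphic_deriv holomorphic_rGamma) auto

lemma DERIV_rGamma: "(rGamma has_field_derivative deriv rGamma w) (at (w :: complex))"
  using field_differentiable_rGamma[of w UNIV] by (simp add: field_differentiable_derivI)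

lemma DERIV_deriv_rGamma: "(deriv rGamma has_field_derivative deriv (deriv rGamma) w) (at (w :: complex))"
  using deriv_rGamma_holomorphic by (intro holomorphic_derivI[of _ UNIV]) auto

text \<open>The square as the limit of products with parameters \<open>a\<close> and \<open>b \<rightarrow> a\<close>, all of them dominated by a multiple of
  \<open>exp (- z) * z powr (-1/2)\<close>. The off-diagonal value is a difference quotient in \<open>b\<close>, because its
  numerator vanishes at \<open>b = a\<close>.\<close>
lemma tri_u_square_integral:
  assumes a: "Re a > 2"
  shows "has_gen_integral (\<lambda>z. tri_u a z * (of_real (exp (- z)) * tri_u a z)) (square_val a)"
proof -
  define b where "b = (\<lambda>n. a + complex_of_real (1 / real (Suc n)))"
  have b: "Re (b n) > 2" for n using a by (simp add: b_def add_pos_pos) (smt (verit) divide_nonneg_pos of_nat_0_le_iff zero_less_one)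
  have ba: "b n \<noteq> a" for n
  proof -
    have "complex_of_real (1 / real (Suc n)) \<noteq> 0" unfolding of_real_eq_0_iff by simp
    thus ?thesis unfolding b_def by (metis add_cancel_left_right)
  qed
  have "(\<lambda>n. complex_of_real (1 / real (Suc n))) \<longlonglongrightarrow> of_real 0" by (intro tendsto_of_real) real_asymp
  from tendsto_add[OF tendsto_const[of a] this] have b_lim: "b \<longlonglongrightarrow> a" unfolding b_def by simp
  define F where "F = (\<lambda>b z. tri_u a z * (of_real (exp (- z)) * tri_u b z))"
  define C where "C = (\<lambda>b::complex. norm (rGamma b) * Gamma (1/4))"
  have G0: "Gamma (1/4) \<ge> (0::real)" by (intro less_imp_le Gamma_real_pos) auto
  have F_bound: "norm (F b z) \<le> C a * C b * (exp (- 1 * z) * z powr (1/2 - 1))" if "Re b > 2" "z > 0" for b z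
  proof -
    have "norm (F b z) = exp (- z) * (norm (tri_u a z) * norm (tri_u b z))"
      by (simp add: F_def norm_mult)
    also have "\<dots> \<le> exp (- z) * ((C a * z powr (-1/4)) * (C b * z powr (-1/4)))"
      unfolding C_def using that a G0 by (intro mult_left_mono mult_mono tri_u_bound mult_nonneg_nonneg) auto
    also have "\<dots> = C a * C b * (exp (- z) * (z powr (-1/4) * z powr (-1/4)))" by simp
    also have "z powr (-1/4) * z powr (-1/4) = z powr (1/2 - 1)" by (simp flip: powr_add)
    finally show ?thesis by simp
  qed
  have int_e: "(\<lambda>z::real. exp (- 1 * z) * z powr (1/2 - 1)) integrable_on {0<..}"
    using Gamma_integral_scaled_real[of "1/2" 1] by auto
  have F_int: "F b absolutely_integrable_on {0<..}" if "Re b > 2" for b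
  proof (rule continuous_bounded_imp_absolutely_integrable)
    show "continuous_on {0<..} (F b)"
      unfolding F_def using that a by (intro continuous_intros tri_u_continuous) auto
    show "(\<lambda>z. C a * C b * (exp (- 1 * z) * z powr (1/2 - 1))) integrable_on {0<..}"
      by (intro integrable_on_mult_right int_e)
    show "norm (F b z) \<le> C a * C b * (exp (- 1 * z) * z powr (1/2 - 1))" if "z \<in> {0<..}" for z
      using F_bound[OF \<open>Re b > 2\<close>, of z] that by simp
  qed auto
  have R: "(\<lambda>n. rGamma (b n)) \<longlonglongrightarrow> rGamma a"
    using isCont_tendsto_compose[OF _ b_lim, of rGamma] by (simp add: isCont_rGamma)
  have C_lim: "(\<lambda>n. C (b n)) \<longlonglongrightarrow> C a" unfolding C_def by (intro tendsto_intros R)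
  then obtain K where K: "\<And>n. norm (C (b n)) \<le> K" using convergent_imp_Bseq[of "\<lambda>n. C (b n)"] unfolding convergent_def Bseq_def by blast
  have K': "C (b n) \<le> K" for n using K[of n] by simp
  have C0: "C c \<ge> 0" for c unfolding C_def using G0 by simp
  have lim: "(\<lambda>n. integral {0<..} (F (b n))) \<longlonglongrightarrow> integral {0<..} (F a)"
  proof (rule dominated_convergence(2)[where h = "\<lambda>z. C a * K * (exp (- 1 * z) * z powr (1/2 - 1))"])
    show "F (b n) integrable_on {0<..}" for n using F_int[OF b] set_lebesgue_integral_eq_integral(1) by blast
    show "(\<lambda>z. C a * K * (exp (- 1 * z) * z powr (1/2 - 1))) integrable_on {0<..}"
      by (intro integrable_on_mult_right int_e)
    show "norm (F (b n) z) \<le> C a * K * (exp (- 1 * z) * z powr (1/2 - 1))" if "z \<in> {0<..}" for n z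
    proof -
      have "norm (F (b n) z) \<le> C a * C (b n) * (exp (- 1 * z) * z powr (1/2 - 1))"
        using F_bound[OF b] that by simp
      also have "\<dots> \<le> C a * K * (exp (- 1 * z) * z powr (1/2 - 1))"
        by (intro mult_right_mono mult_left_mono K' C0) auto
      finally show ?thesis .
    qed
    show "(\<lambda>n. F (b n) z) \<longlonglongrightarrow> F a z" if "z \<in> {0<..}" for z
      unfolding F_def b_def using that by (intro tendsto_intros tri_u_tendsto a) auto
  qed
  define N where "N = (\<lambda>c. deriv rGamma a * rGamma c - rGamma a * deriv rGamma c)"
  have "integral {0<..} (F (b n)) = (N (b n) - N a) / (b n - a)" for n
  proof -
    interpret T: two_tricomi a "b n" "tri_u a" "tri_v a" "tri_u (b n)" "tri_v (b n)"
      using a b[of n] by unfold_locales (auto intro: tricomi_pair_tri)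
    have "T.prod_fun 0 0 0 = F (b n)" by (simp add: T.prod_fun_def F_def fun_eq_iff)
    with T.has_gen_integral_0 ba[of n]
    have "has_gen_integral (F (b n)) ((rGamma a * deriv rGamma (b n) - deriv rGamma a * rGamma (b n)) / (a - b n))"
      by metis
    from has_gen_integral_unique[OF has_gen_integral_of_absolutely_integrable[OF F_int[OF b]] this]
    have "integral {0<..} (F (b n)) = (rGamma a * deriv rGamma (b n) - deriv rGamma a * rGamma (b n)) / (a - b n)" .
    also have "\<dots> = (N (b n) - N a) / (b n - a)"
      using ba[of n] by (simp add: N_def divide_simps) (simp add: algebra_simps)
    finally show ?thesis .
  qed
  moreover have "(N has_field_derivative deriv rGamma a * deriv rGamma a - rGamma a * deriv (deriv rGamma) a) (at a)"
    unfolding N_def by (intro DERIV_diff DERIV_cmult DERIV_rGamma DERIV_deriv_rGamma)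
  hence "(N has_field_derivative square_val a) (at a)" by (simp add: square_val_def power2_eq_square)
  hence "((\<lambda>c. (N c - N a) / (c - a)) \<longlongrightarrow> square_val a) (at a)" by (simp add: has_field_derivative_iff)
  hence "(\<lambda>n. (N (b n) - N a) / (b n - a)) \<longlonglongrightarrow> square_val a"
    by (rule filterlim_compose) (use b_lim ba in \<open>simp add: filterlim_at\<close>)
  ultimately have "(\<lambda>n. integral {0<..} (F (b n))) \<longlonglongrightarrow> square_val a" by simp
  from LIMSEQ_unique[OF lim this] have "integral {0<..} (F a) = square_val a" .
  with has_gen_integral_of_absolutely_integrable[OF F_int[OF a]] show ?thesis unfolding F_def by simp
qed

lemma square_val_lower: "square_val (a - 1) = (rGamma a)\<^sup>2 + (a - 1)\<^sup>2 * square_val a"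
proof -
  have R: "rGamma (a - 1) = (a - 1) * rGamma a" using rGamma_plus1[of "a - 1"] by simp
  have "((\<lambda>w. rGamma (w + 1)) has_field_derivative deriv rGamma a * 1) (at (a - 1))"
    by (rule DERIV_chain2[of rGamma]) (use DERIV_rGamma[of a] in \<open>auto intro!: derivative_eq_intros\<close>)
  moreover have "((\<lambda>w. deriv rGamma (w + 1)) has_field_derivative deriv (deriv rGamma) a * 1) (at (a - 1))"
    by (rule DERIV_chain2[of "deriv rGamma"]) (use DERIV_deriv_rGamma[of a] in \<open>auto intro!: derivative_eq_intros\<close>)
  ultimately have "((\<lambda>w. rGamma (w + 1) + w * deriv rGamma (w + 1)) has_field_derivative
      deriv rGamma a * 1 + (1 * deriv rGamma (a - 1 + 1) + deriv (deriv rGamma) a * 1 * (a - 1))) (at (a - 1))"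
    by (intro DERIV_add DERIV_mult DERIV_ident)
  moreover have "(\<lambda>w. rGamma (w + 1) + w * deriv rGamma (w + 1)) = deriv (rGamma :: complex \<Rightarrow> complex)"
    by (rule ext) (rule deriv_rGamma_shift[of "_ + 1", unfolded add_diff_cancel_right', symmetric])
  ultimately have "(deriv rGamma has_field_derivative 2 * deriv rGamma a + (a - 1) * deriv (deriv rGamma) a) (at (a - 1))"
    by (simp add: algebra_simps)
  hence R'': "deriv (deriv rGamma) (a - 1) = 2 * deriv rGamma a + (a - 1) * deriv (deriv rGamma) a"
    by (rule DERIV_imp_deriv)
  show ?thesis unfolding square_val_def R deriv_rGamma_shift R'' by (simp add: algebra_simps power2_eq_square)
qed

text \<open>With \<open>w = (a - 1) * u + z * v\<close> the next lower function, the derivative of \<open>z * exp (- z) * u * w\<close> is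
  \<open>exp (- z) * (u * w - w\<^sup>2 + (a - 1)\<^sup>2 * u\<^sup>2)\<close>.\<close>
lemma square_integral_lower:
  assumes pair: "tricomi_pair a u v"
    and sq: "has_gen_integral (\<lambda>z. u z * (of_real (exp (- z)) * u z)) (square_val a)"
  defines "w \<equiv> \<lambda>z. (a - 1) * u z + of_real z * v z"
  shows "has_gen_integral (\<lambda>z. w z * (of_real (exp (- z)) * w z)) (square_val (a - 1))"
proof -
  define x where "x = (\<lambda>z. (a - 1) * u z + (a - 1 + of_real z) * v z)"
  have pair': "tricomi_pair (a - 1) w x" unfolding w_def x_def by (rule tricomi_pair_lower[OF pair])
  interpret T: two_tricomi a "a - 1" u v w x using pair pair' by unfold_locales
  interpret L: two_tricomi "a - 1" "a - 1" w x w x using pair' by unfold_locales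
  interpret U: two_tricomi a a u v u v using pair by unfold_locales
  define P' where "P' = (\<lambda>z. T.prod_fun 0 0 0 z + (- 1) * L.prod_fun 0 0 0 z + (a - 1)\<^sup>2 * U.prod_fun 0 0 0 z)"
  have P: "(T.prod_fun 1 0 0 has_vector_derivative P' z) (at z)" if z: "z > 0" for z
  proof -
    have "((\<lambda>z. of_real z * T.A.f 0 z * T.B.g 0 z) has_vector_derivative
        (of_real z * T.A.f 0 z) * (- T.B.g (Suc 0) z) + (of_real z * (T.A.f 0 z - T.A.f (Suc 0) z) + 1 * T.A.f 0 z) * T.B.g 0 z) (at z)"
      by (intro has_vector_derivative_mult of_real_hvd T.A.f_deriv[OF z] T.B.g_deriv[OF z])
    moreover have "(of_real z * T.A.f 0 z) * (- T.B.g (Suc 0) z) + (of_real z * (T.A.f 0 z - T.A.f (Suc 0) z) + 1 * T.A.f 0 z) * T.B.g 0 z = P' z"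
      unfolding P'_def T.prod_fun_def L.prod_fun_def U.prod_fun_def
      by (simp add: x_def) (simp add: w_def algebra_simps power2_eq_square)
    ultimately show ?thesis by (simp add: T.prod_fun_def[abs_def])
  qed
  have pe: "((\<lambda>z. of_real (z powr (1/4)) * u z) \<longlongrightarrow> 0) (at_right 0)"
    using pair polar_expansion_remainder[of 0] unfolding tricomi_pair_def by fastforce
  have pe': "((\<lambda>z. of_real (z powr (1/4)) * T.B.g 0 z) \<longlongrightarrow> 0) (at_right 0)"
    using polar_expansion_remainder[OF T.B.g_expansion[of 0]] by simp
  have "((\<lambda>z. of_real (z powr (1/2)) * (of_real (z powr (1/4)) * u z) * (of_real (z powr (1/4)) * T.B.g 0 z)) \<longlongrightarrow> of_real 0 * 0 * 0) (at_right 0)"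
    by (intro tendsto_mult pe pe' tendsto_of_real) real_asymp
  hence "((\<lambda>z. of_real (z powr (1/2)) * (of_real (z powr (1/4)) * u z) * (of_real (z powr (1/4)) * T.B.g 0 z)) \<longlongrightarrow> 0) (at_right 0)"
    by simp
  hence "(T.prod_fun 1 0 0 \<longlongrightarrow> 0) (at_right 0)"
  proof (rule Lim_transform_eventually, intro eventually_mono[OF eventually_at_right_less])
    fix z :: real assume z: "z > 0"
    have "z powr (1/2) * z powr (1/4) * z powr (1/4) = z" using z by (simp flip: powr_add)
    hence "of_real (z powr (1/2)) * of_real (z powr (1/4)) * of_real (z powr (1/4)) = (of_real z :: complex)"
      by (metis of_real_mult)
    thus "of_real (z powr (1/2)) * (of_real (z powr (1/4)) * u z) * (of_real (z powr (1/4)) * T.B.g 0 z) = T.prod_fun 1 0 0 z"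
      unfolding T.prod_fun_def by (simp add: mult_ac)
  qed
  hence fp: "has_finite_part 0 (T.prod_fun 1 0 0) 0" by (rule has_finite_part_tendsto)
  have "has_gen_integral P' (- 0)"
  proof (rule has_gen_integral_deriv'[OF P _ _ T.prod_fun_tendsto_0 _ fp])
    show "continuous_on {0<..} P'"
      unfolding P'_def by (intro continuous_intros T.prod_fun_continuous L.prod_fun_continuous U.prod_fun_continuous)
    show "P' absolutely_integrable_on {1<..}"
      unfolding P'_def by (intro set_integral_add set_integrable_mult_right T.prod_fun_integrable_Ioi L.prod_fun_integrable_Ioi U.prod_fun_integrable_Ioi)
    show "polar_integrable 0 P'"
      unfolding P'_def by (intro polar_integrable_add polar_integrable_mult T.prod_fun_polar L.prod_fun_polar U.prod_fun_polar)
  qed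
  moreover have "has_gen_integral (T.prod_fun 0 0 0) ((rGamma a)\<^sup>2)"
  proof -
    have R: "rGamma (a - 1) = (a - 1) * rGamma a" using rGamma_plus1[of "a - 1"] by simp
    have "(rGamma a * deriv rGamma (a - 1) - deriv rGamma a * rGamma (a - 1)) / (a - (a - 1)) = (rGamma a)\<^sup>2"
      unfolding deriv_rGamma_shift R by (simp add: algebra_simps power2_eq_square)
    thus ?thesis using T.has_gen_integral_0 by simp
  qed
  moreover have "has_gen_integral (U.prod_fun 0 0 0) (square_val a)"
    using sq by (simp add: U.prod_fun_def[abs_def])
  ultimately have "has_gen_integral (\<lambda>z. 1 * (1 * T.prod_fun 0 0 0 z + (a - 1)\<^sup>2 * U.prod_fun 0 0 0 z) + (- 1) * P' z)
      (1 * (1 * (rGamma a)\<^sup>2 + (a - 1)\<^sup>2 * square_val a) + (- 1) * (- 0))"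
    by (intro has_gen_integral_linear)
  hence "has_gen_integral (\<lambda>z. w z * (of_real (exp (- z)) * w z)) (1 * (1 * (rGamma a)\<^sup>2 + (a - 1)\<^sup>2 * square_val a) + (- 1) * (- 0))"
    by (rule has_gen_integral_cong[rotated]) (simp add: P'_def L.prod_fun_def)
  thus ?thesis by (simp add: square_val_lower)
qed

lemma tricomi_pair_exists:
  obtains u v where "tricomi_pair a u v" "has_gen_integral (\<lambda>z. u z * (of_real (exp (- z)) * u z)) (square_val a)"
proof -
  have *: "\<exists>u v. tricomi_pair a u v \<and> has_gen_integral (\<lambda>z. u z * (of_real (exp (- z)) * u z)) (square_val a)"
    if "Re a + real n > 2" for n :: nat and a
    using that
  proof (induction n arbitrary: a)
    case 0
    thus ?case using tricomi_pair_tri[of a] tri_u_square_integral[of a] by auto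
  next
    case (Suc n)
    have "\<exists>u v. tricomi_pair (a + 1) u v \<and> has_gen_integral (\<lambda>z. u z * (of_real (exp (- z)) * u z)) (square_val (a + 1))"
      using Suc.prems by (intro Suc.IH) simp
    then obtain u v where "tricomi_pair (a + 1) u v" "has_gen_integral (\<lambda>z. u z * (of_real (exp (- z)) * u z)) (square_val (a + 1))" by blast
    from tricomi_pair_lower[OF this(1)] square_integral_lower[OF this] show ?case by auto
  qed
  obtain n :: nat where "2 - Re a < real n" using reals_Archimedean2 by blast
  hence "Re a + real n > 2" by simp
  from *[OF this] that show ?thesis by blast
qed

section \<open>Closed forms\<close>

text \<open>The values as entire expressions, free of digamma functions; the closed forms agree with them at
  regular parameters.\<close>
primrec offdiag_val :: "complex \<Rightarrow> complex \<Rightarrow> nat \<Rightarrow> complex" where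
  "offdiag_val a b 0 = (rGamma a * deriv rGamma b - deriv rGamma a * rGamma b) / (a - b)"
| "offdiag_val a b (Suc m) = (of_nat (Suc m) - a) * offdiag_val a b m + gen_bdry a b m"

primrec diag_val :: "complex \<Rightarrow> nat \<Rightarrow> complex" where
  "diag_val a 0 = square_val a"
| "diag_val a (Suc m) = (of_nat (Suc m) - a) * diag_val a m + gen_bdry a a m"

lemma (in two_tricomi) has_gen_integral_offdiag:
  "a \<noteq> b \<Longrightarrow> has_gen_integral (prod_fun m m m) (offdiag_val a b m)"
  by (induction m) (simp_all add: has_gen_integral_0 has_gen_integral_Suc del: of_nat_Suc)

lemma (in tricomi) has_gen_integral_diag:
  assumes "has_gen_integral (\<lambda>z. u z * (of_real (exp (- z)) * u z)) (square_val a)"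
  shows "has_gen_integral (\<lambda>z. of_real z ^ m * f m z * g m z) (diag_val a m)"
proof -
  interpret D: two_tricomi a a u v u v by unfold_locales
  have "has_gen_integral (D.prod_fun m m m) (diag_val a m)"
  proof (induction m)
    case 0
    thus ?case using assms by (simp add: D.prod_fun_def[abs_def])
  next
    case (Suc m)
    thus ?case using D.has_gen_integral_Suc[OF Suc] by simp
  qed
  thus ?thesis by (simp add: D.prod_fun_def[abs_def])
qed

lemma deriv_rGamma_regular: "a \<notin> \<int>\<^sub>\<le>\<^sub>0 \<Longrightarrow> deriv rGamma a = - rGamma a * Digamma (a :: complex)"
  by (rule DERIV_imp_deriv[OF has_field_derivative_rGamma_no_nonpos_int])

lemma square_val_regular:
  assumes a: "a \<notin> \<int>\<^sub>\<le>\<^sub>0"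
  shows "square_val a = (rGamma a)\<^sup>2 * Polygamma 1 a"
proof -
  have "((\<lambda>w. - rGamma w * Digamma w) has_field_derivative - (- rGamma a * Digamma a) * Digamma a + Polygamma 1 a * - rGamma a) (at a)"
    using DERIV_mult[OF DERIV_minus[OF has_field_derivative_rGamma_no_nonpos_int[OF a]] has_field_derivative_Polygamma[OF a, of 0]] by simp
  moreover have ev: "eventually (\<lambda>w. - rGamma w * Digamma w = deriv rGamma w) (nhds a)"
  proof -
    have "open (- \<int>\<^sub>\<le>\<^sub>0 :: complex set)" by (intro open_Compl closed_nonpos_Ints)
    hence "eventually (\<lambda>w. w \<in> - \<int>\<^sub>\<le>\<^sub>0) (nhds a)" using a by (intro eventually_nhds_in_open) auto
    thus ?thesis by eventually_elim (simp add: deriv_rGamma_regular)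
  qed
  ultimately have "(deriv rGamma has_field_derivative - (- rGamma a * Digamma a) * Digamma a + Polygamma 1 a * - rGamma a) (at a)"
    using DERIV_cong_ev[OF refl ev refl] by simp
  hence DD: "deriv (deriv rGamma) a = - (- rGamma a * Digamma a) * Digamma a + Polygamma 1 a * - rGamma a"
    by (rule DERIV_imp_deriv)
  show ?thesis unfolding square_val_def DD deriv_rGamma_regular[OF a] by (simp add: algebra_simps power2_eq_square)
qed

text \<open>The harmonic sum \<open>1 / (a - 1) + \<dots> + 1 / (a - m)\<close>.\<close>
definition harm_below :: "nat \<Rightarrow> complex \<Rightarrow> complex" where
  "harm_below m a = shifted_harm m (a - of_nat m)"

lemma shifted_harm_Suc: "shifted_harm (Suc k) a = 1 / a + shifted_harm k (a + 1)"
  unfolding shifted_harm_def by (subst sum.lessThan_Suc_shift) (simp add: add_ac)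

lemma harm_below_Suc: "harm_below (Suc m) a = 1 / (a - of_nat (Suc m)) + harm_below m a"
proof -
  have "a - of_nat (Suc m) + 1 = a - of_nat m" by simp
  thus ?thesis unfolding harm_below_def shifted_harm_Suc by (simp only:)
qed

text \<open>\<open>a - m\<close> is no pole of the digamma function; then neither are \<open>a\<close>, \<open>a - 1\<close>, \<open>\<dots>\<close>.\<close>
abbreviation regular :: "nat \<Rightarrow> complex \<Rightarrow> bool" where "regular m a \<equiv> a - of_nat m \<notin> \<int>\<^sub>\<le>\<^sub>0"

lemma regularD:
  assumes "regular m a" "j \<le> m"
  shows "a - of_nat j \<notin> \<int>\<^sub>\<le>\<^sub>0" "a - of_nat j \<noteq> 0"
proof -
  show *: "a - of_nat j \<notin> \<int>\<^sub>\<le>\<^sub>0"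
  proof
    assume "a - of_nat j \<in> \<int>\<^sub>\<le>\<^sub>0"
    then obtain n where "a - of_nat j = - of_nat n" by (auto elim: nonpos_Ints_cases')
    hence "a - of_nat m = - of_nat (n + (m - j))" using assms(2) by (simp add: of_nat_diff algebra_simps)
    thus False using assms(1) by (metis minus_of_nat_in_nonpos_Ints)
  qed
  thus "a - of_nat j \<noteq> 0" by auto
qed

lemma regular_imp: "regular m a \<Longrightarrow> a \<notin> \<int>\<^sub>\<le>\<^sub>0"
  using regularD(1)[of a m 0] by simp

lemma Digamma_diff_of_nat:
  assumes "regular m a"
  shows "Digamma (a - of_nat m) = Digamma a - harm_below m a"
proof -
  have "\<forall>k<m. a - of_nat m \<noteq> - of_nat k" using assms by (metis minus_of_nat_in_nonpos_Ints)
  from Polygamma_plus_of_nat[OF this, of 0] show ?thesis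
    by (simp add: harm_below_def shifted_harm_def)
qed

lemma tricomi_const_regular:
  assumes "regular m b"
  shows "fact m * tricomi_const b m = rGamma b * pochhammer (1 - b) m * (Digamma (of_nat (Suc m)) + Digamma 1 - Digamma b + harm_below m b)"
  using assms
proof (induction m)
  case 0
  thus ?case by (simp add: deriv_rGamma_regular harm_below_def shifted_harm_def algebra_simps)
next
  case (Suc m)
  define s :: complex where "s = of_nat (Suc m)"
  have s: "s \<noteq> 0" unfolding s_def using of_nat_neq_0 by blast
  have bs: "b - s \<noteq> 0" using regularD(2)[OF Suc.prems, of "Suc m"] by (simp add: s_def)
  have "regular m b" using regularD(1)[OF Suc.prems, of m] by simp
  note IH = Suc.IH[OF this]
  define X where "X = Digamma (of_nat (Suc m)) + Digamma 1 - Digamma b + harm_below m b"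
  define p where "p = rGamma b * pochhammer (1 - b) m"
  have 1: "Digamma (of_nat (Suc (Suc m))) + Digamma 1 - Digamma b + harm_below (Suc m) b = X + 1 / s + 1 / (b - s)"
  proof -
    have "Digamma (of_nat (Suc (Suc m)) :: complex) = Digamma (s + 1)" by (simp add: s_def add_ac)
    also have "\<dots> = Digamma s + 1 / s" by (rule Digamma_plus1[OF s])
    finally show ?thesis unfolding harm_below_Suc X_def s_def[symmetric] by simp
  qed
  have 2: "rGamma b * pochhammer (1 - b) (Suc m) = p * (s - b)"
    by (simp add: p_def s_def pochhammer_Suc)
  have "fact (Suc m) * tricomi_const b (Suc m) = s * (fact m * tricomi_const b m) * (1 - b / s) - s * b * (p / s ^ 2)"
  proof -
    have f: "fact (Suc m) = s * fact m" by (simp add: s_def)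
    show ?thesis unfolding f tricomi_const.simps s_def[symmetric] p_def using s by (simp add: field_simps)
  qed
  also have "\<dots> = s * (p * X) * (1 - b / s) - s * b * (p / s ^ 2)"
    unfolding IH X_def[symmetric] p_def[symmetric] ..
  also have "\<dots> = p * (s - b) * (X + 1 / s + 1 / (b - s))"
  proof -
    have "(s - b) * (1 / s + 1 / (b - s)) = - b / s" using s bs by (simp add: field_simps)
    hence "p * (s - b) * (X + 1 / s + 1 / (b - s)) = p * (s - b) * X + p * (- b / s)"
      by (metis (no_types, lifting) add.assoc distrib_left mult.assoc)
    also have "\<dots> = s * (p * X) * (1 - b / s) - s * b * (p / s ^ 2)"
      using s by (simp add: field_simps power2_eq_square)
    finally show ?thesis ..
  qed
  finally show ?case unfolding 1 2 .
qed

text \<open>Summands of the finite sum, in the order in which the recursion produces them.\<close>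
definition poch_term :: "complex \<Rightarrow> complex \<Rightarrow> nat \<Rightarrow> nat \<Rightarrow> complex" where
  "poch_term a b m j = pochhammer (of_nat (j + 2) - a) (m - 1 - j) * pochhammer (1 - b) j"

lemma poch_term_Suc: "j < m \<Longrightarrow> poch_term a b (Suc m) j = (of_nat (Suc m) - a) * poch_term a b m j"
proof -
  assume j: "j < m"
  hence *: "Suc m - 1 - j = Suc (m - 1 - j)" by simp
  have "of_nat (j + 2) - a + of_nat (m - 1 - j) = of_nat (Suc m) - a"
    using j by (simp add: of_nat_diff algebra_simps)
  thus ?thesis unfolding poch_term_def * pochhammer_Suc by (simp only: mult_ac)
qed

lemma poch_term_last: "poch_term a b (Suc m) m = pochhammer (1 - b) m"
  by (simp add: poch_term_def)

text \<open>This identity cancels the terms without digamma functions that the two parts of the closed form produce in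
  \<open>off_sum_Suc\<close> and \<open>off_main_Suc\<close>.\<close>
lemma poch_term_sum: "(b - a) * (\<Sum>j<m. poch_term a b m j) = pochhammer (1 - a) m - pochhammer (1 - b) m"
proof (induction m)
  case (Suc m)
  have "(b - a) * (\<Sum>j<Suc m. poch_term a b (Suc m) j) = (of_nat (Suc m) - a) * ((b - a) * (\<Sum>j<m. poch_term a b m j)) + (b - a) * pochhammer (1 - b) m"
    by (simp add: poch_term_Suc poch_term_last sum_distrib_left distrib_left mult_ac del: of_nat_Suc)
  also have "\<dots> = (of_nat (Suc m) - a) * (pochhammer (1 - a) m - pochhammer (1 - b) m) + (b - a) * pochhammer (1 - b) m"
    unfolding Suc ..
  also have "\<dots> = pochhammer (1 - a) (Suc m) - pochhammer (1 - b) (Suc m)"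
    by (simp add: pochhammer_Suc algebra_simps)
  finally show ?case .
qed auto

lemma gen_bdry_regular:
  assumes "regular m b"
  shows "gen_bdry a b m = rGamma a * rGamma b * (pochhammer (1 - b) m * (Digamma (of_nat (Suc m)) + Digamma 1 - Digamma b + harm_below m b)
     + (\<Sum>j<m. poch_term a b (Suc m) j / of_nat (m - j)))"
proof -
  have "fact m * rGamma a * tricomi_const b m = rGamma a * (fact m * tricomi_const b m)" by simp
  thus ?thesis unfolding gen_bdry_def tricomi_const_regular[OF assms]
    by (simp add: poch_term_def distrib_left mult_ac)
qed

definition off_sum :: "complex \<Rightarrow> complex \<Rightarrow> nat \<Rightarrow> complex" where
  "off_sum a b m = - (\<Sum>j<m. poch_term a b m j * (- Digamma (of_nat (Suc j)) - Digamma (of_nat (m - j))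
      + 1 / 2 * shifted_harm (m - 1 - j) (a - of_nat m) - 1 / 2 * harm_below j b))"

text \<open>Raising \<open>m\<close> multiplies every old summand by \<open>m + 1 - a\<close>, shifts one digamma argument by \<open>1\<close>, and puts
  \<open>1 / (a - m - 1)\<close> in front of the harmonic sum in \<open>a\<close>.\<close>
lemma off_sum_Suc:
  assumes a: "regular (Suc m) a"
  shows "off_sum a b (Suc m) = (of_nat (Suc m) - a) * off_sum a b m + pochhammer (1 - b) m * (Digamma (of_nat (Suc m)) + Digamma 1 + 1 / 2 * harm_below m b)
     + (\<Sum>j<m. poch_term a b (Suc m) j / of_nat (m - j)) + 1 / 2 * (\<Sum>j<m. poch_term a b m j)"
proof -
  define y where "y = a - of_nat (Suc m)"
  have y: "y \<noteq> 0" unfolding y_def by (rule regularD(2)[OF a order_refl])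
  have y1: "y + 1 = a - of_nat m" by (simp add: y_def)
  define X where "X = (\<lambda>j. - Digamma (of_nat (Suc j)) - Digamma (of_nat (m - j)) + 1 / 2 * shifted_harm (m - 1 - j) (a - of_nat m) - 1 / 2 * harm_below j b)"
  have step: "poch_term a b (Suc m) j * (- Digamma (of_nat (Suc j)) - Digamma (of_nat (Suc m - j)) + 1 / 2 * shifted_harm (Suc m - 1 - j) y - 1 / 2 * harm_below j b)
     = (of_nat (Suc m) - a) * (poch_term a b m j * X j) - poch_term a b (Suc m) j / of_nat (m - j) - 1 / 2 * poch_term a b m j" if j: "j < m" for j
  proof -
    have k: "Suc m - j = Suc (m - j)" "Suc m - 1 - j = Suc (m - 1 - j)" using j by auto
    have nz: "of_nat (m - j) \<noteq> (0::complex)" using j by simp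
    have "Digamma (of_nat (Suc m - j) :: complex) = Digamma (of_nat (m - j) + 1)" unfolding k by (simp add: add_ac)
    also have "\<dots> = Digamma (of_nat (m - j)) + 1 / of_nat (m - j)" by (rule Digamma_plus1[OF nz])
    finally have D: "Digamma (of_nat (Suc m - j) :: complex) = Digamma (of_nat (m - j)) + 1 / of_nat (m - j)" .
    have H: "shifted_harm (Suc m - 1 - j) y = 1 / y + shifted_harm (m - 1 - j) (a - of_nat m)"
      unfolding k shifted_harm_Suc y1 ..
    have T: "poch_term a b (Suc m) j = - y * poch_term a b m j" unfolding poch_term_Suc[OF j] y_def by simp
    have "poch_term a b (Suc m) j * (- Digamma (of_nat (Suc j)) - Digamma (of_nat (Suc m - j)) + 1 / 2 * shifted_harm (Suc m - 1 - j) y - 1 / 2 * harm_below j b)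
      = poch_term a b (Suc m) j * (X j - 1 / of_nat (m - j) + 1 / 2 * (1 / y))"
      unfolding D H X_def by (simp add: algebra_simps)
    also have "\<dots> = poch_term a b (Suc m) j * X j - poch_term a b (Suc m) j / of_nat (m - j) + 1 / 2 * (poch_term a b (Suc m) j / y)"
      by (simp add: algebra_simps)
    also have "poch_term a b (Suc m) j / y = - poch_term a b m j" unfolding T using y by simp
    finally show ?thesis unfolding poch_term_Suc[OF j] by (simp add: mult_ac)
  qed
  have "off_sum a b (Suc m) = - ((\<Sum>j<m. poch_term a b (Suc m) j * (- Digamma (of_nat (Suc j)) - Digamma (of_nat (Suc m - j)) + 1 / 2 * shifted_harm (Suc m - 1 - j) y - 1 / 2 * harm_below j b))
     + pochhammer (1 - b) m * (- Digamma (of_nat (Suc m)) - Digamma 1 - 1 / 2 * harm_below m b))"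
    unfolding off_sum_def y_def[symmetric] by (simp add: poch_term_last shifted_harm_def)
  also have "(\<Sum>j<m. poch_term a b (Suc m) j * (- Digamma (of_nat (Suc j)) - Digamma (of_nat (Suc m - j)) + 1 / 2 * shifted_harm (Suc m - 1 - j) y - 1 / 2 * harm_below j b))
     = (\<Sum>j<m. (of_nat (Suc m) - a) * (poch_term a b m j * X j) - poch_term a b (Suc m) j / of_nat (m - j) - 1 / 2 * poch_term a b m j)"
    by (intro sum.cong refl step) auto
  also have "\<dots> = (of_nat (Suc m) - a) * (\<Sum>j<m. poch_term a b m j * X j) - (\<Sum>j<m. poch_term a b (Suc m) j / of_nat (m - j)) - 1 / 2 * (\<Sum>j<m. poch_term a b m j)"
    by (simp only: sum_subtractf sum_distrib_left)
  also have "(\<Sum>j<m. poch_term a b m j * X j) = - off_sum a b m" by (simp add: off_sum_def X_def)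
  finally show ?thesis by (simp add: algebra_simps)
qed

text \<open>The part of the closed form with denominator \<open>\<theta>1 - \<theta>2 = 2 * (a - b)\<close>.\<close>
definition off_main :: "complex \<Rightarrow> complex \<Rightarrow> nat \<Rightarrow> complex" where
  "off_main a b m = (pochhammer (1 - a) m * (2 * Digamma a - harm_below m a) - pochhammer (1 - b) m * (2 * Digamma b - harm_below m b)) / (2 * (a - b))"

lemma off_main_Suc:
  assumes a: "regular (Suc m) a" and b: "regular (Suc m) b" and ab: "a \<noteq> b"
  shows "off_main a b (Suc m) = (of_nat (Suc m) - a) * off_main a b m - 1 / 2 * (\<Sum>j<m. poch_term a b m j) 
      - pochhammer (1 - b) m * (Digamma b - 1 / 2 * harm_below m b)"
proof -
  define s :: complex where "s = of_nat (Suc m)"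
  define p where "p = pochhammer (1 - a) m"
  define q where "q = pochhammer (1 - b) m"
  define X where "X = 2 * Digamma a - harm_below m a"
  define Y where "Y = 2 * Digamma b - harm_below m b"
  have as: "a - s \<noteq> 0" and bs: "b - s \<noteq> 0"
    unfolding s_def by (rule regularD(2)[OF a order_refl], rule regularD(2)[OF b order_refl])
  have ps: "pochhammer (1 - a) (Suc m) = p * (s - a)" "pochhammer (1 - b) (Suc m) = q * (s - b)"
    by (simp_all add: p_def q_def s_def pochhammer_Suc)
  have S: "(b - a) * (\<Sum>j<m. poch_term a b m j) = p - q" unfolding p_def q_def by (rule poch_term_sum)
  have ba: "b - a \<noteq> 0" using ab by simp
  have S': "(\<Sum>j<m. poch_term a b m j) = (p - q) / (b - a)" unfolding S[symmetric] using ba by simp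
  have n1: "2 * Digamma a - (1 / (a - s) + harm_below m a) = X - 1 / (a - s)"
    "2 * Digamma b - (1 / (b - s) + harm_below m b) = Y - 1 / (b - s)" by (simp_all add: X_def Y_def)
  have n2: "p * (s - a) * (X - 1 / (a - s)) = p * (s - a) * X + p" using as by (simp add: field_simps)
  have n3: "q * (s - b) * (Y - 1 / (b - s)) = q * (s - b) * Y + q" using bs by (simp add: field_simps)
  have "off_main a b (Suc m) = (p * (s - a) * X + p - (q * (s - b) * Y + q)) / (2 * (a - b))"
    unfolding off_main_def ps harm_below_Suc s_def[symmetric] n1 n2 n3 ..
  also have "\<dots> = (s - a) * ((p * X - q * Y) / (2 * (a - b))) - 1 / 2 * ((p - q) / (b - a)) - q * (1 / 2 * Y)"
    using ab ba by (simp add: divide_simps) (simp add: algebra_simps)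
  also have "q * (1 / 2 * Y) = q * (Digamma b - 1 / 2 * harm_below m b)" by (simp add: Y_def algebra_simps)
  finally show ?thesis unfolding S' off_main_def p_def q_def X_def Y_def s_def .
qed

lemma offdiag_val_regular:
  assumes "regular m a" "regular m b" and ab: "a \<noteq> b"
  shows "offdiag_val a b m = rGamma a * rGamma b * (off_main a b m + off_sum a b m)"
  using assms(1,2)
proof (induction m)
  case 0
  have "offdiag_val a b 0 = rGamma a * rGamma b * ((Digamma a - Digamma b) / (a - b))"
    using 0 ab by (simp add: deriv_rGamma_regular field_simps)
  also have "(Digamma a - Digamma b) / (a - b) = off_main a b 0 + off_sum a b 0"
    using ab by (simp add: off_main_def off_sum_def harm_below_def shifted_harm_def field_simps)
  finally show ?case .
next
  case (Suc m)
  have r: "regular m a" "regular m b" using regularD(1)[OF Suc.prems(1), of m] regularD(1)[OF Suc.prems(2), of m] by simp_all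
  define h where "h = 1 / 2 * harm_below m b"
  have hh: "harm_below m b = h + h" "1 / 2 * (h + h) = h" by (simp_all add: h_def)
  show ?case
    unfolding offdiag_val.simps Suc.IH[OF r] gen_bdry_regular[OF r(2)] off_main_Suc[OF Suc.prems ab] off_sum_Suc[OF Suc.prems(1)]
      hh
    by (simp only: algebra_simps)
qed

definition diag_bracket :: "complex \<Rightarrow> nat \<Rightarrow> complex" where
  "diag_bracket a m = (Digamma a)\<^sup>2 - (Digamma (a - of_nat m))\<^sup>2 + Polygamma 1 a + Polygamma 1 (a - of_nat m)
     - 2 * (\<Sum>j<m. (Digamma (of_nat (Suc j)) + Digamma (of_nat (m - j))) / (a - of_nat (Suc j)))"

lemma poch_term_Suc_diag:
  assumes "j < m" "a - of_nat (Suc j) \<noteq> 0"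
  shows "poch_term a a (Suc m) j = - pochhammer (1 - a) (Suc m) / (a - of_nat (Suc j))"
proof -
  have e: "Suc m = Suc j + (m - j)" "Suc m - 1 - j = m - j" using assms(1) by auto
  have s: "1 - a + of_nat (Suc j) = of_nat (j + 2) - a" "1 - a + of_nat j = - (a - of_nat (Suc j))" by simp_all
  have "pochhammer (1 - a) (Suc m) = pochhammer (1 - a) (Suc j) * pochhammer (of_nat (j + 2) - a) (m - j)"
    by (subst e(1), subst pochhammer_product') (simp only: s)
  also have "\<dots> = - (a - of_nat (Suc j)) * poch_term a a (Suc m) j"
    unfolding poch_term_def e(2) pochhammer_Suc s by (simp only: mult_ac)
  finally show ?thesis using assms(2) by (simp add: field_simps del: of_nat_Suc)
qed

lemma diag_val_regular:
  assumes "regular m a"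
  shows "diag_val a m = (rGamma a)\<^sup>2 * pochhammer (1 - a) m / 2 * diag_bracket a m"
  using assms
proof (induction m)
  case 0
  thus ?case by (simp add: square_val_regular diag_bracket_def)
next
  case (Suc m)
  have r: "regular m a" using regularD(1)[OF Suc.prems, of m] by simp
  define y where "y = a - of_nat (Suc m)"
  have y: "y \<noteq> 0" unfolding y_def by (rule regularD(2)[OF Suc.prems order_refl])
  have y1: "a - of_nat m = y + 1" by (simp add: y_def)
  define p where "p = pochhammer (1 - a) m"
  have p': "pochhammer (1 - a) (Suc m) = - y * p" by (simp add: p_def y_def pochhammer_Suc)
  define Z where "Z = (\<Sum>j<m. 1 / of_nat (m - j) / (a - of_nat (Suc j)))"
  define K where "K = Digamma (of_nat (Suc m)) + Digamma (1::complex)"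
  have sum: "(\<Sum>j<Suc m. (Digamma (of_nat (Suc j)) + Digamma (of_nat (Suc m - j))) / (a - of_nat (Suc j))) =
     (\<Sum>j<m. (Digamma (of_nat (Suc j)) + Digamma (of_nat (m - j))) / (a - of_nat (Suc j))) + Z + K / y"
  proof -
    have "(Digamma (of_nat (Suc j)) + Digamma (of_nat (Suc m - j))) / (a - of_nat (Suc j)) = 
       (Digamma (of_nat (Suc j)) + Digamma (of_nat (m - j))) / (a - of_nat (Suc j)) + 1 / of_nat (m - j) / (a - of_nat (Suc j))" if j: "j < m" for j
    proof -
      have nz: "of_nat (m - j) \<noteq> (0::complex)" using j by simp
      have "Digamma (of_nat (Suc m - j) :: complex) = Digamma (of_nat (m - j) + 1)" using j by (simp add: Suc_diff_le add_ac)
      also have "\<dots> = Digamma (of_nat (m - j)) + 1 / of_nat (m - j)" by (rule Digamma_plus1[OF nz])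
      finally show ?thesis by (simp add: add_divide_distrib)
    qed
    hence "(\<Sum>j<m. (Digamma (of_nat (Suc j)) + Digamma (of_nat (Suc m - j))) / (a - of_nat (Suc j))) =
      (\<Sum>j<m. (Digamma (of_nat (Suc j)) + Digamma (of_nat (m - j))) / (a - of_nat (Suc j))) + Z"
      unfolding Z_def sum.distrib[symmetric] by (intro sum.cong) auto
    thus ?thesis by (simp add: K_def y_def)
  qed
  have D: "Digamma (y + 1) = Digamma y + 1 / y" by (rule Digamma_plus1[OF y])
  have D1: "Polygamma 1 (y + 1) = Polygamma 1 y - 1 / y ^ 2"
    using Polygamma_plus1[OF y, of 1] by (simp add: power2_eq_square)
  have br: "diag_bracket a (Suc m) = diag_bracket a m + 2 * Digamma (y + 1) / y - 2 * (Z + K / y)"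
    unfolding diag_bracket_def sum y_def[symmetric] y1 D1 D using y
    by (simp add: power2_eq_square field_simps)
  have bd: "(\<Sum>j<m. poch_term a a (Suc m) j / of_nat (m - j)) = y * p * Z"
    unfolding Z_def sum_distrib_left
  proof (intro sum.cong refl)
    fix j assume "j \<in> {..<m}"
    hence j: "j < m" by simp
    have nz: "a - of_nat (Suc j) \<noteq> 0" using regularD(2)[OF Suc.prems, of "Suc j"] j by simp
    show "poch_term a a (Suc m) j / of_nat (m - j) = y * p * (1 / of_nat (m - j) / (a - of_nat (Suc j)))"
      unfolding poch_term_Suc_diag[OF j nz] p' by simp
  qed
  have dg: "Digamma (of_nat (Suc m)) + Digamma 1 - Digamma a + harm_below m a = K - Digamma (y + 1)"
    using Digamma_diff_of_nat[OF r] unfolding y1 K_def by simp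
  have "diag_val a (Suc m) = - y * ((rGamma a)\<^sup>2 * p / 2 * diag_bracket a m) + (rGamma a)\<^sup>2 * (p * (K - Digamma (y + 1)) + y * p * Z)"
    unfolding diag_val.simps Suc.IH[OF r] gen_bdry_regular[OF r] dg bd p_def[symmetric]
    by (simp add: y_def power2_eq_square)
  also have "\<dots> = (rGamma a)\<^sup>2 * (- y * p) / 2 * diag_bracket a (Suc m)"
    unfolding br using y by (simp add: field_simps)
  finally show ?case unfolding p' .
qed

section \<open>The right-hand sides\<close>

definition kummer_param :: "int \<Rightarrow> complex \<Rightarrow> complex" where
  "kummer_param \<alpha> \<theta> = (1 + \<theta> + of_nat (nat \<bar>\<alpha>\<bar>)) / 2"

lemma kummer_param_simps:
  fixes \<alpha> :: int
  defines "m \<equiv> nat \<bar>\<alpha>\<bar>"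
  shows "(1 + \<theta> + of_nat m) / 2 = kummer_param \<alpha> \<theta>" "(1 + \<theta> - of_nat m) / 2 = kummer_param \<alpha> \<theta> - of_nat m"
    "(3 + \<theta> - of_nat m) / 2 = kummer_param \<alpha> \<theta> - of_nat m + 1"
  by (simp_all add: kummer_param_def m_def field_simps)

lemma int_cases_abs:
  fixes \<alpha> :: int
  obtains "of_int \<alpha> = (of_nat (nat \<bar>\<alpha>\<bar>) :: complex)" "\<alpha> = int (nat \<bar>\<alpha>\<bar>)"
    | "of_int \<alpha> = (- of_nat (nat \<bar>\<alpha>\<bar>) :: complex)" "\<alpha> = - int (nat \<bar>\<alpha>\<bar>)"
  by (cases "\<alpha> \<ge> 0") (auto simp flip: of_int_minus)

lemma kummer_param_cases:
  fixes \<alpha> :: int and \<theta> :: complex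
  obtains (nonneg) "(1 + \<theta> + of_int \<alpha>) / 2 = kummer_param \<alpha> \<theta>" "(1 + \<theta> - of_int \<alpha>) / 2 = kummer_param \<alpha> \<theta> - of_nat (nat \<bar>\<alpha>\<bar>)"
    | (neg) "(1 + \<theta> + of_int \<alpha>) / 2 = kummer_param \<alpha> \<theta> - of_nat (nat \<bar>\<alpha>\<bar>)" "(1 + \<theta> - of_int \<alpha>) / 2 = kummer_param \<alpha> \<theta>"
proof (cases \<alpha> rule: int_cases_abs)
  case 1
  show ?thesis by (rule nonneg; simp only: 1(1) kummer_param_simps)
next
  case 2
  show ?thesis by (rule neg; simp only: 2(1) diff_minus_eq_add add_uminus_conv_diff kummer_param_simps)
qed

lemma regular_params_iff: "\<theta> \<in> regular_params \<alpha> \<longleftrightarrow> regular (nat \<bar>\<alpha>\<bar>) (kummer_param \<alpha> \<theta>)"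
proof (cases rule: kummer_param_cases[of \<theta> \<alpha>])
  case nonneg
  show ?thesis unfolding regular_params_def mem_Collect_eq nonneg using regular_imp by blast
next
  case neg
  show ?thesis unfolding regular_params_def mem_Collect_eq neg using regular_imp by blast
qed

lemma minus_one_powi: "(-1) powi \<alpha> = ((-1) ^ nat \<bar>\<alpha>\<bar> :: complex)"
proof (cases "\<alpha> \<ge> 0")
  case False
  thus ?thesis by (simp add: power_int_def power_inverse)
qed (simp add: power_int_def)

lemma rGamma_diff_of_nat: "(-1) ^ m * rGamma (a - of_nat m) = pochhammer (1 - a) m * rGamma (a :: complex)"
proof -
  have "rGamma (a - of_nat m) = pochhammer (a - of_nat m) m * rGamma a"
    using pochhammer_rGamma[of "a - of_nat m" m] by simp
  moreover have "pochhammer (1 - a) m = (-1) ^ m * pochhammer (a - of_nat m) m"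
    using pochhammer_minus[of "a - 1" m] by (simp add: algebra_simps)
  ultimately show ?thesis by simp
qed

text \<open>Reversal of the summation order and reflection of both Pochhammer symbols; the three signs
  multiply to \<open>-1\<close> since \<open>k + j + 1 = m\<close>.\<close>
lemma off_sum_eq:
  "(-1) ^ m * (\<Sum>k<m. pochhammer (a - of_nat m) k * pochhammer (b - of_nat m + 1 + of_nat k) (m - 1 - k)
      * (- Digamma (of_nat (m - k)) - Digamma (of_nat (k + 1))
         + 1 / 2 * shifted_harm k (a - of_nat m) - 1 / 2 * shifted_harm (m - 1 - k) (b - of_nat m + 1 + of_nat k)))
   = off_sum a b m"
proof -
  have "(-1) ^ m * (\<Sum>k<m. pochhammer (a - of_nat m) k * pochhammer (b - of_nat m + 1 + of_nat k) (m - 1 - k)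
      * (- Digamma (of_nat (m - k)) - Digamma (of_nat (k + 1))
         + 1 / 2 * shifted_harm k (a - of_nat m) - 1 / 2 * shifted_harm (m - 1 - k) (b - of_nat m + 1 + of_nat k)))
    = (\<Sum>j<m. - (poch_term a b m j * (- Digamma (of_nat (Suc j)) - Digamma (of_nat (m - j))
      + 1 / 2 * shifted_harm (m - 1 - j) (a - of_nat m) - 1 / 2 * harm_below j b)))"
    unfolding sum_distrib_left
  proof (rule sum.reindex_bij_witness[of _ "\<lambda>j. m - 1 - j" "\<lambda>k. m - 1 - k"])
    fix k assume "k \<in> {..<m}"
    hence k: "k < m" by simp
    define j where "j = m - 1 - k"
    have m: "m = Suc (k + j)" using k by (simp add: j_def)
    have j': "m - k = Suc j" "k + 1 = m - j" "m - 1 - j = k" using m by auto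
    have a: "of_nat (j + 2) - a = (of_nat m - a) - of_nat k + 1" and b: "b - of_nat m + 1 + of_nat k = b - of_nat j"
      unfolding m by simp_all
    have 1: "pochhammer (a - of_nat m) k = (-1) ^ k * pochhammer (of_nat (j + 2) - a) k"
      unfolding a using pochhammer_minus[of "of_nat m - a" k] by simp
    have "pochhammer (1 - b) j = (-1) ^ j * pochhammer (b - of_nat j) j"
      using pochhammer_minus[of "b - 1" j] by simp
    hence 2: "pochhammer (b - of_nat j) j = (-1) ^ j * pochhammer (1 - b) j"
      by (simp flip: mult.assoc power_mult_distrib)
    have "(-1) ^ m * ((-1) ^ k * (-1) ^ j) = (-1 :: complex)"
    proof -
      have "(-1) ^ (k + j) * (-1) ^ (k + j) = (1 :: complex)" by (simp flip: power_mult_distrib)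
      thus ?thesis unfolding m by (simp add: power_add)
    qed
    hence 3: "(-1) ^ m * (pochhammer (a - of_nat m) k * pochhammer (b - of_nat j) j) = - poch_term a b m j"
      unfolding poch_term_def j'(3) 1 2 by (metis (no_types, lifting) mult.assoc mult.left_commute mult_minus1)
    show "- (poch_term a b m (m - 1 - k) * (- Digamma (of_nat (Suc (m - 1 - k))) - Digamma (of_nat (m - (m - 1 - k)))
      + 1 / 2 * shifted_harm (m - 1 - (m - 1 - k)) (a - of_nat m) - 1 / 2 * harm_below (m - 1 - k) b)) =
      (-1) ^ m * (pochhammer (a - of_nat m) k * pochhammer (b - of_nat m + 1 + of_nat k) (m - 1 - k)
      * (- Digamma (of_nat (m - k)) - Digamma (of_nat (k + 1))
         + 1 / 2 * shifted_harm k (a - of_nat m) - 1 / 2 * shifted_harm (m - 1 - k) (b - of_nat m + 1 + of_nat k)))"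
      unfolding j_def[symmetric] b j' harm_below_def[symmetric] mult.assoc[symmetric] 3[unfolded mult.assoc[symmetric]]
      by simp
  qed auto
  thus ?thesis by (simp add: off_sum_def sum_negf)
qed

lemma gen_int_rhs_offdiag_eq:
  assumes r: "\<theta>1 \<in> regular_params \<alpha>" "\<theta>2 \<in> regular_params \<alpha>" and ne: "\<theta>1 \<noteq> \<theta>2"
  shows "gen_int_rhs_offdiag \<alpha> \<theta>1 \<theta>2 = offdiag_val (kummer_param \<alpha> \<theta>1) (kummer_param \<alpha> \<theta>2) (nat \<bar>\<alpha>\<bar>)"
proof -
  define m where "m = nat \<bar>\<alpha>\<bar>"
  define a where "a = kummer_param \<alpha> \<theta>1"
  define b where "b = kummer_param \<alpha> \<theta>2"
  have ra: "regular m a" and rb: "regular m b" using r by (auto simp: regular_params_iff m_def a_def b_def)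
  have t: "\<theta>1 - \<theta>2 = 2 * (a - b)" by (simp add: a_def b_def kummer_param_def field_simps)
  have ab: "a \<noteq> b" using ne t by auto
  have psi: "Digamma ((1 + \<theta> + of_int \<alpha>) / 2) + Digamma ((1 + \<theta> - of_int \<alpha>) / 2) = 2 * Digamma c - harm_below m c"
    if "regular m c" "c = kummer_param \<alpha> \<theta>" for \<theta> c
  proof (cases rule: kummer_param_cases[of \<theta> \<alpha>, folded m_def that(2), case_names nonneg neg])
    case nonneg
    show ?thesis unfolding nonneg Digamma_diff_of_nat[OF that(1)] by simp
  next
    case neg
    show ?thesis unfolding neg Digamma_diff_of_nat[OF that(1)] by simp
  qed
  have G: "x / (Gamma (c - of_nat m) * Gamma d) = x * (rGamma (c - of_nat m) * rGamma d)"
     "x / (Gamma c * Gamma d) = x * (rGamma c * rGamma d)" for x c d :: complex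
    by (simp_all add: rGamma_inverse_Gamma divide_inverse)
  have "gen_int_rhs_offdiag \<alpha> \<theta>1 \<theta>2 = (-1) ^ m / (2 * (a - b)) * ((2 * Digamma a - harm_below m a) * (rGamma (a - of_nat m) * rGamma b)
      - (2 * Digamma b - harm_below m b) * (rGamma (b - of_nat m) * rGamma a)) + rGamma a * rGamma b * off_sum a b m"
    unfolding gen_int_rhs_offdiag_def Let_def m_def[symmetric] minus_one_powi psi[OF ra a_def] psi[OF rb b_def] t off_sum_eq[symmetric]
      kummer_param_simps[of \<theta>1 \<alpha>, folded m_def, folded a_def]
      kummer_param_simps[of \<theta>2 \<alpha>, folded m_def, folded b_def] G
    by (simp only: mult_ac)
  also have "(-1) ^ m / (2 * (a - b)) * ((2 * Digamma a - harm_below m a) * (rGamma (a - of_nat m) * rGamma b)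
      - (2 * Digamma b - harm_below m b) * (rGamma (b - of_nat m) * rGamma a))
     = ((2 * Digamma a - harm_below m a) * (((-1) ^ m * rGamma (a - of_nat m)) * rGamma b)
      - (2 * Digamma b - harm_below m b) * (((-1) ^ m * rGamma (b - of_nat m)) * rGamma a)) / (2 * (a - b))"
  proof -
    have "c / d * (x * (r1 * s1) - y * (r2 * s2)) = (x * ((c * r1) * s1) - y * ((c * r2) * s2)) / d" for c d x y r1 r2 s1 s2 :: complex
      by (simp add: divide_inverse algebra_simps)
    thus ?thesis .
  qed
  also have "\<dots> = rGamma a * rGamma b * off_main a b m"
  proof -
    have "(x * (p * r * s) - y * (q * s * r)) / d = r * s * ((p * x - q * y) / d)" for x y p q r s d :: complex
      by (simp add: divide_inverse algebra_simps)
    thus ?thesis unfolding rGamma_diff_of_nat off_main_def .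
  qed
  finally show ?thesis
    unfolding offdiag_val_regular[OF ra rb ab] a_def[symmetric] b_def[symmetric] m_def[symmetric] by (simp add: algebra_simps)
qed

lemma gen_int_rhs_diag_eq:
  assumes r: "\<theta> \<in> regular_params \<alpha>"
  shows "gen_int_rhs_diag \<alpha> \<theta> = diag_val (kummer_param \<alpha> \<theta>) (nat \<bar>\<alpha>\<bar>)"
proof -
  define m where "m = nat \<bar>\<alpha>\<bar>"
  define a where "a = kummer_param \<alpha> \<theta>"
  note simps = kummer_param_simps[of \<theta> \<alpha>, folded m_def, folded a_def]
  have ra: "regular m a" using r by (auto simp: regular_params_iff m_def a_def)
  have sym: "Polygamma 1 ((1 + \<theta> + of_int \<alpha>) / 2) + Polygamma 1 ((1 + \<theta> - of_int \<alpha>) / 2) = Polygamma 1 a + Polygamma 1 (a - of_nat m)"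
    "2 * Gamma ((1 + \<theta> + of_int \<alpha>) / 2) * Gamma ((1 + \<theta> - of_int \<alpha>) / 2) = 2 * Gamma a * Gamma (a - of_nat m)"
    by (cases rule: kummer_param_cases[of \<theta> \<alpha>, folded m_def a_def]; simp only: add.commute mult.commute mult.left_commute)+
  have sum: "(\<Sum>k<m. (Digamma (of_nat (m - k)) + Digamma (of_nat (k + 1))) / (a - of_nat m + of_nat k)) =
     (\<Sum>j<m. (Digamma (of_nat (Suc j)) + Digamma (of_nat (m - j))) / (a - of_nat (Suc j)))"
  proof (rule sum.reindex_bij_witness[of _ "\<lambda>j. m - 1 - j" "\<lambda>k. m - 1 - k"])
    fix k assume "k \<in> {..<m}"
    hence k: "k < m" by simp
    define j where "j = m - 1 - k"
    have m: "m = Suc (k + j)" using k by (simp add: j_def)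
    have "a - of_nat (Suc j) = a - of_nat m + of_nat k" unfolding m by simp
    moreover have "Suc j = m - k" "m - j = k + 1" using m by auto
    ultimately show "(Digamma (of_nat (Suc (m - 1 - k))) + Digamma (of_nat (m - (m - 1 - k)))) / (a - of_nat (Suc (m - 1 - k))) =
       (Digamma (of_nat (m - k)) + Digamma (of_nat (k + 1))) / (a - of_nat m + of_nat k)"
      unfolding j_def[symmetric] by (simp only:)
  qed auto
  have "gen_int_rhs_diag \<alpha> \<theta> = (-1) ^ m / (2 * Gamma a * Gamma (a - of_nat m)) * diag_bracket a m"
    unfolding gen_int_rhs_diag_def Let_def m_def[symmetric] minus_one_powi simps sum sym(2) diag_bracket_def
    using sym(1) by (simp only: add.assoc)
  also have "(-1) ^ m / (2 * Gamma a * Gamma (a - of_nat m)) = ((-1) ^ m * rGamma (a - of_nat m)) * rGamma a / 2"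
  proof -
    have "c / (2 * x * y) = (c * inverse y) * inverse x / 2" for c x y :: complex
      by (simp only: divide_inverse inverse_mult_distrib mult_ac)
    thus ?thesis unfolding rGamma_inverse_Gamma .
  qed
  also have "((-1) ^ m * rGamma (a - of_nat m)) * rGamma a / 2 = (rGamma a)\<^sup>2 * pochhammer (1 - a) m / 2"
    unfolding rGamma_diff_of_nat by (simp add: power2_eq_square)
  finally show ?thesis unfolding diag_val_regular[OF ra] a_def[symmetric] m_def[symmetric] .
qed

section \<open>Continuity in the parameters\<close>

lemma continuous_on_deriv_rGamma:
  assumes "continuous_on S f"
  shows "continuous_on S (\<lambda>x. deriv rGamma (f x :: complex))" "continuous_on S (\<lambda>x. deriv (deriv rGamma) (f x :: complex))"
proof -
  have "continuous_on UNIV (deriv rGamma :: complex \<Rightarrow> complex)"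
    by (rule holomorphic_on_imp_continuous_on[OF deriv_rGamma_holomorphic])
  from continuous_on_compose2[OF this assms] show "continuous_on S (\<lambda>x. deriv rGamma (f x :: complex))" by simp
  have "deriv (deriv rGamma) holomorphic_on (UNIV :: complex set)"
    by (intro holomorphic_deriv deriv_rGamma_holomorphic) auto
  from continuous_on_compose2[OF holomorphic_on_imp_continuous_on[OF this] assms]
  show "continuous_on S (\<lambda>x. deriv (deriv rGamma) (f x :: complex))" by simp
qed

lemma continuous_on_rGamma': "continuous_on S f \<Longrightarrow> continuous_on S (\<lambda>x. rGamma (f x :: complex))"
  using continuous_on_compose2[OF continuous_on_rGamma[of UNIV]] by auto

lemma continuous_on_pochhammer': "continuous_on S f \<Longrightarrow> continuous_on S (\<lambda>x. pochhammer (f x :: complex) n)"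
  unfolding pochhammer_prod by (intro continuous_intros)

lemma continuous_on_tricomi_const: "continuous_on S f \<Longrightarrow> continuous_on S (\<lambda>x. tricomi_const (f x) m)"
  by (induction m) (auto intro!: continuous_intros continuous_on_deriv_rGamma continuous_on_rGamma' continuous_on_pochhammer' simp del: of_nat_Suc)

lemma continuous_on_gen_bdry:
  "continuous_on S f \<Longrightarrow> continuous_on S g \<Longrightarrow> continuous_on S (\<lambda>x. gen_bdry (f x) (g x) m)"
  unfolding gen_bdry_def
  by (intro continuous_intros continuous_on_rGamma' continuous_on_pochhammer' continuous_on_tricomi_const) auto

lemma continuous_on_offdiag_val:
  assumes "continuous_on S f" "continuous_on S g" "\<And>x. x \<in> S \<Longrightarrow> f x \<noteq> g x"
  shows "continuous_on S (\<lambda>x. offdiag_val (f x) (g x) m)"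
  using assms
  by (induction m) (auto intro!: continuous_intros continuous_on_deriv_rGamma continuous_on_rGamma' continuous_on_gen_bdry simp del: of_nat_Suc)

lemma continuous_on_diag_val:
  assumes "continuous_on S f"
  shows "continuous_on S (\<lambda>x. diag_val (f x) m)"
  using assms
  by (induction m) (auto simp: square_val_def intro!: continuous_intros continuous_on_deriv_rGamma continuous_on_rGamma' continuous_on_gen_bdry simp del: of_nat_Suc)

text \<open>Non-integral parameters are regular, so every point has regular parameters arbitrarily close to it.\<close>
lemma regular_shift_exists:
  assumes e: "e > 0" and F: "finite F"
  obtains t where "0 < t" "t < e" "\<And>\<theta>. \<theta> \<in> F \<Longrightarrow> \<theta> + of_real t \<in> regular_params \<alpha>"
proof -
  define B where "B = (\<Union>\<theta>\<in>F. (\<lambda>n::int. of_int n - Re \<theta>) ` UNIV)"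
  have "countable B" unfolding B_def using F by (intro countable_UN countable_image) (auto intro: countable_finite)
  moreover have "uncountable {0<..<e}" using e by (simp add: uncountable_open_interval)
  ultimately have "\<not> {0<..<e} \<subseteq> B" using countable_subset by blast
  then obtain t where t: "t \<in> {0<..<e}" "t \<notin> B" by blast
  have "\<theta> + of_real t \<in> regular_params \<alpha>" if "\<theta> \<in> F" for \<theta>
  proof (rule ccontr)
    assume "\<theta> + of_real t \<notin> regular_params \<alpha>"
    hence "(1 + (\<theta> + of_real t) + of_int \<alpha>) / 2 \<in> \<int>\<^sub>\<le>\<^sub>0 \<or> (1 + (\<theta> + of_real t) - of_int \<alpha>) / 2 \<in> \<int>\<^sub>\<le>\<^sub>0"
      by (simp add: regular_params_def)
    hence "\<exists>n::int. (1 + (\<theta> + of_real t) + of_int \<alpha>) / 2 = of_int n \<or> (1 + (\<theta> + of_real t) - of_int \<alpha>) / 2 = of_int n"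
      by (blast elim: nonpos_Ints_cases)
    then obtain n :: int where "(1 + (\<theta> + of_real t) + of_int \<alpha>) / 2 = of_int n \<or> (1 + (\<theta> + of_real t) - of_int \<alpha>) / 2 = of_int n"
      by blast
    hence "\<theta> + of_real t = of_int (2 * n - 1 - \<alpha>) \<or> \<theta> + of_real t = of_int (2 * n - 1 + \<alpha>)"
      by (auto simp: field_simps)
    hence "Re \<theta> + t = of_int (2 * n - 1 - \<alpha>) \<or> Re \<theta> + t = of_int (2 * n - 1 + \<alpha>)"
      by (metis Re_complex_of_real plus_complex.sel(1) of_real_of_int_eq)
    hence "t = of_int (2 * n - 1 - \<alpha>) - Re \<theta> \<or> t = of_int (2 * n - 1 + \<alpha>) - Re \<theta>" by linarith
    hence "t \<in> B" using that unfolding B_def by blast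
    thus False using t by simp
  qed
  with t that show ?thesis by auto
qed

lemma regular_params_islimpt: "\<theta> islimpt regular_params \<alpha>"
  unfolding islimpt_approachable
proof (intro allI impI)
  fix e :: real assume "e > 0"
  obtain t where t: "0 < t" "t < e" "\<theta> + of_real t \<in> regular_params \<alpha>"
    using regular_shift_exists[OF \<open>e > 0\<close>, of "{\<theta>}"] by auto
  thus "\<exists>x'\<in>regular_params \<alpha>. x' \<noteq> \<theta> \<and> dist x' \<theta> < e"
    by (intro bexI[of _ "\<theta> + of_real t"]) (auto simp: dist_norm)
qed

lemma regular_param_pairs_islimpt:
  assumes "\<theta>1 \<noteq> \<theta>2"
  shows "(\<theta>1, \<theta>2) islimpt regular_param_pairs \<alpha>"
  unfolding islimpt_approachable
proof (intro allI impI)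
  fix e :: real assume "e > 0"
  hence "e / 2 > 0" by simp
  obtain t where t: "0 < t" "t < e / 2" "\<theta>1 + of_real t \<in> regular_params \<alpha>" "\<theta>2 + of_real t \<in> regular_params \<alpha>"
    by (rule regular_shift_exists[OF \<open>e / 2 > 0\<close>, of "{\<theta>1, \<theta>2}" \<alpha>]) auto
  have "dist (\<theta>1 + of_real t, \<theta>2 + of_real t) (\<theta>1, \<theta>2) = sqrt (t\<^sup>2 + t\<^sup>2)"
    unfolding dist_Pair_Pair using t by (simp add: dist_norm)
  also have "\<dots> \<le> t + t" using sqrt_sum_squares_le_sum[of t t] t by simp
  finally have "dist (\<theta>1 + of_real t, \<theta>2 + of_real t) (\<theta>1, \<theta>2) < e" using t by simp
  moreover have "(\<theta>1 + of_real t, \<theta>2 + of_real t) \<in> regular_param_pairs \<alpha>"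
    using t assms by (simp add: regular_param_pairs_def)
  ultimately show "\<exists>x'\<in>regular_param_pairs \<alpha>. x' \<noteq> (\<theta>1, \<theta>2) \<and> dist x' (\<theta>1, \<theta>2) < e"
    using t by (intro bexI[of _ "(\<theta>1 + of_real t, \<theta>2 + of_real t)"]) auto
qed

lemma continued_valueI:
  fixes F G :: "'a::t2_space \<Rightarrow> complex"
  assumes "p islimpt S" "open U" "p \<in> U" "continuous_on U G" "\<And>x. x \<in> S \<Longrightarrow> F x = G x"
  shows "continued_value F S p (G p)"
proof -
  have "isCont G p" using assms(2-4) by (simp add: continuous_on_eq_continuous_at)
  hence "(G \<longlongrightarrow> G p) (at p within S)"
    unfolding isCont_def by (rule tendsto_within_subset) simp
  moreover have "eventually (\<lambda>x. G x = F x) (at p within S)"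
    using assms(5) by (auto simp: eventually_at_filter)
  ultimately have "(F \<longlongrightarrow> G p) (at p within S)" by (rule Lim_transform_eventually)
  with assms show ?thesis by (auto simp: continued_value_def)
qed

section \<open>The theorem\<close>

lemma (in tricomi) Tricomi_U_Lie_eq:
  assumes a: "a = kummer_param \<alpha> \<theta>" and z: "z > 0"
  shows "Tricomi_U_Lie \<theta> (of_int \<alpha>) z = (if \<alpha> \<ge> 0 then f (nat \<bar>\<alpha>\<bar>) z else of_real z ^ nat \<bar>\<alpha>\<bar> * f (nat \<bar>\<alpha>\<bar>) z)"
proof (cases "\<alpha> \<ge> 0")
  case True
  define m where "m = nat \<bar>\<alpha>\<bar>"
  have m: "of_int \<alpha> = (of_nat m :: complex)" using True by (simp add: m_def)
  have args: "(1 + of_int \<alpha> + \<theta>) / 2 = a" "1 + of_int \<alpha> = (1 + of_nat m :: complex)"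
    unfolding a kummer_param_def m m_def[symmetric] by (simp_all add: add_ac)
  show ?thesis
    unfolding Tricomi_U_Lie_def unfolding args(1) unfolding args(2) m_def[symmetric] using True Tricomi_U_eq_f[OF z, of m] by simp
next
  case False
  define m where "m = nat \<bar>\<alpha>\<bar>"
  have m: "of_int \<alpha> = (- of_nat m :: complex)" using False by (simp add: m_def)
  have args: "(1 + of_int \<alpha> + \<theta>) / 2 = a - of_nat m" "1 + of_int \<alpha> = (1 - of_nat m :: complex)"
    unfolding a kummer_param_def m m_def[symmetric] by (simp_all add: field_simps)
  show ?thesis
    unfolding Tricomi_U_Lie_def unfolding args(1) unfolding args(2) m_def[symmetric] using False Tricomi_U_eq_f_neg[OF z, of m] by simp
qed

lemma (in two_tricomi) integrand_eq:
  assumes "a = kummer_param \<alpha> \<theta>1" "b = kummer_param \<alpha> \<theta>2" and z: "z > 0"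
  defines "m \<equiv> nat \<bar>\<alpha>\<bar>"
  shows "Tricomi_U_Lie \<theta>1 (of_int \<alpha>) z * Tricomi_U_Lie \<theta>2 (of_int \<alpha>) z * exp (- of_real z) * of_real z powi \<alpha> = of_real z ^ m * A.f m z * B.g m z"
proof -
  have e: "exp (- of_real z) = (of_real (exp (- z)) :: complex)" by (simp flip: exp_of_real)
  show ?thesis
  proof (cases "\<alpha> \<ge> 0")
    case True
    thus ?thesis using A.Tricomi_U_Lie_eq[OF assms(1) z] B.Tricomi_U_Lie_eq[OF assms(2) z] e
      by (simp add: power_int_def m_def)
  next
    case False
    hence p: "of_real z powi \<alpha> = inverse (of_real z ^ m :: complex)"
      by (simp add: power_int_def m_def power_inverse)
    show ?thesis
      using A.Tricomi_U_Lie_eq[OF assms(1) z] B.Tricomi_U_Lie_eq[OF assms(2) z] e z False unfolding p m_def[symmetric]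
      by (simp add: field_simps)
  qed
qed

theorem theorem2p2:
  fixes \<alpha> :: int
  shows
    "(\<forall>\<theta>1 \<theta>2 :: complex. \<theta>1 \<noteq> \<theta>2 \<longrightarrow>
        (let f = (\<lambda>z::real. Tricomi_U_Lie \<theta>1 (of_int \<alpha>) z * Tricomi_U_Lie \<theta>2 (of_int \<alpha>) z
                            * exp (- of_real z) * of_real z powi \<alpha>) in
           gen_integrable f \<and>
           continued_value (\<lambda>(t1, t2). gen_int_rhs_offdiag \<alpha> t1 t2)
             (regular_param_pairs \<alpha>) (\<theta>1, \<theta>2) (gen_integral f)))
   \<and> (\<forall>\<theta> :: complex.
        (let f = (\<lambda>z::real. (Tricomi_U_Lie \<theta> (of_int \<alpha>) z)\<^sup>2
                            * exp (- of_real z) * of_real z powi \<alpha>) in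
           gen_integrable f \<and>
           continued_value (gen_int_rhs_diag \<alpha>)
             (regular_params \<alpha>) \<theta> (gen_integral f)))"
proof (intro conjI allI impI)
  fix \<theta>1 \<theta>2 :: complex assume ne: "\<theta>1 \<noteq> \<theta>2"
  define a where "a = kummer_param \<alpha> \<theta>1"
  define b where "b = kummer_param \<alpha> \<theta>2"
  define m where "m = nat \<bar>\<alpha>\<bar>"
  have ab: "a \<noteq> b" using ne by (simp add: a_def b_def kummer_param_def)
  obtain u v where uv: "tricomi_pair a u v" by (rule tricomi_pair_exists)
  obtain w x where wx: "tricomi_pair b w x" by (rule tricomi_pair_exists)
  interpret two_tricomi a b u v w x using uv wx by unfold_locales
  let ?f = "\<lambda>z::real. Tricomi_U_Lie \<theta>1 (of_int \<alpha>) z * Tricomi_U_Lie \<theta>2 (of_int \<alpha>) z * exp (- of_real z) * of_real z powi \<alpha>"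
  have f: "has_gen_integral ?f (offdiag_val a b m)"
    by (rule has_gen_integral_cong[OF _ has_gen_integral_offdiag[OF ab, of m]])
       (simp only: integrand_eq[OF a_def b_def] prod_fun_def m_def)
  have ne_set: "open {p :: complex \<times> complex. fst p \<noteq> snd p}"
    by (intro open_Collect_neq continuous_intros)
  have "continued_value (\<lambda>(t1, t2). gen_int_rhs_offdiag \<alpha> t1 t2) (regular_param_pairs \<alpha>) (\<theta>1, \<theta>2)
      ((\<lambda>p. offdiag_val (kummer_param \<alpha> (fst p)) (kummer_param \<alpha> (snd p)) m) (\<theta>1, \<theta>2))"
  proof (rule continued_valueI[OF regular_param_pairs_islimpt[OF ne] ne_set])
    show "continuous_on {p. fst p \<noteq> snd p} (\<lambda>p. offdiag_val (kummer_param \<alpha> (fst p)) (kummer_param \<alpha> (snd p)) m)"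
      unfolding kummer_param_def by (intro continuous_on_offdiag_val continuous_intros) auto
  qed (use ne gen_int_rhs_offdiag_eq in \<open>auto simp: regular_param_pairs_def m_def\<close>)
  with f show "let f = ?f in gen_integrable f \<and>
       continued_value (\<lambda>(t1, t2). gen_int_rhs_offdiag \<alpha> t1 t2) (regular_param_pairs \<alpha>) (\<theta>1, \<theta>2) (gen_integral f)"
    unfolding Let_def gen_integrable_def gen_integral_eqI[OF f] by (auto simp: a_def b_def)
next
  fix \<theta> :: complex
  define a where "a = kummer_param \<alpha> \<theta>"
  define m where "m = nat \<bar>\<alpha>\<bar>"
  obtain u v where uv: "tricomi_pair a u v"
    and sq: "has_gen_integral (\<lambda>z. u z * (of_real (exp (- z)) * u z)) (square_val a)" by (rule tricomi_pair_exists)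
  interpret D: two_tricomi a a u v u v using uv by unfold_locales
  let ?f = "\<lambda>z::real. (Tricomi_U_Lie \<theta> (of_int \<alpha>) z)\<^sup>2 * exp (- of_real z) * of_real z powi \<alpha>"
  have f: "has_gen_integral ?f (diag_val a m)"
    by (rule has_gen_integral_cong[OF _ D.A.has_gen_integral_diag[OF sq, of m]])
       (simp only: D.integrand_eq[OF a_def a_def] power2_eq_square m_def)
  have "continued_value (gen_int_rhs_diag \<alpha>) (regular_params \<alpha>) \<theta> ((\<lambda>t. diag_val (kummer_param \<alpha> t) m) \<theta>)"
  proof (rule continued_valueI[OF regular_params_islimpt open_UNIV])
    show "continuous_on UNIV (\<lambda>t. diag_val (kummer_param \<alpha> t) m)"
      unfolding kummer_param_def by (intro continuous_on_diag_val continuous_intros) auto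
  qed (auto simp: gen_int_rhs_diag_eq m_def)
  with f show "let f = ?f in gen_integrable f \<and> continued_value (gen_int_rhs_diag \<alpha>) (regular_params \<alpha>) \<theta> (gen_integral f)"
    unfolding Let_def gen_integrable_def gen_integral_eqI[OF f] by (auto simp: a_def)
qed

end
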